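(* Suppose there is $(\beta^*,\theta^* )\in\mathbb R^q\times\Theta$ such that for all $\mathbf X$ the distribution of $\mathbf y\mid\mathbf X$ under $P$ has the elliptically contoured density $f_{\mu,\Sigma}$ with $\mu=\mathbf X\beta^*$ and $\Sigma=\mathbf V(\theta^* )$, and suppose $\mathbb E\|\mathbf X\|^2<\infty$. Let $\rho_1$ be such that for some finite $c_1>0$ it is non-decreasing on $[0,c_1]$ and constant on $[c_1,\infty)$, $\rho_1$ is twice continuously differentiable, and $u_1(s)=\rho_1'(s)/s$ is continuous. Suppose $\mathbf V$ is twice continuously differentiable and has the linear structure $\mathbf V(\gamma)=\sum_{j=1}^l\gamma_j\mathbf L_j$. Fix $\mathbf s_0=(\mathbf y_0,\mathbf X_0)\in\mathbb R^k\times\mathbb R^{kq}$. Let $\sigma(P)$ be a solution of the scale equation at $P$ and let $\xi(P)=(\beta_1(P),\gamma(P))\in\mathfrak D$ be a local minimum of $R_P(\beta,\mathbf V(\gamma))$ that satisfies $\beta_1(P)=\beta^*$ and $\mathbf V(\gamma(P))=\Sigma/|\Sigma|^{1/k}$. Let $\sigma(P_{h,\mathbf s_0})$ be a solution of the scale equation at $P_{h,\mathbf s_0}$ and let $\xi(P_{h,\mathbf s_0})=(\beta_1(P_{h,\mathbf s_0}),\gamma(P_{h,\mathbf s_0}))\in\mathfrak D$ be a local minimum of $R_{P_{h,\mathbf s_0}}(\beta,\mathbf V(\gamma))$. Suppose $(\xi(P_{h,\mathbf s_0}),\sigma(P_{h,\mathbf s_0}))\to(\xi(P),\sigma(P))$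 as $h\downarrow0$. Put $c_\sigma=|\Sigma|^{1/(2k)}/\sigma(P)$, $\mathbf z_0=\Sigma^{-1/2}(\mathbf y_0-\mathbf X_0\beta^* )$, $v_1(s)=\rho_1'(s)s$, $$\alpha_1=\mathbb E_{\mathbf 0,\mathbf I_k}\left[\left(1-\frac1k\right)\frac{\rho_1'(c_\sigma\|\mathbf z\|)}{c_\sigma\|\mathbf z\|}+\frac1k\rho_1''(c_\sigma\|\mathbf z\|)\right],$$ $$\gamma_1=\frac{\mathbb E_{\mathbf 0,\mathbf I_k}\left[\rho_1''(c_\sigma\|\mathbf z\|)(c_\sigma\|\mathbf z\|)^2+(k+1)\rho_1'(c_\sigma\|\mathbf z\|)c_\sigma\|\mathbf z\|\right]}{k+2}.$$ Suppose $\alpha_1\ne0$ and that $\mathbf X$ has full rank with probability one (so that $\mathbb E[\mathbf X^T\Sigma^{-1}\mathbf X]$ is non-singular). Then $$\mathrm{IF}(\mathbf s_0;\beta_1,P)=\frac{u_1(c_\sigma\|\mathbf z_0\|)}{\alpha_1}\left(\mathbb E[\mathbf X^T\Sigma^{-1}\mathbf X]\right)^{-1}\mathbf X_0^T\Sigma^{-1/2}\mathbf z_0 .$$ In addition, suppose that $\mathrm{IF}(\mathbf s_0;\sigma,P)$ exists, that $\gamma_1>0$, and that the $k^2\times l$ matrix $\mathbf L=[\mathrm{vec}(\mathbf L_1)\ \cdots\ \mathrm{vec}(\mathbf L_l)]$ has full rank. Then $$\mathrm{IF}(\mathbf s_0;\gamma,P)=\frac{k\,u_1(c_\sigma\|\mathbf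 z_0\|)}{\sigma^2(P)\gamma_1}\left(\mathbf L^T(\Sigma^{-1}\otimes\Sigma^{-1})\mathbf L\right)^{-1}\mathbf L^T(\Sigma^{-1/2}\otimes\Sigma^{-1/2})\mathrm{vec}(\mathbf z_0\mathbf z_0^T)-\frac{v_1(c_\sigma\|\mathbf z_0\|)}{|\Sigma|^{1/k}\gamma_1}\theta^* .$$
   Context: Fix positive integers $k,q,l$. A point $\mathbf s=(\mathbf y,\mathbf X)$, with $\mathbf y\in\mathbb R^k$ and $\mathbf X\in\mathbb R^{k\times q}$, is identified with a point of $\mathbb R^k\times\mathbb R^{kq}$; $P$ is a probability measure on this space and $\mathbb E$ is expectation under $P$. $\mathrm{PDS}(k)$ is the set of positive definite symmetric $k\times k$ matrices; $|\mathbf A|$ is the determinant; $\mathrm{vec}$ stacks the columns of a matrix; $\otimes$ is the Kronecker product. $\Theta\subset\mathbb R^l$ and $\mathbf V:\Theta\to\mathrm{PDS}(k)$ is a known injective (identifiable) map; in the linear structure $\mathbf L_1,\dots,\mathbf L_l$ are known symmetric $k\times k$ matrices. Put $\Gamma(\theta)=\mathbf V(\theta)/|\mathbf V(\theta)|^{1/k}$ and $\mathfrak D=\{(\beta,\gamma)\in\mathbb R^q\times\Theta:\mathbf V(\gamma)\in\mathrm{PDS}(k),\ |\mathbf V(\gamma)|=1\}$. $\rho_0,\rho_1:\mathbb R\to[0,\infty)$ are the loss functions and $0<b_0<\sup\rho_0$. Initial functionals $Q\mapsto(\beta_0(Q),\theta_0(Q))\in\mathbb R^q\times\Theta$ are given.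 The scale equation at $Q$, to be solved for $\sigma=\sigma(Q)>0$, is $$\int\rho_0\left(\frac{\sqrt{(\mathbf y-\mathbf X\beta_0(Q))^T\Gamma(\theta_0(Q))^{-1}(\mathbf y-\mathbf X\beta_0(Q))}}{\sigma}\right)dQ(\mathbf s)=b_0,$$ and $R_Q(\beta,\mathbf C)=\int\rho_1\big(\sqrt{(\mathbf y-\mathbf X\beta)^T\mathbf C^{-1}(\mathbf y-\mathbf X\beta)}/\sigma(Q)\big)\,dQ(\mathbf s)$. Local minima of $R_Q(\beta,\mathbf V(\gamma))$ are local minima over $(\beta,\gamma)\in\mathfrak D$. The elliptically contoured density is $f_{\mu,\Sigma}(\mathbf y)=|\Sigma|^{-1/2}m\big((\mathbf y-\mu)^T\Sigma^{-1}(\mathbf y-\mu)\big)$ for a fixed $m:[0,\infty)\to[0,\infty)$; $\mathbb E_{\mathbf 0,\mathbf I_k}$ denotes expectation for $\mathbf z$ with density $f_{\mathbf 0,\mathbf I_k}$. For $0<h<1$, $P_{h,\mathbf s}=(1-h)P+h\delta_{\mathbf s}$ with $\delta_{\mathbf s}$ the Dirac measure. The influence function of a functional $T$ is $\mathrm{IF}(\mathbf s;T,P)=\lim_{h\downarrow0}\{T(P_{h,\mathbf s})-T(P)\}/h$; the claims include existence of the limit.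
   Formalization: The formula for IF(s_0; γ, P) is proved under the added assumption that γ(P) is an interior point of Θ (automatic for open Θ; it fails e.g. for Θ a single point); "X has full rank" is read as full column rank q. *)

theory Defs
  imports "HOL-Probability.Probability"
begin

type_synonym ('k, 'q) obs = "(real ^ 'k) \<times> (real ^ 'q ^ 'k)"

definition PDS :: "(real ^ 'k ^ 'k) set" where
  "PDS = {A. transpose A = A \<and> (\<forall>x. x \<noteq> 0 \<longrightarrow> x \<bullet> (A *v x) > 0)}"

text \<open>The symmetric positive definite square root; it exists and is unique for \<open>A \<in> PDS\<close>.\<close>

definition pd_sqrt :: "real ^ 'k ^ 'k \<Rightarrow> real ^ 'k ^ 'k" where
  "pd_sqrt A = (THE B. B \<in> PDS \<and> B ** B = A)"

definition inv_sqrt :: "real ^ 'k ^ 'k \<Rightarrow> real ^ 'k ^ 'k" where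
  "inv_sqrt A = matrix_inv (pd_sqrt A)"

text \<open>Entries of the stacked vector are indexed by (column, row), i.e. the entry (c, r) of
  \<open>vectorize A\<close> is the r-th entry of the c-th block.  In the Kronecker product the first
  component is likewise the block index, so that
  \<open>kronecker A B *v vectorize C = vectorize (B ** C ** transpose A)\<close>.\<close>

definition vectorize :: "real ^ 'n ^ 'm \<Rightarrow> real ^ ('n \<times> 'm)" where
  "vectorize A = (\<chi> p. A $ snd p $ fst p)"

definition kronecker ::
    "real ^ 'n ^ 'm \<Rightarrow> real ^ 'b ^ 'a \<Rightarrow> real ^ ('n \<times> 'b) ^ ('m \<times> 'a)" where
  "kronecker A B = (\<chi> p r. A $ fst p $ fst r * B $ snd p $ snd r)"

definition vectorized_columns :: "('l \<Rightarrow> real ^ 'k ^ 'k) \<Rightarrow> real ^ 'l ^ ('k \<times> 'k)" where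
  "vectorized_columns L = (\<chi> p j. vectorize (L j) $ p)"

definition outer :: "real ^ 'k \<Rightarrow> real ^ 'k ^ 'k" where
  "outer z = (\<chi> i j. z $ i * z $ j)"

definition det_normalized :: "real ^ 'k ^ 'k \<Rightarrow> real ^ 'k ^ 'k" where
  "det_normalized A = (1 / det A powr (1 / CARD('k))) *\<^sub>R A"

text \<open>Derivatives are taken within \<open>S\<close>, which for open \<open>S\<close> is the usual notion.\<close>

definition C2_on :: "('a::real_normed_vector \<Rightarrow> 'b::real_normed_vector) \<Rightarrow> 'a set \<Rightarrow> bool" where
  "C2_on f S \<longleftrightarrow>
     (\<exists>(f' :: 'a \<Rightarrow> 'a \<Rightarrow>\<^sub>L 'b) (f'' :: 'a \<Rightarrow> 'a \<Rightarrow>\<^sub>L ('a \<Rightarrow>\<^sub>L 'b)).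
        (\<forall>x\<in>S. (f has_derivative blinfun_apply (f' x)) (at x within S)) \<and>
        (\<forall>x\<in>S. (f' has_derivative blinfun_apply (f'' x)) (at x within S)) \<and>
        continuous_on S f'')"

definition local_min_on :: "('a::topological_space \<Rightarrow> real) \<Rightarrow> 'a set \<Rightarrow> 'a \<Rightarrow> bool" where
  "local_min_on f S x \<longleftrightarrow> x \<in> S \<and> (\<forall>\<^sub>F y in at x within S. f x \<le> f y)"

text \<open>The value at \<open>0\<close> is the only one that can make \<open>\<rho>'(s) / s\<close> continuous there; with it, the
  function is continuous iff \<open>\<rho>'(0) = 0\<close> when \<open>\<rho>\<close> is twice continuously differentiable.\<close>

definition u_fun :: "(real \<Rightarrow> real) \<Rightarrow> real \<Rightarrow> real" where
  "u_fun \<rho> s = (if s = 0 then deriv (deriv \<rho>) 0 else deriv \<rho> s / s)"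

definition v_fun :: "(real \<Rightarrow> real) \<Rightarrow> real \<Rightarrow> real" where
  "v_fun \<rho> s = deriv \<rho> s * s"

definition elliptical_density ::
    "(real \<Rightarrow> real) \<Rightarrow> real ^ 'k \<Rightarrow> real ^ 'k ^ 'k \<Rightarrow> real ^ 'k \<Rightarrow> real" where
  "elliptical_density m \<mu> \<Sigma> y =
     det \<Sigma> powr (- 1 / 2) * m ((y - \<mu>) \<bullet> (matrix_inv \<Sigma> *v (y - \<mu>)))"

text \<open>The probability kernel \<open>x \<mapsto> g x dy\<close> is a regular conditional distribution of the first
  coordinate given the second.\<close>

definition has_conditional_density ::
    "('a::euclidean_space \<times> 'b::euclidean_space) measure \<Rightarrow> ('b \<Rightarrow> 'a \<Rightarrow> real) \<Rightarrow> bool" where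
  "has_conditional_density P g \<longleftrightarrow>
     (\<lambda>(y, x). g x y) \<in> borel_measurable borel \<and>
     (\<forall>x y. 0 \<le> g x y) \<and>
     (\<forall>x. (\<integral>\<^sup>+ y. ennreal (g x y) \<partial>lborel) = 1) \<and>
     (\<forall>A\<in>sets borel. emeasure P A =
        (\<integral>\<^sup>+ x. (\<integral>\<^sup>+ y. ennreal (g x y) * indicator A (y, x) \<partial>lborel) \<partial>distr P borel snd))"

definition spherical_expectation ::
    "(real \<Rightarrow> real) \<Rightarrow> (real ^ 'k \<Rightarrow> real) \<Rightarrow> real" where
  "spherical_expectation m g =
     (\<integral>z. g z \<partial>density lborel (\<lambda>z. ennreal (elliptical_density m 0 (mat 1) z)))"

definition contaminated :: "'a measure \<Rightarrow> 'a \<Rightarrow> real \<Rightarrow> 'a measure" where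
  "contaminated P s h = measure_of (space P) (sets P)
     (\<lambda>A. ennreal (1 - h) * emeasure P A + ennreal h * emeasure (return P s) A)"

definition has_influence ::
    "('a measure \<Rightarrow> 'b::real_normed_vector) \<Rightarrow> 'a measure \<Rightarrow> 'a \<Rightarrow> 'b \<Rightarrow> bool" where
  "has_influence T P s v \<longleftrightarrow>
     ((\<lambda>h. (T (contaminated P s h) - T P) /\<^sub>R h) \<longlongrightarrow> v) (at_right 0)"

definition mahalanobis ::
    "real ^ 'q \<Rightarrow> real ^ 'k ^ 'k \<Rightarrow> ('k, 'q) obs \<Rightarrow> real" where
  "mahalanobis \<beta> C = (\<lambda>(y, X). sqrt ((y - X *v \<beta>) \<bullet> (matrix_inv C *v (y - X *v \<beta>))))"

definition scale_solution ::
    "(real \<Rightarrow> real) \<Rightarrow> real \<Rightarrow> (real ^ 'l \<Rightarrow> real ^ 'k ^ 'k) \<Rightarrow>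
     (('k, 'q) obs measure \<Rightarrow> real ^ 'q) \<Rightarrow> (('k, 'q) obs measure \<Rightarrow> real ^ 'l) \<Rightarrow>
     ('k, 'q) obs measure \<Rightarrow> real \<Rightarrow> bool" where
  "scale_solution \<rho>0 b0 V \<beta>0 \<theta>0 Q \<sigma> \<longleftrightarrow> 0 < \<sigma> \<and>
     has_bochner_integral Q
       (\<lambda>s. \<rho>0 (mahalanobis (\<beta>0 Q) (det_normalized (V (\<theta>0 Q))) s / \<sigma>)) b0"

definition R_crit ::
    "(real \<Rightarrow> real) \<Rightarrow> ('k, 'q) obs measure \<Rightarrow> real \<Rightarrow> real ^ 'q \<Rightarrow> real ^ 'k ^ 'k \<Rightarrow> real" where
  "R_crit \<rho>1 Q \<sigma> \<beta> C = (\<integral>s. \<rho>1 (mahalanobis \<beta> C s / \<sigma>) \<partial>Q)"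

definition param_domain ::
    "(real ^ 'l \<Rightarrow> real ^ 'k ^ 'k) \<Rightarrow> (real ^ 'l) set \<Rightarrow> ((real ^ 'q) \<times> (real ^ 'l)) set" where
  "param_domain V \<Theta> = {(\<beta>, \<gamma>). \<gamma> \<in> \<Theta> \<and> V \<gamma> \<in> PDS \<and> det (V \<gamma>) = 1}"

definition R_local_min ::
    "(real \<Rightarrow> real) \<Rightarrow> (real ^ 'l \<Rightarrow> real ^ 'k ^ 'k) \<Rightarrow> (real ^ 'l) set \<Rightarrow>
     ('k, 'q) obs measure \<Rightarrow> real \<Rightarrow> (real ^ 'q) \<times> (real ^ 'l) \<Rightarrow> bool" where
  "R_local_min \<rho>1 V \<Theta> Q \<sigma> \<xi> \<longleftrightarrow>
     local_min_on (\<lambda>(\<beta>, \<gamma>). R_crit \<rho>1 Q \<sigma> \<beta> (V \<gamma>)) (param_domain V \<Theta>) \<xi>"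

definition alpha1 :: "'k::finite itself \<Rightarrow> (real \<Rightarrow> real) \<Rightarrow> (real \<Rightarrow> real) \<Rightarrow> real \<Rightarrow> real" where
  "alpha1 _ m \<rho>1 c =
     spherical_expectation m (\<lambda>z :: real ^ 'k.
       (1 - 1 / CARD('k)) * (deriv \<rho>1 (c * norm z) / (c * norm z))
       + 1 / CARD('k) * deriv (deriv \<rho>1) (c * norm z))"

definition gamma1 :: "'k::finite itself \<Rightarrow> (real \<Rightarrow> real) \<Rightarrow> (real \<Rightarrow> real) \<Rightarrow> real \<Rightarrow> real" where
  "gamma1 _ m \<rho>1 c =
     spherical_expectation m (\<lambda>z :: real ^ 'k.
       deriv (deriv \<rho>1) (c * norm z) * (c * norm z)\<^sup>2
       + (CARD('k) + 1) * deriv \<rho>1 (c * norm z) * (c * norm z)) / (CARD('k) + 2)"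

end

theory Submission
  imports Defs
begin

text \<open>Both influence functions come from linearizing the stationarity equations of the local minima at
  \<open>P\<^sub>h = (1 - h) P + h \<delta>\<^sub>s\<close>.

  Standardization.  Put \<open>z = \<Sigma>\<^sup>-\<^sup>1\<^sup>/\<^sup>2 (y - X \<beta>\<^sup>*)\<close> and replace \<open>X\<close> by \<open>\<Sigma>\<^sup>-\<^sup>1\<^sup>/\<^sup>2 X\<close>.  Under \<open>P\<close> the pair then
  has a product law: \<open>z\<close> is spherical and independent of the design (\<open>standardized_law\<close>).  The
  estimates at \<open>P\<^sub>h\<close> become a small vector \<open>\<delta> = \<beta>\<^sub>1(P\<^sub>h) - \<beta>\<^sup>*\<close> and a positive definite form \<open>T\<close> close to
  \<open>g I\<close>, where \<open>g = c\<^sub>\<sigma>\<^sup>2\<close>, and the loss of an observation is \<open>\<rho> (sqrt (r \<bullet> T r))\<close> with \<open>r = z - X \<delta>\<close>.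

  Stationarity.  Varying \<open>\<beta>\<close> along lines and \<open>\<gamma>\<close> along lines rescaled to determinant one
  (\<open>normalized_line\<close>) and differentiating under the integral sign gives, with weight
  \<open>w (q) = u (sqrt q)\<close> at \<open>q = r \<bullet> T r\<close>, the equations \<open>E\<^sub>h [w (X e \<bullet> T r)] = 0\<close> and \<open>E\<^sub>h [w (r \<bullet> B\<^sub>j r)] = 0\<close>
  (\<open>regression_stationary\<close>, \<open>shape_stationary\<close>).  Here \<open>B\<^sub>j = k T L\<^sub>j T - tr (T L\<^sub>j) T\<close>, where \<open>L\<^sub>j\<close> denotes the
  standardized structure matrix.  Because \<open>E\<^sub>h\<close> is a mixture, each equation has the form
  \<open>(1 - h) E [score] + h score(s) = 0\<close>, and the second term converges to an explicit function of \<open>z\<^sub>0\<close>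
  after division by \<open>h\<close>.

  Linearization.  It remains to find the first order term of \<open>E [score]\<close>.  The mean value theorem
  along the segment from the unperturbed to the perturbed parameters and dominated convergence
  express it by moments of the spherical law (\<open>regression_score_limit\<close>, \<open>weighted_scatter_limit\<close>,
  \<open>shape_score_limit\<close>).  Terms that are odd in \<open>z\<close> vanish; this decouples \<open>\<beta>\<close> from \<open>\<gamma>\<close> and \<open>\<sigma>\<close>.  The
  second and fourth moments are determined by rotation invariance (\<open>second_moment\<close>,
  \<open>matrix_fourth_moment\<close>) and produce the constants \<open>\<alpha>\<^sub>1\<close> and \<open>\<gamma>\<^sub>1\<close> (\<open>alpha_eq\<close>, \<open>gamma_eq\<close>).  A change of the
  scale only multiplies \<open>T\<close> by a factor, which leaves the expectation of the shape score at zero.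

  From limits to rates.  Nothing is known in advance about the size of the change of a parameter
  compared with \<open>h\<close>.  Therefore the equations are divided by \<open>h\<close> plus the norm of that change;
  along a subsequence the normalized change and the normalized \<open>h\<close> converge to some \<open>b\<close> and \<open>\<eta>\<close>, and the
  limit of the equations is the linear relation \<open>b = \<eta> l\<close>, which forces the rate \<open>l\<close>
  (\<open>rate_at_right\<close>).  For the shape, solving for \<open>b\<close> uses that \<open>b\<close> is tangent to the surface of
  determinant one (\<open>derivative_vanishes_along_level_set\<close>), so that the trace terms of the fourth moment drop
  out; the remaining system has the matrix \<open>L\<^sup>T (\<Sigma>\<^sup>-\<^sup>1 \<otimes> \<Sigma>\<^sup>-\<^sup>1) L\<close>, which is invertible because \<open>L\<close> has
  full rank.  Applying this matrix to \<open>\<theta>\<^sup>*\<close> yields the traces of the \<open>L\<^sub>j\<close>, whence the second term of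
  the formula for \<open>\<gamma>\<close>.\<close>

section \<open>Losses with redescending weight\<close>

text \<open>The tail where the loss is constant makes every weighted expectation below finite without
  moment assumptions on \<open>y\<close>.  The pair \<open>\<rho>, c1\<close> is fixed in a locale because the derived weights \<open>w\<close>
  and \<open>\<kappa>\<close> occur throughout.\<close>

locale redescending_loss =
  fixes \<rho> :: "real \<Rightarrow> real" and c1 :: real
  assumes c1_pos: "0 < c1"
    and eventually_constant: "\<And>s. c1 \<le> s \<Longrightarrow> \<rho> s = \<rho> c1"
    and twice_differentiable: "C2_on \<rho> UNIV"
    and continuous_u: "continuous_on UNIV (u_fun \<rho>)"
begin

text \<open>As a function of the squared radius, \<open>\<rho> (sqrt q)\<close> has derivative \<open>w q / 2\<close>, and \<open>w\<close> has derivative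
  \<open>\<kappa>\<close> away from \<open>q = 0\<close>.  Working with \<open>q\<close> instead of the radius keeps quadratic forms smooth at the
  origin; the only singularity left is that of \<open>\<kappa>\<close>, which is at most of order \<open>1 / q\<close>.  At \<open>q = 0\<close> the
  convention \<open>x / 0 = 0\<close> gives \<open>\<kappa> 0 = 0\<close>.\<close>

definition w :: "real \<Rightarrow> real" where
  "w q = u_fun \<rho> (sqrt q)"

definition \<kappa> :: "real \<Rightarrow> real" where
  "\<kappa> q = (deriv (deriv \<rho>) (sqrt q) - u_fun \<rho> (sqrt q)) / (2 * q)"

lemma derivatives:
  shows DERIV_rho: "(\<rho> has_real_derivative deriv \<rho> x) (at x)"
    and DERIV_deriv_rho: "(deriv \<rho> has_real_derivative deriv (deriv \<rho>) x) (at x)"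
    and continuous_deriv2: "continuous_on UNIV (deriv (deriv \<rho>))"
proof -
  obtain f' :: "real \<Rightarrow> real \<Rightarrow>\<^sub>L real" and f''
    where f': "\<And>x. (\<rho> has_derivative blinfun_apply (f' x)) (at x)"
      and f'': "\<And>x. (f' has_derivative blinfun_apply (f'' x)) (at x)"
      and cont: "continuous_on UNIV f''"
    using twice_differentiable unfolding C2_on_def by auto
  have mult_one: "blinfun_apply g = (*) (blinfun_apply g 1)" for g :: "real \<Rightarrow>\<^sub>L real"
    by (rule ext) (metis blinfun.scaleR_right mult.commute mult.right_neutral real_scaleR_def)
  have d1: "(\<rho> has_real_derivative blinfun_apply (f' x) 1) (at x)" for x
    using f'[of x] mult_one[of "f' x"] unfolding has_field_derivative_def by simp
  then have e1: "deriv \<rho> = (\<lambda>x. blinfun_apply (f' x) 1)"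
    by (intro ext DERIV_imp_deriv)
  have "((\<lambda>x. blinfun_apply (f' x) 1) has_derivative (\<lambda>h. blinfun_apply (blinfun_apply (f'' x) h) 1)) (at x)" for x
    by (rule bounded_linear.has_derivative[OF blinfun.bounded_linear_left f''])
  moreover have "(\<lambda>h. blinfun_apply (blinfun_apply (f'' x) h) 1) = (*) (blinfun_apply (blinfun_apply (f'' x) 1) 1)" for x
  proof
    fix h :: real
    have "blinfun_apply (f'' x) h = h *\<^sub>R blinfun_apply (f'' x) 1"
      by (metis blinfun.scaleR_right mult.right_neutral real_scaleR_def)
    then show "blinfun_apply (blinfun_apply (f'' x) h) 1 = blinfun_apply (blinfun_apply (f'' x) 1) 1 * h"
      by (simp add: blinfun.scaleR_left mult.commute)
  qed
  ultimately have d2: "(deriv \<rho> has_real_derivative blinfun_apply (blinfun_apply (f'' x) 1) 1) (at x)" for x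
    unfolding has_field_derivative_def e1 by metis
  then have e2: "deriv (deriv \<rho>) = (\<lambda>x. blinfun_apply (blinfun_apply (f'' x) 1) 1)"
    by (intro ext DERIV_imp_deriv)
  show "(\<rho> has_real_derivative deriv \<rho> x) (at x)" using d1 e1 by simp
  show "(deriv \<rho> has_real_derivative deriv (deriv \<rho>) x) (at x)" using d2 e2 by simp
  show "continuous_on UNIV (deriv (deriv \<rho>))"
    unfolding e2 by (intro continuous_intros cont)
qed

lemma continuous_rho: "continuous_on UNIV \<rho>"
proof (rule continuous_at_imp_continuous_on, rule ballI)
  fix x :: real
  show "isCont \<rho> x" using DERIV_rho[of x] by (rule DERIV_isCont)
qed

lemma continuous_deriv_rho: "continuous_on UNIV (deriv \<rho>)"
proof (rule continuous_at_imp_continuous_on, rule ballI)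
  fix x :: real
  show "isCont (deriv \<rho>) x" using DERIV_deriv_rho[of x] by (rule DERIV_isCont)
qed

text \<open>Since \<open>\<rho>'(s) / s\<close> stays bounded as \<open>s \<rightarrow> 0\<close>, the derivative of \<open>\<rho>\<close> has to
  vanish at the origin.\<close>

lemma deriv_rho_eq: "deriv \<rho> s = u_fun \<rho> s * s"
proof (cases "s = 0")
  case True
  have "((\<lambda>s. u_fun \<rho> s * s) \<longlongrightarrow> u_fun \<rho> 0 * 0) (at 0)"
    using continuous_u by (intro tendsto_intros) (simp add: continuous_on_def)
  moreover have "\<forall>\<^sub>F s in at 0. u_fun \<rho> s * s = deriv \<rho> s"
    by (auto simp: u_fun_def eventually_at_filter)
  ultimately have "(deriv \<rho> \<longlongrightarrow> u_fun \<rho> 0 * 0) (at 0)"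
    by (rule Lim_transform_eventually)
  moreover have "(deriv \<rho> \<longlongrightarrow> deriv \<rho> 0) (at 0)"
    using continuous_deriv_rho by (simp add: continuous_on_def)
  ultimately have "deriv \<rho> 0 = u_fun \<rho> 0 * 0"
    using LIM_unique by metis
  then have "deriv \<rho> 0 = 0" by simp
  with True show ?thesis by simp
qed (simp add: u_fun_def)

lemma deriv_beyond: assumes "c1 \<le> s"
  shows "deriv \<rho> s = 0" "deriv (deriv \<rho>) s = 0"
proof -
  \<comment> \<open>A continuous function that vanishes to the right of \<open>c1\<close> vanishes at \<open>c1\<close>.\<close>
  have boundary: "f s = 0" if "continuous_on UNIV f" "\<And>s. c1 < s \<Longrightarrow> f s = 0" for f :: "real \<Rightarrow> real"
  proof -
    have "(f \<longlongrightarrow> f s) (at_right s)"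
      using that(1) by (simp add: continuous_on_def filterlim_at_split)
    moreover have "(f \<longlongrightarrow> 0) (at_right s)"
      using that(2) \<open>c1 \<le> s\<close> by (intro tendsto_eventually) (auto simp: eventually_at_filter)
    ultimately show ?thesis
      using tendsto_unique[OF trivial_limit_at_right_real] by blast
  qed
  have 1: "deriv \<rho> s = 0" if "c1 < s" for s
  proof -
    have ev: "\<forall>\<^sub>F t in nhds s. \<rho> c1 = \<rho> t"
      by (rule eventually_mono[OF eventually_nhds_in_open[of "{c1<..}" s]])
        (use that eventually_constant[symmetric] in auto)
    have "(\<rho> has_real_derivative 0) (at s)"
      using DERIV_cong_ev[OF refl ev refl, of 0] by simp
    then show ?thesis by (rule DERIV_imp_deriv)
  qed
  have 2: "deriv (deriv \<rho>) s = 0" if "c1 < s" for s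
  proof -
    have ev: "\<forall>\<^sub>F t in nhds s. 0 = deriv \<rho> t"
      by (rule eventually_mono[OF eventually_nhds_in_open[of "{c1<..}" s]])
        (use that 1 in auto)
    have "(deriv \<rho> has_real_derivative 0) (at s)"
      using DERIV_cong_ev[OF refl ev refl, of 0] by simp
    then show ?thesis by (rule DERIV_imp_deriv)
  qed
  show "deriv \<rho> s = 0" by (rule boundary[OF continuous_deriv_rho 1])
  show "deriv (deriv \<rho>) s = 0" by (rule boundary[OF continuous_deriv2 2])
qed

lemma u_beyond: "c1 \<le> s \<Longrightarrow> u_fun \<rho> s = 0"
  using deriv_beyond(1)[of s] c1_pos unfolding u_fun_def by auto

lemma continuous_w: "continuous_on UNIV w"
proof -
  have "continuous_on UNIV (\<lambda>q. u_fun \<rho> (sqrt q))"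
    by (rule continuous_on_compose2[OF continuous_u, of UNIV sqrt]) (auto intro: continuous_intros)
  then show ?thesis unfolding w_def .
qed

lemma w_beyond: "c1\<^sup>2 \<le> q \<Longrightarrow> w q = 0"
  and kappa_beyond: "c1\<^sup>2 \<le> q \<Longrightarrow> \<kappa> q = 0"
  using u_beyond[OF real_le_rsqrt] deriv_beyond(2)[OF real_le_rsqrt] by (auto simp: w_def \<kappa>_def)

lemma two_q_kappa: "0 \<le> q \<Longrightarrow> q \<noteq> 0 \<Longrightarrow> 2 * q * \<kappa> q = deriv (deriv \<rho>) (sqrt q) - u_fun \<rho> (sqrt q)"
  by (simp add: \<kappa>_def)

lemma DERIV_w: assumes "0 < q" shows "(w has_real_derivative \<kappa> q) (at q)"
proof -
  have "((\<lambda>q. deriv \<rho> (sqrt q) / sqrt q) has_real_derivative \<kappa> q) (at q)"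
    using assms
    apply (auto intro!: derivative_eq_intros DERIV_chain2[OF DERIV_deriv_rho])
    apply (simp add: \<kappa>_def u_fun_def field_simps)
    done
  moreover have ev: "\<forall>\<^sub>F t in nhds q. deriv \<rho> (sqrt t) / sqrt t = w t"
    by (rule eventually_mono[OF eventually_nhds_in_open[of "{0<..}" q]])
      (use assms in \<open>auto simp: w_def u_fun_def\<close>)
  ultimately show ?thesis using DERIV_cong_ev[OF refl ev refl, of "\<kappa> q"] by simp
qed

lemma continuous_kappa: assumes "0 < q" shows "isCont \<kappa> q"
proof -
  have "isCont (deriv (deriv \<rho>)) (sqrt q)" "isCont (u_fun \<rho>) (sqrt q)"
    using continuous_deriv2 continuous_u by (auto simp: continuous_on_eq_continuous_at)
  then have "isCont (\<lambda>q. deriv (deriv \<rho>) (sqrt q)) q" "isCont (\<lambda>q. u_fun \<rho> (sqrt q)) q"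
    using isCont_o2[OF isCont_real_sqrt[of q]] by auto
  then show ?thesis unfolding \<kappa>_def using assms by (intro continuous_intros) auto
qed

lemma measurable_w [measurable]: "w \<in> borel_measurable borel"
  by (rule borel_measurable_continuous_onI[OF continuous_w])

lemma measurable_kappa [measurable]: "\<kappa> \<in> borel_measurable borel"
proof -
  have [measurable]: "deriv (deriv \<rho>) \<in> borel_measurable borel" "u_fun \<rho> \<in> borel_measurable borel"
    by (intro borel_measurable_continuous_onI continuous_deriv2 continuous_u)+
  show ?thesis unfolding \<kappa>_def by measurable
qed

lemma measurable_rho [measurable]: "\<rho> \<in> borel_measurable borel"
  by (rule borel_measurable_continuous_onI[OF continuous_rho])

text \<open>One constant bounds the loss, its weight and \<open>q \<kappa> q\<close>, because each of them is continuous
  and constant from \<open>c1\<close> on.\<close>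

lemma bounded_weights:
  obtains M where "0 < M" "\<And>q. 0 \<le> q \<Longrightarrow> \<bar>\<rho> (sqrt q)\<bar> \<le> M" "\<And>q. 0 \<le> q \<Longrightarrow> \<bar>w q\<bar> \<le> M"
    "\<And>q. 0 \<le> q \<Longrightarrow> \<bar>q * \<kappa> q\<bar> \<le> M"
proof -
  have bd: "\<exists>B. \<forall>s\<ge>0. \<bar>f s\<bar> \<le> B" if "continuous_on UNIV f" "\<And>s. c1 \<le> s \<Longrightarrow> f s = f c1"
    for f :: "real \<Rightarrow> real"
  proof -
    have "compact (f ` {0..c1})"
      using that(1) by (intro compact_continuous_image) (auto intro: continuous_on_subset)
    then obtain B where B: "\<And>s. s \<in> {0..c1} \<Longrightarrow> \<bar>f s\<bar> \<le> B"
      by (metis bounded_iff compact_imp_bounded imageI real_norm_def)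
    have "\<bar>f s\<bar> \<le> B" if "0 \<le> s" for s
      using B[of s] B[of c1] \<open>c1 \<le> s \<Longrightarrow> f s = f c1\<close> c1_pos that by (cases "s \<le> c1") auto
    then show ?thesis by blast
  qed
  obtain B1 where B1: "\<And>s. 0 \<le> s \<Longrightarrow> \<bar>\<rho> s\<bar> \<le> B1"
    using bd[OF continuous_rho eventually_constant] by blast
  obtain B2 where B2: "\<And>s. 0 \<le> s \<Longrightarrow> \<bar>u_fun \<rho> s\<bar> \<le> B2"
    using bd[OF continuous_u] by (auto simp: u_beyond)
  obtain B3 where B3: "\<And>s. 0 \<le> s \<Longrightarrow> \<bar>deriv (deriv \<rho>) s\<bar> \<le> B3"
    using bd[OF continuous_deriv2] by (auto simp: deriv_beyond)
  have nn: "0 \<le> B1" "0 \<le> B2" "0 \<le> B3" using B1[of 0] B2[of 0] B3[of 0] by auto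
  show thesis
  proof (rule that[of "B1 + B2 + B3 + 1"])
    fix q :: real assume q: "0 \<le> q"
    show "\<bar>\<rho> (sqrt q)\<bar> \<le> B1 + B2 + B3 + 1" using B1[of "sqrt q"] q nn by auto
    show "\<bar>w q\<bar> \<le> B1 + B2 + B3 + 1" using B2[of "sqrt q"] q nn by (auto simp: w_def)
    have "2 * \<bar>q * \<kappa> q\<bar> \<le> B2 + B3"
    proof (cases "q = 0")
      case False
      have "2 * \<bar>q * \<kappa> q\<bar> = \<bar>2 * q * \<kappa> q\<bar>" by (simp add: abs_mult)
      also have "\<dots> \<le> B2 + B3"
        unfolding two_q_kappa[OF q False] using B2[of "sqrt q"] B3[of "sqrt q"] q by auto
      finally show ?thesis .
    qed (use nn in simp)
    then show "\<bar>q * \<kappa> q\<bar> \<le> B1 + B2 + B3 + 1" using nn by linarith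
  qed (use nn in simp)
qed

lemma DERIV_rho_sqrt: assumes "0 < q"
  shows "((\<lambda>q. \<rho> (sqrt q)) has_real_derivative w q / 2) (at q)"
proof -
  have "((\<lambda>q. \<rho> (sqrt q)) has_real_derivative deriv \<rho> (sqrt q) * (inverse (sqrt q) / 2)) (at q)"
    by (rule DERIV_chain2[OF DERIV_rho DERIV_real_sqrt[OF assms]])
  moreover have "deriv \<rho> (sqrt q) * (inverse (sqrt q) / 2) = w q / 2"
    using assms by (simp add: w_def deriv_rho_eq field_simps)
  ultimately show ?thesis by simp
qed

text \<open>The mean value theorem also covers the end point \<open>0\<close>, where \<open>sqrt\<close> is not
  differentiable.\<close>

lemma rho_sqrt_mvt: assumes "0 \<le> p" "p < q"
  obtains \<xi> where "p < \<xi>" "\<xi> < q" "\<rho> (sqrt q) - \<rho> (sqrt p) = (q - p) * (w \<xi> / 2)"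
proof -
  have "continuous_on {p..q} (\<lambda>q. \<rho> (sqrt q))"
    by (rule continuous_on_compose2[OF continuous_rho, of "{p..q}" sqrt]) (auto intro: continuous_intros)
  moreover have "((\<lambda>q. \<rho> (sqrt q)) has_derivative (\<lambda>h. h * (w x / 2))) (at x)" if "p < x" for x
  proof -
    have "(\<lambda>h. h * (w x / 2)) = (*) (w x / 2)" by (auto simp: mult.commute)
    then show ?thesis using DERIV_rho_sqrt[of x] that assms by (simp add: has_field_derivative_def)
  qed
  ultimately show thesis
    using mvt[OF \<open>p < q\<close>, of "\<lambda>q. \<rho> (sqrt q)" "\<lambda>x h. h * (w x / 2)"] that
    by (metis greaterThanLessThan_iff)
qed

lemma rho_sqrt_has_derivative: assumes "0 \<le> q"
  shows "((\<lambda>q. \<rho> (sqrt q)) has_real_derivative w q / 2) (at q within {0..})"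
proof (cases "q = 0")
  case True
  have "((\<lambda>x. (\<rho> (sqrt x) - \<rho> (sqrt 0)) / (x - 0)) \<longlongrightarrow> w 0 / 2) (at 0 within {0..})"
  proof (rule tendstoI)
    fix e :: real assume "0 < e"
    have "isCont w 0" using continuous_w by (simp add: continuous_on_eq_continuous_at)
    then obtain d where "0 < d" and d: "\<And>x. \<bar>x\<bar> < d \<Longrightarrow> \<bar>w x - w 0\<bar> < e"
      using \<open>0 < e\<close> unfolding continuous_at_real_range by auto
    have "dist ((\<rho> (sqrt x) - \<rho> (sqrt 0)) / (x - 0)) (w 0 / 2) < e" if "0 < x" "x < d" for x
    proof -
      obtain \<xi> where \<xi>: "0 < \<xi>" "\<xi> < x" "\<rho> (sqrt x) - \<rho> (sqrt 0) = (x - 0) * (w \<xi> / 2)"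
        by (rule rho_sqrt_mvt[OF order_refl \<open>0 < x\<close>])
      then have eq: "(\<rho> (sqrt x) - \<rho> (sqrt 0)) / (x - 0) = w \<xi> / 2" using \<open>0 < x\<close> by simp
      moreover have "\<bar>w \<xi> - w 0\<bar> < e" using d[of \<xi>] \<xi> that by auto
      ultimately show ?thesis unfolding dist_real_def eq by linarith
    qed
    then show "\<forall>\<^sub>F x in at 0 within {0..}. dist ((\<rho> (sqrt x) - \<rho> (sqrt 0)) / (x - 0)) (w 0 / 2) < e"
      unfolding eventually_at using \<open>0 < d\<close> by (intro exI[of _ d]) (auto simp: dist_real_def)
  qed
  then show ?thesis using True by (simp add: has_field_derivative_iff)
next
  case False
  then have "0 < q" using assms by simp
  then show ?thesis by (rule has_field_derivative_at_within[OF DERIV_rho_sqrt])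
qed

lemma rho_sqrt_lipschitz:
  assumes M: "\<And>q. 0 \<le> q \<Longrightarrow> \<bar>w q\<bar> \<le> M" and "0 \<le> p" "0 \<le> q"
  shows "\<bar>\<rho> (sqrt q) - \<rho> (sqrt p)\<bar> \<le> M * \<bar>q - p\<bar>"
proof -
  have *: "\<bar>\<rho> (sqrt q) - \<rho> (sqrt p)\<bar> \<le> M * (q - p)" if pq: "0 \<le> p" "p < q" for p q
  proof -
    obtain \<xi> where \<xi>: "p < \<xi>" "\<rho> (sqrt q) - \<rho> (sqrt p) = (q - p) * (w \<xi> / 2)"
      using rho_sqrt_mvt[OF pq] by metis
    have "\<bar>w \<xi> / 2\<bar> \<le> M" using M[of \<xi>] \<xi> pq by auto
    then show ?thesis unfolding \<xi>(2) using pq by (simp add: abs_mult)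
  qed
  show ?thesis
    using *[of p q] *[of q p] assms by (cases p q rule: linorder_cases) (auto simp: abs_minus_commute)
qed

lemma rho_sqrt_beyond: "c1\<^sup>2 \<le> q \<Longrightarrow> \<rho> (sqrt q) = \<rho> c1"
  by (rule eventually_constant) (rule real_le_rsqrt)

end

section \<open>Matrix products and the Frobenius inner product\<close>

lemma bounded_bilinear_matrix_mult:
  "bounded_bilinear ((**) :: real^'n^'m \<Rightarrow> real^'p^'n \<Rightarrow> real^'p^'m)"
proof -
  have "bilinear ((**) :: real^'n^'m \<Rightarrow> real^'p^'n \<Rightarrow> real^'p^'m)"
    unfolding bilinear_def
    by (auto intro!: linearI
        simp: matrix_matrix_mult_def vec_eq_iff sum.distrib sum_distrib_left algebra_simps)
  then show ?thesis by (simp add: bilinear_conv_bounded_bilinear)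
qed

lemma bounded_bilinear_matrix_vector_mult:
  "bounded_bilinear ((*v) :: real^'n^'m \<Rightarrow> real^'n \<Rightarrow> real^'m)"
proof -
  have "bilinear ((*v) :: real^'n^'m \<Rightarrow> real^'n \<Rightarrow> real^'m)"
    unfolding bilinear_def
    by (auto intro!: linearI
        simp: matrix_vector_mult_def vec_eq_iff sum.distrib sum_distrib_left algebra_simps)
  then show ?thesis by (simp add: bilinear_conv_bounded_bilinear)
qed

lemma bounded_linear_transpose: "bounded_linear (transpose :: real^'n^'m \<Rightarrow> real^'m^'n)"
  by (simp add: linear_conv_bounded_linear[symmetric] linear_iff transpose_def vec_eq_iff)

lemma bounded_linear_trace: "bounded_linear (trace :: real^'n^'n \<Rightarrow> real)"
  by (simp add: linear_conv_bounded_linear[symmetric] linear_iff trace_def sum.distrib sum_distrib_left)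

interpretation mm: bounded_bilinear "(**) :: real^'n^'m \<Rightarrow> real^'p^'n \<Rightarrow> real^'p^'m"
  by (rule bounded_bilinear_matrix_mult)

interpretation mv: bounded_bilinear "(*v) :: real^'n^'m \<Rightarrow> real^'n \<Rightarrow> real^'m"
  by (rule bounded_bilinear_matrix_vector_mult)

lemmas transpose_add = linear_add[OF bounded_linear.linear[OF bounded_linear_transpose]]
  and transpose_diff = linear_diff[OF bounded_linear.linear[OF bounded_linear_transpose]]
  and transpose_scaleR = linear_cmul[OF bounded_linear.linear[OF bounded_linear_transpose]]
  and transpose_sum = linear_sum[OF bounded_linear.linear[OF bounded_linear_transpose]]

lemmas trace_scaleR = linear_cmul[OF bounded_linear.linear[OF bounded_linear_trace]]
  and trace_zero = linear_0[OF bounded_linear.linear[OF bounded_linear_trace]]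

lemma inner_matrix_vector_left:
  fixes A :: "real^'n^'m" shows "(A *v x) \<bullet> y = x \<bullet> (transpose A *v y)"
  by (metis dot_lmul_matrix inner_commute transpose_matrix_vector)

lemma inner_symmetric_matrix:
  fixes A :: "real^'n^'n" assumes "transpose A = A" shows "(A *v x) \<bullet> y = x \<bullet> (A *v y)"
  by (metis assms inner_matrix_vector_left)

lemma norm_matrix_vector_le:
  fixes A :: "real^'n^'m" shows "norm (A *v x) \<le> norm A * norm x"
proof -
  have "norm (A *v x) = L2_set (\<lambda>i. \<bar>A $ i \<bullet> x\<bar>) UNIV"
    by (simp add: norm_vec_def matrix_vector_mul_component)
  also have "\<dots> \<le> L2_set (\<lambda>i. norm (A $ i) * norm x) UNIV"
    by (rule L2_set_mono) (auto simp: Cauchy_Schwarz_ineq2)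
  also have "\<dots> = norm A * norm x"
    by (simp add: L2_set_left_distrib norm_vec_def)
  finally show ?thesis .
qed

text \<open>The inner product of matrices is the Frobenius one, so quadratic forms are inner products with
  outer products.\<close>

lemma inner_outer: fixes B :: "real^'n^'n" shows "B \<bullet> outer z = z \<bullet> (B *v z)"
  by (simp add: outer_def inner_vec_def matrix_vector_mult_def sum_distrib_left mult_ac)

lemma inner_eq_trace: fixes A B :: "real^'n^'m" shows "A \<bullet> B = trace (transpose A ** B)"
  unfolding inner_vec_def trace_def transpose_def matrix_matrix_mult_def
  by simp (rule sum.swap)

lemma inner_mat_1: fixes A :: "real^'n^'n" shows "A \<bullet> mat 1 = trace A"
  by (simp add: inner_vec_def mat_def trace_def if_distrib cong: if_cong)

lemma inner_mult_left: fixes A :: "real^'n^'m" and B :: "real^'p^'n" and C :: "real^'p^'m"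
  shows "(A ** B) \<bullet> C = B \<bullet> (transpose A ** C)"
  by (simp add: inner_eq_trace matrix_transpose_mul matrix_mul_assoc)

lemma inner_mult_right: fixes A :: "real^'n^'m" and B :: "real^'p^'n" and C :: "real^'p^'m"
  shows "(A ** B) \<bullet> C = A \<bullet> (C ** transpose B)"
  unfolding inner_eq_trace matrix_transpose_mul
  by (metis matrix_mul_assoc trace_mul_sym)

lemma matrix_entry: fixes A :: "real^'n^'m" shows "A $ i $ j = axis i 1 \<bullet> (A *v axis j 1)"
  by (simp add: inner_axis' matrix_vector_mult_basis column_def)

lemma matrix_inverse:
  fixes A :: "real^'n^'n" assumes "invertible A"
  shows matrix_inv_right: "A ** matrix_inv A = mat 1" and matrix_inv_left: "matrix_inv A ** A = mat 1"
proof -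
  have "A ** matrix_inv A = mat 1 \<and> matrix_inv A ** A = mat 1"
    unfolding matrix_inv_def by (rule someI_ex) (use assms in \<open>simp add: invertible_def\<close>)
  then show "A ** matrix_inv A = mat 1" "matrix_inv A ** A = mat 1" by auto
qed

lemma matrix_inv_eqI:
  fixes A B :: "real^'n^'n" assumes "A ** B = mat 1" shows "matrix_inv A = B"
proof -
  have "invertible A" using assms by (metis invertible_right_inverse)
  then have "matrix_inv A ** (A ** B) = B"
    by (simp add: matrix_mul_assoc matrix_inv_left)
  then show ?thesis using assms by simp
qed

lemma transpose_matrix_inv:
  fixes A :: "real^'n^'n" assumes "invertible A"
  shows "matrix_inv (transpose A) = transpose (matrix_inv A)"
  by (rule matrix_inv_eqI) (metis assms matrix_inv_left matrix_transpose_mul transpose_mat)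

section \<open>Positive definite matrices\<close>

lemma PDS_sym: "A \<in> PDS \<Longrightarrow> transpose A = A"
  and PDS_pos: "A \<in> PDS \<Longrightarrow> x \<noteq> 0 \<Longrightarrow> 0 < x \<bullet> (A *v x)"
  by (auto simp: PDS_def)

lemma PDS_nonneg: "A \<in> PDS \<Longrightarrow> 0 \<le> x \<bullet> (A *v x)"
  using PDS_pos[of A x] by (cases "x = 0") auto

lemma PDS_invertible: assumes "A \<in> PDS" shows "invertible A"
proof -
  have "x = 0" if "A *v x = 0" for x
    using PDS_pos[OF assms, of x] that by (cases "x = 0") auto
  then show ?thesis by (metis invertible_left_inverse matrix_left_invertible_ker)
qed

lemma PDS_scaleR: "A \<in> PDS \<Longrightarrow> 0 < a \<Longrightarrow> a *\<^sub>R A \<in> PDS"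
  by (auto simp: PDS_def transpose_scaleR mv.scaleR_left)

lemma PDS_inv: assumes "A \<in> PDS" shows "matrix_inv A \<in> PDS"
proof -
  note i = PDS_invertible[OF assms]
  have "0 < x \<bullet> (matrix_inv A *v x)" if "x \<noteq> 0" for x
  proof -
    let ?y = "matrix_inv A *v x"
    have x: "A *v ?y = x" by (simp add: matrix_vector_mul_assoc matrix_inv_right i)
    then have "?y \<noteq> 0" using that by (metis matrix_vector_mult_0_right)
    then show ?thesis using PDS_pos[OF assms, of ?y] x by (simp add: inner_commute)
  qed
  then show ?thesis
    unfolding PDS_def using transpose_matrix_inv[OF i] PDS_sym[OF assms] by simp
qed

text \<open>The quadratic form attains a positive minimum on the compact unit sphere.\<close>

lemma PDS_coercive: assumes "A \<in> PDS" obtains c where "0 < c" "\<And>x. c * (norm x)\<^sup>2 \<le> x \<bullet> (A *v x)"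
proof -
  have "compact (sphere (0 :: real^'a) 1)" "sphere (0 :: real^'a) 1 \<noteq> {}" by auto
  moreover have "continuous_on (sphere 0 1) (\<lambda>x. x \<bullet> (A *v x))"
    by (intro continuous_intros mv.continuous_on)
  ultimately obtain u where u: "u \<in> sphere 0 1" "\<And>x. x \<in> sphere 0 1 \<Longrightarrow> u \<bullet> (A *v u) \<le> x \<bullet> (A *v x)"
    using continuous_attains_inf[of "sphere 0 1" "\<lambda>x. x \<bullet> (A *v x)"] by auto
  have "u \<noteq> 0" using u(1) by auto
  then have "0 < u \<bullet> (A *v u)" by (rule PDS_pos[OF assms])
  moreover have "(u \<bullet> (A *v u)) * (norm x)\<^sup>2 \<le> x \<bullet> (A *v x)" for x
  proof (cases "x = 0")
    case False
    have "x /\<^sub>R norm x \<in> sphere 0 1" using False by simp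
    then have "u \<bullet> (A *v u) \<le> (x \<bullet> (A *v x)) / (norm x)\<^sup>2"
      using u(2)[of "x /\<^sub>R norm x"] by (simp add: mv.scaleR_right power2_eq_square field_simps)
    then show ?thesis using False by (simp add: field_simps)
  qed simp
  ultimately show thesis by (rule that)
qed

section \<open>The positive definite square root\<close>

text \<open>A maximizer of the Rayleigh quotient on the unit sphere of \<open>S\<close> is an eigenvector.\<close>

lemma selfadjoint_eigenvector:
  fixes f :: "'a::euclidean_space \<Rightarrow> 'a"
  assumes f: "linear f" and sym: "\<And>x y. f x \<bullet> y = x \<bullet> f y"
    and S: "subspace S" "S \<noteq> {0}" "f ` S \<subseteq> S"
  obtains v where "v \<in> S" "norm v = 1" "f v = (v \<bullet> f v) *\<^sub>R v"
proof -
  interpret f: linear f by fact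
  obtain x where x: "x \<in> S" "x \<noteq> 0" using S subspace_0 by blast
  have "compact (S \<inter> sphere 0 1)"
    using closed_subspace[OF S(1)] by (simp add: closed_Int_compact)
  moreover have "x /\<^sub>R norm x \<in> S \<inter> sphere 0 1"
    using x S(1) by (simp add: subspace_scale)
  then have "S \<inter> sphere 0 1 \<noteq> {}" by blast
  moreover have "continuous_on (S \<inter> sphere 0 1) (\<lambda>x. x \<bullet> f x)"
    by (intro continuous_intros linear_continuous_on f[THEN linear_linear[THEN iffD2]])
  ultimately obtain v where v: "v \<in> S" "norm v = 1"
    and max: "\<And>x. x \<in> S \<Longrightarrow> norm x = 1 \<Longrightarrow> x \<bullet> f x \<le> v \<bullet> f v"
    using continuous_attains_sup[of "S \<inter> sphere 0 1" "\<lambda>x. x \<bullet> f x"]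
    by (metis IntD1 IntD2 IntI mem_sphere_0)
  let ?l = "v \<bullet> f v"
  have hom: "x \<bullet> f x \<le> ?l * (norm x)\<^sup>2" if "x \<in> S" for x
  proof (cases "x = 0")
    case False
    have "(x /\<^sub>R norm x) \<bullet> f (x /\<^sub>R norm x) \<le> ?l"
      using that False S(1) by (intro max) (auto simp: subspace_scale)
    then show ?thesis using False by (simp add: f.scale power2_eq_square field_simps)
  qed (simp add: f.zero)
  define r where "r = f v - ?l *\<^sub>R v"
  have r: "r \<in> S" using S v by (auto simp: r_def subspace_diff subspace_scale image_subset_iff)
  have vv: "v \<bullet> v = 1" using v by (simp add: dot_square_norm)
  have rv: "r \<bullet> v = 0" by (simp add: r_def inner_diff_left vv inner_commute[of "f v" v])
  have fr: "f v \<bullet> r = r \<bullet> r"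
  proof -
    have "f v \<bullet> r = (r + ?l *\<^sub>R v) \<bullet> r" by (simp add: r_def)
    also have "\<dots> = r \<bullet> r + ?l * (r \<bullet> v)" by (simp add: inner_add_left inner_commute[of v r])
    finally show ?thesis using rv by simp
  qed
  \<comment> \<open>If \<open>r \<noteq> 0\<close>, moving from \<open>v\<close> a little in the direction \<open>r\<close> would increase the quotient.\<close>
  have quad: "2 * t * (r \<bullet> r) \<le> t\<^sup>2 * (?l * (r \<bullet> r) - r \<bullet> f r)" for t
  proof -
    have "(v + t *\<^sub>R r) \<bullet> f (v + t *\<^sub>R r) \<le> ?l * ((v + t *\<^sub>R r) \<bullet> (v + t *\<^sub>R r))"
      using hom[of "v + t *\<^sub>R r"] r v S(1) by (simp add: subspace_add subspace_scale dot_square_norm)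
    moreover have "v \<bullet> f r = r \<bullet> r" using fr sym[of v r] by simp
    moreover have "r \<bullet> f v = r \<bullet> r" using fr by (simp add: inner_commute)
    moreover have "v \<bullet> r = 0" using rv by (simp add: inner_commute)
    ultimately show ?thesis
      using rv vv by (simp add: f.add f.scale inner_add_left inner_add_right power2_eq_square algebra_simps)
  qed
  have "r \<bullet> r = 0"
  proof (rule ccontr)
    assume "r \<bullet> r \<noteq> 0"
    then have pos: "0 < r \<bullet> r" by simp
    define K where "K = \<bar>?l * (r \<bullet> r) - r \<bullet> f r\<bar> + 1"
    have K: "0 < K" "?l * (r \<bullet> r) - r \<bullet> f r \<le> K" by (auto simp: K_def)
    let ?t = "(r \<bullet> r) / K"
    have "2 * ?t * (r \<bullet> r) \<le> ?t\<^sup>2 * K"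
      using quad[of ?t] K mult_left_mono[OF K(2), of "?t\<^sup>2"] by simp
    also have "?t\<^sup>2 * K = ?t * (r \<bullet> r)" using K by (simp add: power2_eq_square)
    finally have "?t * (r \<bullet> r) \<le> 0" by simp
    moreover have "0 < ?t * (r \<bullet> r)" using pos K by simp
    ultimately show False by simp
  qed
  then have "f v = ?l *\<^sub>R v" by (simp add: r_def)
  with v that show thesis by blast
qed

text \<open>The orthogonal complement of an eigenvector is again an invariant subspace, of smaller dimension.\<close>

lemma selfadjoint_eigenbasis:
  fixes f :: "'a::euclidean_space \<Rightarrow> 'a"
  assumes f: "linear f" and sym: "\<And>x y. f x \<bullet> y = x \<bullet> f y"
    and "subspace S" "f ` S \<subseteq> S"
  shows "\<exists>B. finite B \<and> B \<subseteq> S \<and> pairwise orthogonal B \<and> (\<forall>v\<in>B. norm v = 1 \<and> f v = (v \<bullet> f v) *\<^sub>R v) \<and> S \<subseteq> span B"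
  using assms(3,4)
proof (induction "dim S" arbitrary: S rule: less_induct)
  case less
  show ?case
  proof (cases "S = {0}")
    case True
    then show ?thesis by (intro exI[of _ "{}"]) auto
  next
    case False
    then obtain v where v: "v \<in> S" "norm v = 1" "f v = (v \<bullet> f v) *\<^sub>R v"
      using selfadjoint_eigenvector[OF f sym less.prems(1) False less.prems(2)] by blast
    have vv: "v \<bullet> v = 1" using v by (simp add: dot_square_norm)
    define T where "T = S \<inter> {x. v \<bullet> x = 0}"
    have T: "subspace T" unfolding T_def
      by (intro subspace_inter less.prems subspace_hyperplane)
    have fT: "f ` T \<subseteq> T"
    proof
      fix y assume "y \<in> f ` T"
      then obtain x where x: "x \<in> S" "v \<bullet> x = 0" "y = f x" by (auto simp: T_def)
      have "v \<bullet> y = (v \<bullet> f v) * (v \<bullet> x)" using sym[of v x] v(3) x(3) by (metis inner_scaleR_left)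
      then show "y \<in> T" using x less.prems(2) by (auto simp: T_def)
    qed
    have "v \<notin> T" using vv by (simp add: T_def)
    then have "T \<noteq> S" using v by blast
    then have "dim T < dim S"
      using subspace_dim_equal[OF T less.prems(1)] by (metis Int_lower1 T_def not_le)
    from less.hyps[OF this T fT] obtain B where B: "finite B" "B \<subseteq> T" "pairwise orthogonal B"
      "\<forall>v\<in>B. norm v = 1 \<and> f v = (v \<bullet> f v) *\<^sub>R v" "T \<subseteq> span B" by blast
    have "S \<subseteq> span (insert v B)"
    proof
      fix x assume x: "x \<in> S"
      have "x - (v \<bullet> x) *\<^sub>R v \<in> T"
        using x v less.prems(1) vv by (auto simp: T_def subspace_diff subspace_scale inner_diff_right)
      then have "x - (v \<bullet> x) *\<^sub>R v \<in> span (insert v B)"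
        using B(5) span_mono[of B "insert v B"] by blast
      moreover have "(v \<bullet> x) *\<^sub>R v \<in> span (insert v B)" by (simp add: span_base span_scale)
      ultimately show "x \<in> span (insert v B)" using span_add by fastforce
    qed
    moreover have "pairwise orthogonal (insert v B)"
      using B(2,3) by (auto simp: pairwise_insert orthogonal_def T_def inner_commute)
    ultimately show ?thesis
      using B v by (intro exI[of _ "insert v B"]) (auto simp: T_def)
  qed
qed

text \<open>In an orthonormal eigenbasis of \<open>A\<close>, the root scales each eigenvector by the square root of its
  eigenvalue.\<close>

lemma PDS_sqrt_exists:
  fixes A :: "real^'n^'n" assumes "A \<in> PDS"
  shows "\<exists>B \<in> PDS. B ** B = A"
proof -
  let ?f = "\<lambda>x. A *v x"
  obtain B where B: "finite B" "pairwise orthogonal B" "\<And>v. v \<in> B \<Longrightarrow> norm v = 1"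
    "\<And>v. v \<in> B \<Longrightarrow> A *v v = (v \<bullet> (A *v v)) *\<^sub>R v" "UNIV \<subseteq> span B"
    using selfadjoint_eigenbasis[of ?f UNIV] inner_symmetric_matrix[OF PDS_sym[OF assms]] by auto
  have orth: "u \<bullet> v = (if u = v then 1 else 0)" if "u \<in> B" "v \<in> B" for u v
    using B that by (auto simp: pairwise_def orthogonal_def dot_square_norm)
  have proj: "u \<bullet> (\<Sum>v\<in>B. c v *\<^sub>R v) = c u" if "u \<in> B" for u c
    using that B(1) by (simp add: inner_sum_right orth if_distrib cong: if_cong)
  have expand: "x = (\<Sum>v\<in>B. (v \<bullet> x) *\<^sub>R v)" for x
  proof -
    let ?d = "x - (\<Sum>v\<in>B. (v \<bullet> x) *\<^sub>R v)"
    have "orthogonal ?d v" if "v \<in> B" for v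
      using proj[OF that, of "\<lambda>v. v \<bullet> x"] by (simp add: orthogonal_def inner_diff_right inner_commute[of _ v])
    then have "orthogonal ?d ?d"
      using orthogonal_to_span[of ?d B ?d] B(5) by (simp add: orthogonal_commute subset_iff)
    then show ?thesis by (simp add: orthogonal_def)
  qed
  define l where "l v = v \<bullet> (A *v v)" for v
  have l: "0 < l v" if "v \<in> B" for v
  proof -
    have "v \<noteq> 0" using B(3)[OF that] by auto
    then show ?thesis unfolding l_def by (rule PDS_pos[OF assms])
  qed
  have eig: "A *v v = l v *\<^sub>R v" if "v \<in> B" for v
    unfolding l_def by (rule B(4)[OF that])
  define g where "g x = (\<Sum>v\<in>B. (sqrt (l v) * (v \<bullet> x)) *\<^sub>R v)" for x
  have g: "linear g"
    unfolding g_def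
    by (rule linearI)
      (simp_all add: inner_add_right distrib_left scaleR_add_left sum.distrib scaleR_sum_right mult_ac)
  have ug: "u \<bullet> g x = sqrt (l u) * (u \<bullet> x)" if "u \<in> B" for u x
    unfolding g_def by (rule proj[OF that])
  have gg: "g (g x) = A *v x" for x
  proof -
    have "g (g x) = (\<Sum>v\<in>B. (l v * (v \<bullet> x)) *\<^sub>R v)"
      unfolding g_def[of "g x"] by (rule sum.cong) (auto simp: ug l less_imp_le)
    also have "\<dots> = (\<Sum>v\<in>B. (v \<bullet> x) *\<^sub>R (A *v v))"
      by (rule sum.cong) (simp_all add: eig mult.commute)
    also have "\<dots> = A *v (\<Sum>v\<in>B. (v \<bullet> x) *\<^sub>R v)"
      by (simp add: mv.sum_right mv.scaleR_right)
    finally show ?thesis using expand[of x] by simp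
  qed
  have sym: "x \<bullet> g y = g x \<bullet> y" for x y
    by (simp add: g_def inner_sum_left inner_sum_right mult_ac inner_commute)
  have pos: "0 < x \<bullet> g x" if "x \<noteq> 0" for x
  proof -
    have eq: "x \<bullet> g x = (\<Sum>v\<in>B. sqrt (l v) * (v \<bullet> x)\<^sup>2)"
      by (simp add: g_def inner_sum_right power2_eq_square mult_ac inner_commute)
    obtain u where u: "u \<in> B" "u \<bullet> x \<noteq> 0"
    proof (rule ccontr)
      assume "\<not> thesis"
      then have "(v \<bullet> x) *\<^sub>R v = 0" if "v \<in> B" for v using that \<open>\<And>u. u \<in> B \<Longrightarrow> u \<bullet> x \<noteq> 0 \<Longrightarrow> thesis\<close> by auto
      then have "(\<Sum>v\<in>B. (v \<bullet> x) *\<^sub>R v) = 0" by (rule sum.neutral[rule_format])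
      then have "x = 0" using expand[of x] by metis
      with \<open>x \<noteq> 0\<close> show False by simp
    qed
    have "0 < sqrt (l u) * (u \<bullet> x)\<^sup>2" using u l by simp
    then show ?thesis unfolding eq using u(1) B(1) l by (intro sum_pos2[of B u]) (auto simp: less_imp_le)
  qed
  have mg: "matrix g *v x = g x" for x by (simp add: matrix_works g)
  have "transpose (matrix g) = matrix g"
    unfolding vec_eq_iff
  proof (intro allI)
    fix i j
    have "transpose (matrix g) $ i $ j = axis j 1 \<bullet> g (axis i 1)"
      by (simp add: transpose_def matrix_entry mg)
    also have "\<dots> = matrix g $ i $ j" unfolding matrix_entry[of "matrix g"] mg by (subst sym) (rule inner_commute)
    finally show "transpose (matrix g) $ i $ j = matrix g $ i $ j" .
  qed
  then have "matrix g \<in> PDS" using pos by (simp add: PDS_def mg)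
  moreover have "matrix g ** matrix g = A"
    by (simp add: matrix_eq mg gg flip: matrix_vector_mul_assoc)
  ultimately show ?thesis by blast
qed

text \<open>With \<open>D = B - C\<close>, the equation \<open>B\<^sup>2 = C\<^sup>2\<close> reads \<open>B D + D C = 0\<close>; multiplying
  by \<open>D\<close> and taking traces leaves a vanishing sum of nonnegative quadratic forms.\<close>

lemma PDS_sqrt_unique:
  fixes B C :: "real^'n^'n" assumes "B \<in> PDS" "C \<in> PDS" "B ** B = C ** C" shows "B = C"
proof -
  define D where "D = B - C"
  have D: "transpose D = D" using assms by (simp add: D_def transpose_diff PDS_sym)
  have tr: "trace (D ** M ** D) = (\<Sum>i\<in>UNIV. (D *v axis i 1) \<bullet> (M *v (D *v axis i 1)))" for M
    unfolding trace_def matrix_entry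
    by (simp add: inner_symmetric_matrix[OF D] matrix_vector_mul_assoc matrix_mul_assoc)
  have "B ** D + D ** C = 0" using assms(3) by (simp add: D_def mm.diff_left mm.diff_right)
  then have "trace (D ** (B ** D) + D ** (D ** C)) = 0"
    by (metis matrix_add_ldistrib mm.zero_right trace_zero)
  moreover have "trace (D ** (D ** C)) = trace (D ** C ** D)"
    by (rule trace_mul_sym)
  ultimately have "trace (D ** B ** D) + trace (D ** C ** D) = 0"
    by (simp add: trace_add matrix_mul_assoc)
  moreover have "0 \<le> trace (D ** C ** D)"
    unfolding tr by (intro sum_nonneg PDS_nonneg assms)
  moreover have "0 \<le> (D *v axis i 1) \<bullet> (B *v (D *v axis i 1))" for i
    by (intro PDS_nonneg assms)
  ultimately have zero: "(D *v axis i 1) \<bullet> (B *v (D *v axis i 1)) = 0" for i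
    using sum_nonneg_eq_0_iff[of UNIV "\<lambda>i. (D *v axis i 1) \<bullet> (B *v (D *v axis i 1))"]
      sum_nonneg[of UNIV "\<lambda>i. (D *v axis i 1) \<bullet> (B *v (D *v axis i 1))"]
    unfolding tr[of B] by auto
  then have "D *v axis i 1 = 0" for i using PDS_pos[OF assms(1)] by (metis less_irrefl)
  then have "D $ i $ j = 0" for i j by (simp only: matrix_entry inner_zero_right)
  then have "D = 0" by (simp add: vec_eq_iff)
  then show ?thesis by (simp add: D_def)
qed

lemma pd_sqrt:
  fixes A :: "real^'n^'n" assumes "A \<in> PDS"
  shows pd_sqrt_PDS: "pd_sqrt A \<in> PDS" and pd_sqrt_square: "pd_sqrt A ** pd_sqrt A = A"
proof -
  have "\<exists>!B. B \<in> PDS \<and> B ** B = A"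
    using PDS_sqrt_exists[OF assms] PDS_sqrt_unique by metis
  then have "pd_sqrt A \<in> PDS \<and> pd_sqrt A ** pd_sqrt A = A"
    unfolding pd_sqrt_def by (rule theI')
  then show "pd_sqrt A \<in> PDS" "pd_sqrt A ** pd_sqrt A = A" by auto
qed

lemma PDS_det_pos: assumes "A \<in> PDS" shows "0 < det A"
proof -
  have "det (pd_sqrt A) \<noteq> 0"
    using PDS_invertible[OF pd_sqrt_PDS[OF assms]] by (simp add: invertible_det_nz)
  moreover have "det A = det (pd_sqrt A) * det (pd_sqrt A)"
    by (metis assms det_mul pd_sqrt_square)
  ultimately show ?thesis by (auto simp: zero_less_mult_iff linorder_neq_iff)
qed

section \<open>Derivatives of determinants and inverses\<close>

text \<open>In the Leibniz expansion a permutation other than the identity moves at least two indices, so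
  its term vanishes to second order at the identity matrix.\<close>

lemma det_has_derivative_at_mat_1:
  "((det :: real^'n^'n \<Rightarrow> real) has_derivative trace) (at (mat 1))"
proof -
  have entry: "((\<lambda>X :: real^'n^'n. X $ i $ j) has_derivative (\<lambda>H. H $ i $ j)) (at (mat 1))" for i j
    by (intro bounded_linear_imp_has_derivative bounded_linear_compose[OF bounded_linear_vec_nth bounded_linear_vec_nth])
  have "((\<lambda>X :: real^'n^'n. \<Sum>p\<in>{p. p permutes UNIV}. of_int (sign p) * (\<Prod>i\<in>UNIV. X $ i $ p i))
    has_derivative (\<lambda>H. \<Sum>p\<in>{p. p permutes UNIV}. of_int (sign p) *
       (\<Sum>i\<in>UNIV. H $ i $ p i * (\<Prod>j\<in>UNIV - {i}. mat 1 $ j $ p j)))) (at (mat 1))"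
    by (intro has_derivative_sum has_derivative_mult_right has_derivative_prod entry)
  moreover have "(\<Sum>p\<in>{p. p permutes UNIV}. of_int (sign p) *
       (\<Sum>i\<in>UNIV. H $ i $ p i * (\<Prod>j\<in>UNIV - {i}. mat 1 $ j $ p j))) = trace H" for H :: "real^'n^'n"
  proof -
    have zero: "(\<Prod>j\<in>UNIV - {i}. mat 1 $ j $ p j) = (0::real)" if p: "p permutes UNIV" "p \<noteq> id" for p and i :: 'n
    proof -
      obtain a where a: "p a \<noteq> a" using p by (auto simp: fun_eq_iff)
      have "p (p a) \<noteq> p a" using a p by (metis permutes_inj injD)
      then obtain j where "j \<noteq> i" "p j \<noteq> j" using a by (metis)
      then show ?thesis by (intro prod_zero bexI[of _ j]) (auto simp: mat_def)
    qed
    have "(\<Sum>p\<in>{p. p permutes UNIV}. of_int (sign p) *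
       (\<Sum>i\<in>UNIV. H $ i $ p i * (\<Prod>j\<in>UNIV - {i}. mat 1 $ j $ p j))) =
      (\<Sum>p\<in>{id}. of_int (sign p) * (\<Sum>i\<in>UNIV. H $ i $ p i * (\<Prod>j\<in>UNIV - {i}. mat 1 $ j $ p j)))"
      by (rule sum.mono_neutral_right) (auto simp: finite_permutations zero permutes_id)
    also have "\<dots> = trace H" by (simp add: mat_def trace_def sign_id)
    finally show ?thesis .
  qed
  ultimately show ?thesis unfolding det_def[abs_def] by simp
qed

text \<open>Translation to the identity: \<open>det X = det V * det (V\<^sup>-\<^sup>1 X)\<close>.\<close>

lemma det_has_derivative:
  fixes V :: "real^'n^'n" assumes "invertible V"
  shows "(det has_derivative (\<lambda>H. det V * trace (matrix_inv V ** H))) (at V)"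
proof -
  have eq: "det X = det V * det (matrix_inv V ** X)" for X :: "real^'n^'n"
    by (metis assms det_mul matrix_inv_right matrix_mul_assoc matrix_mul_lid)
  have 1: "((\<lambda>X. matrix_inv V ** X) has_derivative (\<lambda>H. matrix_inv V ** H)) (at V)"
    by (rule bounded_linear_imp_has_derivative[OF mm.bounded_linear_right])
  have "((\<lambda>X. det (matrix_inv V ** X)) has_derivative (\<lambda>H. trace (matrix_inv V ** H))) (at V)"
    using has_derivative_compose[OF 1, of det trace] det_has_derivative_at_mat_1
    by (simp add: matrix_inv_left assms)
  then have "((\<lambda>X. det V * det (matrix_inv V ** X)) has_derivative (\<lambda>H. det V * trace (matrix_inv V ** H))) (at V)"
    by (rule has_derivative_mult_right)
  moreover have "(\<lambda>X. det V * det (matrix_inv V ** X)) = det" by (rule ext) (rule eq[symmetric])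
  ultimately show ?thesis by (simp only:)
qed

lemma matrix_inv_diff:
  fixes A B :: "real^'n^'n" assumes "invertible A" "invertible B"
  shows "matrix_inv B - matrix_inv A = - (matrix_inv B ** (B - A) ** matrix_inv A)"
proof -
  have "matrix_inv B ** (B - A) ** matrix_inv A = matrix_inv B ** B ** matrix_inv A - matrix_inv B ** (A ** matrix_inv A)"
    by (simp add: mm.diff_left mm.diff_right matrix_mul_assoc)
  then show ?thesis by (simp add: assms matrix_inv_left matrix_inv_right)
qed

text \<open>The operator norm is dominated by the Frobenius norm, so a perturbation of norm less than \<open>c - c'\<close>
  costs at most \<open>c - c'\<close> in the coercivity constant.\<close>

lemma PDS_coercive_nearby:
  fixes v :: "'b \<Rightarrow> real^'n^'n"
  assumes "(v \<longlongrightarrow> V) F" "\<And>x. c * (norm x)\<^sup>2 \<le> x \<bullet> (V *v x)" "c' < c"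
  shows "\<forall>\<^sub>F t in F. \<forall>x. c' * (norm x)\<^sup>2 \<le> x \<bullet> (v t *v x)"
proof -
  have "\<forall>\<^sub>F t in F. dist (v t) V < c - c'" using assms by (intro tendstoD) auto
  then show ?thesis
  proof (rule eventually_mono, intro allI)
    fix t x assume t: "dist (v t) V < c - c'"
    have "\<bar>x \<bullet> ((v t - V) *v x)\<bar> \<le> norm x * (norm (v t - V) * norm x)"
      by (meson Cauchy_Schwarz_ineq2 norm_matrix_vector_le mult_left_mono norm_ge_zero order_trans)
    also have "\<dots> = norm (v t - V) * (norm x)\<^sup>2" by (simp add: power2_eq_square)
    also have "\<dots> \<le> (c - c') * (norm x)\<^sup>2" using t by (intro mult_right_mono) (auto simp: dist_norm)
    finally show "c' * (norm x)\<^sup>2 \<le> x \<bullet> (v t *v x)"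
      using assms(2)[of x] by (auto simp: mv.diff_left inner_diff_right algebra_simps)
  qed
qed

text \<open>Near a positive definite matrix coercivity is uniform, which bounds the inverses; then the
  resolvent identity turns convergence of the matrices into convergence of their inverses.\<close>

lemma tendsto_matrix_inv:
  fixes v :: "'b \<Rightarrow> real^'n^'n"
  assumes v: "(v \<longlongrightarrow> V) F" and V: "V \<in> PDS" and inv: "\<forall>\<^sub>F t in F. invertible (v t)"
  shows "((\<lambda>t. matrix_inv (v t)) \<longlongrightarrow> matrix_inv V) F"
proof -
  obtain c where c: "0 < c" "\<And>x. c * (norm x)\<^sup>2 \<le> x \<bullet> (V *v x)" using PDS_coercive[OF V] by blast
  have co: "\<forall>\<^sub>F t in F. \<forall>x. c/2 * (norm x)\<^sup>2 \<le> x \<bullet> (v t *v x)"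
    by (rule PDS_coercive_nearby[OF v c(2)]) (use c in auto)
  have bound: "\<forall>\<^sub>F t in F. \<forall>x. norm (matrix_inv (v t) *v x) \<le> 2/c * norm x"
    using eventually_conj[OF co inv]
  proof (rule eventually_mono, intro allI)
    fix t x assume "(\<forall>x. c/2 * (norm x)\<^sup>2 \<le> x \<bullet> (v t *v x)) \<and> invertible (v t)"
    then have 1: "\<forall>x. c/2 * (norm x)\<^sup>2 \<le> x \<bullet> (v t *v x)" and 2: "invertible (v t)" by auto
    let ?y = "matrix_inv (v t) *v x"
    have "v t *v ?y = x" by (simp add: matrix_vector_mul_assoc matrix_inv_right 2)
    then have "c/2 * (norm ?y)\<^sup>2 \<le> norm ?y * norm x"
      using 1[rule_format, of ?y] norm_cauchy_schwarz[of ?y x] by simp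
    then show "norm ?y \<le> 2/c * norm x"
      using c(1) by (cases "?y = 0") (auto simp: power2_eq_square field_simps)
  qed
  have "((\<lambda>t. (matrix_inv (v t) - matrix_inv V) *v x) \<longlongrightarrow> 0) F" for x
  proof (rule Lim_null_comparison)
    show "\<forall>\<^sub>F t in F. norm ((matrix_inv (v t) - matrix_inv V) *v x) \<le> 2/c * norm ((v t - V) *v (matrix_inv V *v x))"
      using bound inv
    proof eventually_elim
      case (elim t)
      have "(matrix_inv (v t) - matrix_inv V) *v x = - (matrix_inv (v t) *v ((v t - V) *v (matrix_inv V *v x)))"
        unfolding matrix_inv_diff[OF PDS_invertible[OF V] elim(2)]
        by (simp add: matrix_vector_mul_assoc mv.minus_left matrix_mul_assoc)
      then show ?case using elim(1) by simp
    qed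
    have "((\<lambda>t. 2/c * norm ((v t - V) *v (matrix_inv V *v x))) \<longlongrightarrow> 2/c * norm ((V - V) *v (matrix_inv V *v x))) F"
      by (intro tendsto_intros mv.tendsto v)
    then show "((\<lambda>t. 2/c * norm ((v t - V) *v (matrix_inv V *v x))) \<longlongrightarrow> 0) F" by simp
  qed
  note null = this
  have entry: "((\<lambda>t. (matrix_inv (v t) - matrix_inv V) $ i $ j) \<longlongrightarrow> 0) F" for i j
    using tendsto_vec_nth[OF null[of "axis j 1"], of i] by (simp add: matrix_vector_mult_basis column_def)
  show ?thesis
  proof (intro vec_tendstoI)
    fix i j
    show "((\<lambda>t. matrix_inv (v t) $ i $ j) \<longlongrightarrow> matrix_inv V $ i $ j) F"
      using entry[of i j] by (simp add: LIM_zero_iff)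
  qed
qed

section \<open>Lebesgue measure under affine maps\<close>

lemma nn_integral_lborel_translate:
  fixes f :: "'a::euclidean_space \<Rightarrow> ennreal"
  assumes [measurable]: "f \<in> borel_measurable borel"
  shows "(\<integral>\<^sup>+x. f (x + v) \<partial>lborel) = (\<integral>\<^sup>+x. f x \<partial>lborel)"
proof -
  have "(\<integral>\<^sup>+x. f x \<partial>lborel) = (\<integral>\<^sup>+x. f x \<partial>distr lborel borel ((+) v))"
    by (simp add: lborel_distr_plus)
  also have "\<dots> = (\<integral>\<^sup>+x. f (v + x) \<partial>lborel)" by (simp add: nn_integral_distr)
  finally show ?thesis by (simp add: add.commute)
qed

text \<open>Averaging over translations along \<open>e\<close> turns the shear (\<open>r = 1\<close>) or reflection (\<open>r = - 1\<close>)
  \<open>x \<mapsto> x + l x e\<close> into a translation of the averaging variable, so Tonelli and the translation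
  invariance of Lebesgue measure suffice.\<close>

lemma nn_integral_line_shift:
  fixes f :: "'a::euclidean_space \<Rightarrow> ennreal" and l :: "'a \<Rightarrow> real"
  assumes [measurable]: "f \<in> borel_measurable borel" "l \<in> borel_measurable borel"
    and r: "r = 1 \<or> r = - 1" and l: "\<And>x s. l (x + s *\<^sub>R e) = l x + (r - 1) * s"
  shows "(\<integral>\<^sup>+x. f (x + l x *\<^sub>R e) \<partial>lborel) = (\<integral>\<^sup>+x. f x \<partial>lborel)"
proof -
  define \<phi> :: "real \<Rightarrow> ennreal" where "\<phi> = indicator {0..1}"
  have [measurable]: "\<phi> \<in> borel_measurable borel" by (simp add: \<phi>_def)
  have \<phi>: "(\<integral>\<^sup>+t. \<phi> t \<partial>lborel) = 1" by (simp add: \<phi>_def)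
  have \<phi>_shift: "(\<integral>\<^sup>+t. \<phi> (t - a) \<partial>lborel) = 1" for a
    using nn_integral_lborel_translate[of \<phi> "- a"] by (simp add: \<phi>)
  have rr: "r * r = 1" using r by auto
  have "(\<integral>\<^sup>+x. f (x + l x *\<^sub>R e) \<partial>lborel) = (\<integral>\<^sup>+t. \<phi> t * (\<integral>\<^sup>+x. f (x + l x *\<^sub>R e) \<partial>lborel) \<partial>lborel)"
    by (subst nn_integral_multc) (simp_all add: \<phi>)
  also have "\<dots> = (\<integral>\<^sup>+t. (\<integral>\<^sup>+x. \<phi> t * f (x + (l x + r * t) *\<^sub>R e) \<partial>lborel) \<partial>lborel)"
  proof (rule nn_integral_cong)
    fix t
    have "(\<integral>\<^sup>+x. f (x + l x *\<^sub>R e) \<partial>lborel) = (\<integral>\<^sup>+x. f (x + t *\<^sub>R e + l (x + t *\<^sub>R e) *\<^sub>R e) \<partial>lborel)"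
      by (rule nn_integral_lborel_translate[symmetric]) measurable
    also have "\<dots> = (\<integral>\<^sup>+x. f (x + (l x + r * t) *\<^sub>R e) \<partial>lborel)"
      by (simp add: l algebra_simps)
    finally show "\<phi> t * (\<integral>\<^sup>+x. f (x + l x *\<^sub>R e) \<partial>lborel) = (\<integral>\<^sup>+x. \<phi> t * f (x + (l x + r * t) *\<^sub>R e) \<partial>lborel)"
      by (simp add: nn_integral_cmult)
  qed
  also have "\<dots> = (\<integral>\<^sup>+x. (\<integral>\<^sup>+t. \<phi> t * f (x + (l x + r * t) *\<^sub>R e) \<partial>lborel) \<partial>lborel)"
    by (rule lborel_pair.Fubini') measurable
  also have "\<dots> = (\<integral>\<^sup>+x. (\<integral>\<^sup>+s. \<phi> (r * (s - l x)) * f (x + s *\<^sub>R e) \<partial>lborel) \<partial>lborel)"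
  proof (rule nn_integral_cong)
    fix x
    have "(\<integral>\<^sup>+t. \<phi> t * f (x + (l x + r * t) *\<^sub>R e) \<partial>lborel)
      = ennreal \<bar>r\<bar> * (\<integral>\<^sup>+s. \<phi> (- (r * l x) + r * s) * f (x + (l x + r * (- (r * l x) + r * s)) *\<^sub>R e) \<partial>lborel)"
      using r by (intro nn_integral_real_affine) auto
    also have "\<dots> = (\<integral>\<^sup>+s. \<phi> (r * (s - l x)) * f (x + s *\<^sub>R e) \<partial>lborel)"
      using r by (auto simp: algebra_simps)
    finally show "(\<integral>\<^sup>+t. \<phi> t * f (x + (l x + r * t) *\<^sub>R e) \<partial>lborel)
      = (\<integral>\<^sup>+s. \<phi> (r * (s - l x)) * f (x + s *\<^sub>R e) \<partial>lborel)" .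
  qed
  also have "\<dots> = (\<integral>\<^sup>+s. (\<integral>\<^sup>+x. \<phi> (r * (s - l x)) * f (x + s *\<^sub>R e) \<partial>lborel) \<partial>lborel)"
    by (rule lborel_pair.Fubini') measurable
  also have "\<dots> = (\<integral>\<^sup>+s. (\<integral>\<^sup>+x. \<phi> (s - r * l x) * f x \<partial>lborel) \<partial>lborel)"
  proof (rule nn_integral_cong)
    fix s
    have eq: "r * (s - l (x + (- s) *\<^sub>R e)) = s - r * l x" for x
      unfolding l using r by (auto simp: algebra_simps)
    have "(\<integral>\<^sup>+x. \<phi> (r * (s - l x)) * f (x + s *\<^sub>R e) \<partial>lborel)
      = (\<integral>\<^sup>+x. \<phi> (r * (s - l (x + (- s) *\<^sub>R e))) * f (x + (- s) *\<^sub>R e + s *\<^sub>R e) \<partial>lborel)"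
      by (rule nn_integral_lborel_translate[symmetric]) measurable
    then show "(\<integral>\<^sup>+x. \<phi> (r * (s - l x)) * f (x + s *\<^sub>R e) \<partial>lborel) = (\<integral>\<^sup>+x. \<phi> (s - r * l x) * f x \<partial>lborel)"
      unfolding eq by simp
  qed
  also have "\<dots> = (\<integral>\<^sup>+x. (\<integral>\<^sup>+s. \<phi> (s - r * l x) * f x \<partial>lborel) \<partial>lborel)"
    by (rule lborel_pair.Fubini') measurable
  also have "\<dots> = (\<integral>\<^sup>+x. f x \<partial>lborel)"
    by (subst nn_integral_multc) (simp_all add: \<phi>_shift)
  finally show ?thesis .
qed

lemma borel_measurable_matrix_vector [measurable]:
  fixes A :: "real^'n^'m" shows "(*v) A \<in> borel_measurable borel"
  by (intro borel_measurable_continuous_onI linear_continuous_on) (rule mv.bounded_linear_right)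

text \<open>Induction over elementary matrices: diagonal matrices scale the coordinates, transpositions are
  reflections and transvections are shears, the latter two in the form \<open>x \<mapsto> x + l x e\<close>.\<close>

lemma nn_integral_linear:
  fixes B :: "real^'n^'n"
  shows "invertible B \<longrightarrow> (\<forall>f\<in>borel_measurable borel.
    (\<integral>\<^sup>+x. f x \<partial>lborel) = ennreal \<bar>det B\<bar> * (\<integral>\<^sup>+x. f (B *v x) \<partial>lborel))"
proof (induction B rule: induct_matrix_elementary)
  case (1 A B)
  show ?case
  proof (intro impI ballI)
    fix f :: "real^'n \<Rightarrow> ennreal" assume "invertible (A ** B)" and [measurable]: "f \<in> borel_measurable borel"
    then have inv: "invertible A" "invertible B" by (auto simp: invertible_det_nz det_mul)
    have "(\<integral>\<^sup>+x. f x \<partial>lborel) = ennreal \<bar>det A\<bar> * (\<integral>\<^sup>+x. f (A *v x) \<partial>lborel)"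
      using 1(1)[THEN mp, OF inv(1), THEN bspec, of f] by simp
    also have "(\<integral>\<^sup>+x. f (A *v x) \<partial>lborel) = ennreal \<bar>det B\<bar> * (\<integral>\<^sup>+x. f (A *v (B *v x)) \<partial>lborel)"
      using 1(2)[THEN mp, OF inv(2), THEN bspec, of "\<lambda>x. f (A *v x)"] by simp
    finally show "(\<integral>\<^sup>+x. f x \<partial>lborel) = ennreal \<bar>det (A ** B)\<bar> * (\<integral>\<^sup>+x. f ((A ** B) *v x) \<partial>lborel)"
      by (simp add: det_mul abs_mult ennreal_mult' mult.assoc matrix_vector_mul_assoc)
  qed
next
  case (2 A i)
  then show ?case by (simp add: invertible_det_nz det_zero_row)
next
  case (3 A)
  show ?case
  proof (intro impI ballI)
    fix f :: "real^'n \<Rightarrow> ennreal" assume "invertible A" and [measurable]: "f \<in> borel_measurable borel"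
    then have nz: "(\<Prod>i\<in>UNIV. A $ i $ i) \<noteq> 0" using 3 by (simp add: invertible_det_nz det_diagonal)
    let ?c = "\<lambda>b :: real^'n. b \<bullet> (A *v b)"
    have diag: "A *v x = (\<Sum>j\<in>UNIV. (A $ j $ j * x $ j) *\<^sub>R axis j 1)" for x
    proof -
      have "(A *v x) $ i = A $ i $ i * x $ i" for i
      proof -
        have "(A *v x) $ i = (\<Sum>j\<in>UNIV. if j = i then A $ i $ i * x $ i else 0)"
          unfolding matrix_vector_mult_def vec_lambda_beta by (intro sum.cong) (auto simp: 3)
        then show ?thesis by simp
      qed
      then show ?thesis by (simp add: vec_eq_iff axis_def if_distrib cong: if_cong)
    qed
    have Ax: "axis j 1 \<bullet> (A *v axis j 1) = A $ j $ j" for j by (simp add: matrix_entry)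
    have inj: "inj_on (\<lambda>j :: 'n. axis j (1::real)) UNIV" by (simp add: inj_on_def axis_eq_axis)
    have Basis: "(Basis :: (real^'n) set) = range (\<lambda>j. axis j 1)" by (auto simp: Basis_vec_def)
    have T: "(\<lambda>x. 0 + (\<Sum>j\<in>Basis. (?c j * (x \<bullet> j)) *\<^sub>R j)) = (*v) A"
      unfolding Basis sum.reindex[OF inj] by (rule ext) (simp add: diag[symmetric] Ax inner_axis o_def)
    have P: "(\<Prod>j\<in>Basis. \<bar>?c j\<bar>) = \<bar>det A\<bar>"
      unfolding Basis prod.reindex[OF inj] using 3 by (simp add: det_diagonal abs_prod Ax)
    have c: "?c j \<noteq> 0" if "j \<in> Basis" for j
      using that nz unfolding Basis by (auto simp: Ax)
    have "lborel = density (distr lborel borel ((*v) A)) (\<lambda>_. ennreal \<bar>det A\<bar>)"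
      using lborel_affine_euclidean[of ?c 0, OF c] unfolding T P .
    then have "(\<integral>\<^sup>+x. f x \<partial>lborel) = (\<integral>\<^sup>+x. f x \<partial>density (distr lborel borel ((*v) A)) (\<lambda>_. ennreal \<bar>det A\<bar>))"
      by metis
    also have "\<dots> = (\<integral>\<^sup>+x. ennreal \<bar>det A\<bar> * f (A *v x) \<partial>lborel)"
      by (subst nn_integral_density) (simp_all add: nn_integral_distr)
    also have "\<dots> = ennreal \<bar>det A\<bar> * (\<integral>\<^sup>+x. f (A *v x) \<partial>lborel)"
      by (rule nn_integral_cmult) measurable
    finally show "(\<integral>\<^sup>+x. f x \<partial>lborel) = ennreal \<bar>det A\<bar> * (\<integral>\<^sup>+x. f (A *v x) \<partial>lborel)" .
  qed
next
  case (4 m n)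
  let ?B = "(\<chi> i j. mat 1 $ i $ Transposition.transpose m n j) :: real^'n^'n"
  have det: "\<bar>det ?B\<bar> = 1"
    by (simp add: det_permute_columns permutes_swap_id sign_swap_id abs_mult)
  have B: "?B *v x = x + (x $ n - x $ m) *\<^sub>R (axis m 1 - axis n 1)" for x :: "real^'n"
  proof -
    have "(?B *v x) $ i = x $ Transposition.transpose m n i" for i
    proof -
      have "(?B *v x) $ i = (\<Sum>j\<in>UNIV. if j = Transposition.transpose m n i then x $ j else 0)"
        unfolding matrix_vector_mult_def vec_lambda_beta
        by (intro sum.cong) (auto simp: mat_def Transposition.transpose_def)
      then show ?thesis by simp
    qed
    then show ?thesis using 4 by (auto simp: vec_eq_iff axis_def Transposition.transpose_def)
  qed
  have "(\<integral>\<^sup>+x. f (?B *v x) \<partial>lborel) = (\<integral>\<^sup>+x. f x \<partial>lborel)"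
    if [measurable]: "f \<in> borel_measurable borel" for f :: "real^'n \<Rightarrow> ennreal"
    unfolding B by (rule nn_integral_line_shift[where r="- 1"]) (use 4 in \<open>auto simp: axis_def\<close>)
  then show ?case by (simp add: det)
next
  case (5 m n c)
  let ?B = "(\<chi> i j. if i = m \<and> j = n then c else of_bool (i = j)) :: real^'n^'n"
  have "?B = (\<chi> k. if k = m then row m (mat 1) + c *s row n (mat 1) else row k (mat 1))"
    using 5 by (auto simp: vec_eq_iff row_def mat_def)
  then have det: "det ?B = 1" using det_row_operation[OF 5, of "mat 1 :: real^'n^'n" c] by simp
  have B: "?B *v x = x + (c * x $ n) *\<^sub>R axis m 1" for x :: "real^'n"
  proof -
    have "(?B *v x) $ i = x $ i + (if i = m then c * x $ n else 0)" for i
    proof -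
      have "(?B *v x) $ i = (\<Sum>j\<in>UNIV. (if j = i then x $ j else 0) + (if j = n then (if i = m then c * x $ n else 0) else 0))"
        unfolding matrix_vector_mult_def vec_lambda_beta using 5 by (intro sum.cong) auto
      then show ?thesis by (simp add: sum.distrib)
    qed
    then show ?thesis by (simp add: vec_eq_iff axis_def)
  qed
  have "(\<integral>\<^sup>+x. f (?B *v x) \<partial>lborel) = (\<integral>\<^sup>+x. f x \<partial>lborel)"
    if [measurable]: "f \<in> borel_measurable borel" for f :: "real^'n \<Rightarrow> ennreal"
    unfolding B by (rule nn_integral_line_shift[where r=1]) (use 5 in \<open>auto simp: axis_def\<close>)
  then show ?case by (simp add: det)
qed

lemma nn_integral_affine:
  fixes B :: "real^'n^'n" assumes B: "invertible B" and [measurable]: "f \<in> borel_measurable borel"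
  shows "(\<integral>\<^sup>+x. f x \<partial>lborel) = ennreal \<bar>det B\<bar> * (\<integral>\<^sup>+x. f (b + B *v x) \<partial>lborel)"
proof -
  have "(\<integral>\<^sup>+x. f x \<partial>lborel) = (\<integral>\<^sup>+x. f (x + b) \<partial>lborel)"
    by (rule nn_integral_lborel_translate[symmetric]) measurable
  also have "\<dots> = ennreal \<bar>det B\<bar> * (\<integral>\<^sup>+x. f (B *v x + b) \<partial>lborel)"
    by (rule nn_integral_linear[of B, THEN mp, OF B, THEN bspec]) measurable
  finally show ?thesis by (simp only: add.commute[of b])
qed

section \<open>Moments of spherical laws\<close>

text \<open>A spherical law is only used through its invariance under orthogonal maps, together with the fact
  that it does not charge the origin, where weights of the squared radius may fail to be
  differentiable.\<close>

locale spherical_law = prob_space \<mu> for \<mu> :: "(real^'k) measure" +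
  assumes sets_mu [measurable_cong]: "sets \<mu> = sets borel"
    and rotation_invariant: "\<And>U. orthogonal_transformation U \<Longrightarrow> distr \<mu> borel U = \<mu>"
    and AE_nonzero: "AE z in \<mu>. z \<noteq> 0"
begin

lemma integral_rotate:
  fixes g :: "real^'k \<Rightarrow> real"
  assumes U: "orthogonal_transformation U" and [measurable]: "g \<in> borel_measurable borel"
  shows "(\<integral>z. g (U z) \<partial>\<mu>) = (\<integral>z. g z \<partial>\<mu>)"
proof -
  have [measurable]: "U \<in> borel_measurable borel"
    by (intro borel_measurable_continuous_onI linear_continuous_on)
      (use U orthogonal_transformation_linear linear_linear in blast)
  have "(\<integral>z. g z \<partial>\<mu>) = (\<integral>z. g z \<partial>distr \<mu> borel U)" by (simp add: rotation_invariant[OF U])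
  also have "\<dots> = (\<integral>z. g (U z) \<partial>\<mu>)" by (rule integral_distr) measurable
  finally show ?thesis by simp
qed

lemma integral_odd:
  fixes g :: "real^'k \<Rightarrow> real"
  assumes "g \<in> borel_measurable borel" "\<And>z. g (- z) = - g z"
  shows "(\<integral>z. g z \<partial>\<mu>) = 0"
proof -
  have "orthogonal_transformation (\<lambda>z :: real^'k. - z)"
    by (simp add: orthogonal_transformation_neg)
  from integral_rotate[OF this assms(1)] have "(\<integral>z. - g z \<partial>\<mu>) = (\<integral>z. g z \<partial>\<mu>)"
    by (simp only: assms(2))
  then show ?thesis by simp
qed

text \<open>A rotation moves \<open>a\<close> onto any multiple \<open>norm a\<close> of a unit vector, so radially weighted powers
  of \<open>a \<bullet> z\<close> integrate to a multiple of \<open>norm a ^ p\<close>.\<close>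

lemma radial_power_moment:
  fixes f :: "real \<Rightarrow> real"
  assumes [measurable]: "f \<in> borel_measurable borel" and e: "norm e = 1"
  shows "(\<integral>z. f (norm z) * (a \<bullet> z) ^ p \<partial>\<mu>) = norm a ^ p * (\<integral>z. f (norm z) * (e \<bullet> z) ^ p \<partial>\<mu>)"
proof -
  have "norm (norm a *\<^sub>R e) = norm a" using e by simp
  then obtain U where U: "orthogonal_transformation U" and Ue: "U (norm a *\<^sub>R e) = a"
    using orthogonal_transformation_exists by blast
  have "(\<integral>z. f (norm z) * (a \<bullet> z) ^ p \<partial>\<mu>) = (\<integral>z. f (norm (U z)) * (a \<bullet> U z) ^ p \<partial>\<mu>)"
    by (rule integral_rotate[OF U, symmetric]) measurable
  also have "\<dots> = (\<integral>z. norm a ^ p * (f (norm z) * (e \<bullet> z) ^ p) \<partial>\<mu>)"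
  proof (rule Bochner_Integration.integral_cong[OF refl])
    fix z
    have "a \<bullet> U z = norm a * (e \<bullet> z)"
      using U unfolding orthogonal_transformation_def by (metis Ue inner_scaleR_left)
    then show "f (norm (U z)) * (a \<bullet> U z) ^ p = norm a ^ p * (f (norm z) * (e \<bullet> z) ^ p)"
      by (simp add: orthogonal_transformation_norm[OF U] power_mult_distrib)
  qed
  finally show ?thesis by simp
qed

lemma integrable_radial_product:
  fixes f :: "real \<Rightarrow> real"
  assumes [measurable]: "f \<in> borel_measurable borel" and int: "integrable \<mu> (\<lambda>z. f (norm z) * norm z ^ p)"
    and [measurable]: "g \<in> borel_measurable borel" and g: "\<And>z. \<bar>g z\<bar> \<le> C * norm z ^ p"
  shows "integrable \<mu> (\<lambda>z. f (norm z) * g z)"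
proof (rule Bochner_Integration.integrable_bound)
  show "integrable \<mu> (\<lambda>z. C * (f (norm z) * norm z ^ p))" using int by simp
  show "AE z in \<mu>. norm (f (norm z) * g z) \<le> norm (C * (f (norm z) * norm z ^ p))"
  proof (rule AE_I2)
    fix z
    have "\<bar>g z\<bar> \<le> \<bar>C\<bar> * norm z ^ p"
      using g[of z] by (meson abs_ge_self mult_right_mono norm_ge_zero order_trans zero_le_power)
    then have "\<bar>f (norm z)\<bar> * \<bar>g z\<bar> \<le> \<bar>f (norm z)\<bar> * (\<bar>C\<bar> * norm z ^ p)"
      by (rule mult_left_mono) simp
    then show "norm (f (norm z) * g z) \<le> norm (C * (f (norm z) * norm z ^ p))"
      by (simp add: abs_mult mult_ac)
  qed
qed measurable

text \<open>Polarization of the squared moments: \<open>4 (a \<bullet> z) (b \<bullet> z)\<close> is the difference of the squares of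
  \<open>(a + b) \<bullet> z\<close> and \<open>(a - b) \<bullet> z\<close>.  The constant follows by summing over the coordinates.\<close>

lemma second_moment:
  fixes f :: "real \<Rightarrow> real"
  assumes f [measurable]: "f \<in> borel_measurable borel"
    and int: "integrable \<mu> (\<lambda>z. f (norm z) * norm z ^ 2)"
  shows "(\<integral>z. f (norm z) * ((a \<bullet> z) * (b \<bullet> z)) \<partial>\<mu>)
    = (a \<bullet> b) * (\<integral>z. f (norm z) * norm z ^ 2 \<partial>\<mu>) / CARD('k)"
proof -
  obtain e :: "real^'k" where e: "norm e = 1" using vector_choose_size[of 1] by auto
  define K where "K = (\<integral>z. f (norm z) * (e \<bullet> z) ^ 2 \<partial>\<mu>)"
  have sq: "(\<integral>z. f (norm z) * (a \<bullet> z) ^ 2 \<partial>\<mu>) = norm a ^ 2 * K" for a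
    unfolding K_def by (rule radial_power_moment[OF f e])
  have int2: "integrable \<mu> (\<lambda>z. f (norm z) * (a \<bullet> z) ^ 2)" for a
    by (rule integrable_radial_product[OF f int, where C="norm a ^ 2"])
      (auto simp: power_mult_distrib[symmetric] abs_le_square_iff[symmetric] Cauchy_Schwarz_ineq2)
  have sum_axis: "(\<Sum>i\<in>UNIV. (axis i 1 \<bullet> z) ^ 2) = norm z ^ 2" for z :: "real^'k"
  proof -
    have "(axis i 1 \<bullet> z) ^ 2 = z $ i * z $ i" for i by (simp add: inner_axis' power2_eq_square)
    then show ?thesis by (simp add: power2_norm_eq_inner inner_vec_def)
  qed
  have "(\<integral>z. f (norm z) * norm z ^ 2 \<partial>\<mu>) = (\<integral>z. (\<Sum>i\<in>UNIV. f (norm z) * (axis i 1 \<bullet> z) ^ 2) \<partial>\<mu>)"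
    by (simp only: sum_distrib_left[symmetric] sum_axis)
  also have "\<dots> = CARD('k) * K"
    by (subst Bochner_Integration.integral_sum) (auto simp: int2 sq)
  finally have K: "K = (\<integral>z. f (norm z) * norm z ^ 2 \<partial>\<mu>) / CARD('k)" by simp
  have "(\<integral>z. f (norm z) * ((a \<bullet> z) * (b \<bullet> z)) \<partial>\<mu>)
    = (\<integral>z. (1/4) * (f (norm z) * ((a + b) \<bullet> z) ^ 2 - f (norm z) * ((a - b) \<bullet> z) ^ 2) \<partial>\<mu>)"
    by (rule Bochner_Integration.integral_cong[OF refl])
      (simp add: inner_add_left inner_diff_left power2_eq_square algebra_simps)
  also have "\<dots> = (1/4) * (norm (a + b) ^ 2 * K - norm (a - b) ^ 2 * K)"
    by (simp only: integral_mult_right_zero Bochner_Integration.integral_diff[OF int2 int2] sq)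
  also have "\<dots> = (a \<bullet> b) * K"
    by (simp add: power2_norm_eq_inner inner_add_left inner_add_right inner_diff_left inner_diff_right
        inner_commute[of b a] algebra_simps)
  finally show ?thesis by (simp add: K)
qed

text \<open>The product \<open>(a \<bullet> z) (b \<bullet> z) (c \<bullet> z) (d \<bullet> z)\<close> is a signed sum of eight fourth powers
  \<open>((a \<plusminus> b \<plusminus> c \<plusminus> d) \<bullet> z)\<^sup>4\<close>, whose radially weighted integrals are multiples of
  fourth powers of norms.\<close>

lemma fourth_moment:
  fixes f :: "real \<Rightarrow> real"
  assumes f [measurable]: "f \<in> borel_measurable borel"
    and int: "integrable \<mu> (\<lambda>z. f (norm z) * norm z ^ 4)"
  shows "(\<integral>z. f (norm z) * ((a \<bullet> z) * (b \<bullet> z) * (c \<bullet> z) * (d \<bullet> z)) \<partial>\<mu>)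
    = ((a \<bullet> b) * (c \<bullet> d) + (a \<bullet> c) * (b \<bullet> d) + (a \<bullet> d) * (b \<bullet> c)) *
      ((\<integral>z. f (norm z) * norm z ^ 4 \<partial>\<mu>) / (CARD('k) * (CARD('k) + 2)))"
proof -
  obtain e :: "real^'k" where e: "norm e = 1" using vector_choose_size[of 1] by auto
  define K where "K = (\<integral>z. f (norm z) * (e \<bullet> z) ^ 4 \<partial>\<mu>)"
  have pow: "(\<integral>z. f (norm z) * (a \<bullet> z) ^ 4 \<partial>\<mu>) = norm a ^ 4 * K" for a
    unfolding K_def by (rule radial_power_moment[OF f e])
  have int4: "integrable \<mu> (\<lambda>z. f (norm z) * (a \<bullet> z) ^ 4)" for a
  proof (rule integrable_radial_product[OF f int, where C="norm a ^ 4"])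
    fix z
    have "\<bar>a \<bullet> z\<bar> ^ 4 \<le> (norm a * norm z) ^ 4" by (intro power_mono Cauchy_Schwarz_ineq2) auto
    then show "\<bar>(a \<bullet> z) ^ 4\<bar> \<le> norm a ^ 4 * norm z ^ 4" by (simp add: power_mult_distrib power_abs)
  qed measurable
  let ?S = "{1, - 1} :: real set"
  let ?v = "\<lambda>a b c d (s :: real) (t :: real) (r :: real). a + s *\<^sub>R b + t *\<^sub>R c + r *\<^sub>R d"
  have polar: "x * y * u * v = (1/192) * (\<Sum>s\<in>?S. \<Sum>t\<in>?S. \<Sum>r\<in>?S. s * t * r * (x + s * y + t * u + r * v) ^ 4)"
    for x y u v :: real
    by (simp add: power4_eq_xxxx algebra_simps)
  have scale: "k * ((1/192) * (\<Sum>s\<in>?S. \<Sum>t\<in>?S. \<Sum>r\<in>?S. s * t * r * W s t r))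
      = (1/192) * (\<Sum>s\<in>?S. \<Sum>t\<in>?S. \<Sum>r\<in>?S. s * t * r * (k * W s t r))"
    and scale': "(\<Sum>s\<in>?S. \<Sum>t\<in>?S. \<Sum>r\<in>?S. s * t * r * (W s t r * k))
      = (\<Sum>s\<in>?S. \<Sum>t\<in>?S. \<Sum>r\<in>?S. s * t * r * W s t r) * k" for k :: real and W
    by (simp_all add: algebra_simps)
  have normpow: "(\<Sum>s\<in>?S. \<Sum>t\<in>?S. \<Sum>r\<in>?S. s * t * r * norm (?v a b c d s t r) ^ 4)
    = 64 * ((a \<bullet> b) * (c \<bullet> d) + (a \<bullet> c) * (b \<bullet> d) + (a \<bullet> d) * (b \<bullet> c))" for a b c d :: "real^'k"
  proof -
    define A where "A = a \<bullet> a + b \<bullet> b + c \<bullet> c + d \<bullet> d"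
    have "norm (?v a b c d s t r) ^ 4 =
      (A + 2 * (s * (a \<bullet> b) + t * (a \<bullet> c) + r * (a \<bullet> d) + s * t * (b \<bullet> c) + s * r * (b \<bullet> d) + t * r * (c \<bullet> d)))\<^sup>2"
      if "s \<in> ?S" "t \<in> ?S" "r \<in> ?S" for s t r
    proof -
      have "norm (?v a b c d s t r) ^ 4 = (norm (?v a b c d s t r) ^ 2) ^ 2" by simp
      also have "norm (?v a b c d s t r) ^ 2 =
        A + 2 * (s * (a \<bullet> b) + t * (a \<bullet> c) + r * (a \<bullet> d) + s * t * (b \<bullet> c) + s * r * (b \<bullet> d) + t * r * (c \<bullet> d))"
        using that unfolding A_def power2_norm_eq_inner
        by (auto simp: inner_add_left inner_add_right inner_diff_left inner_diff_right inner_commute algebra_simps)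
      finally show ?thesis .
    qed
    then have "(\<Sum>s\<in>?S. \<Sum>t\<in>?S. \<Sum>r\<in>?S. s * t * r * norm (?v a b c d s t r) ^ 4) =
      (\<Sum>s\<in>?S. \<Sum>t\<in>?S. \<Sum>r\<in>?S. s * t * r *
        (A + 2 * (s * (a \<bullet> b) + t * (a \<bullet> c) + r * (a \<bullet> d) + s * t * (b \<bullet> c) + s * r * (b \<bullet> d) + t * r * (c \<bullet> d)))\<^sup>2)"
      by (intro sum.cong refl) auto
    also have "\<dots> = 64 * ((a \<bullet> b) * (c \<bullet> d) + (a \<bullet> c) * (b \<bullet> d) + (a \<bullet> d) * (b \<bullet> c))"
      by (simp add: power2_eq_square algebra_simps)
    finally show ?thesis .
  qed
  have T: "(\<integral>z. f (norm z) * ((a \<bullet> z) * (b \<bullet> z) * (c \<bullet> z) * (d \<bullet> z)) \<partial>\<mu>)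
    = ((a \<bullet> b) * (c \<bullet> d) + (a \<bullet> c) * (b \<bullet> d) + (a \<bullet> d) * (b \<bullet> c)) * (K / 3)" for a b c d
  proof -
    have "(\<integral>z. f (norm z) * ((a \<bullet> z) * (b \<bullet> z) * (c \<bullet> z) * (d \<bullet> z)) \<partial>\<mu>) =
      (\<integral>z. (1/192) * (\<Sum>s\<in>?S. \<Sum>t\<in>?S. \<Sum>r\<in>?S. s * t * r * (f (norm z) * (?v a b c d s t r \<bullet> z) ^ 4)) \<partial>\<mu>)"
      by (rule Bochner_Integration.integral_cong[OF refl], subst polar)
        (simp only: inner_add_left inner_scaleR_left scale)
    also have "\<dots> = (1/192) * (\<Sum>s\<in>?S. \<Sum>t\<in>?S. \<Sum>r\<in>?S. s * t * r * (norm (?v a b c d s t r) ^ 4 * K))"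
      by (subst integral_mult_right_zero)
        (simp only: Bochner_Integration.integral_sum Bochner_Integration.integrable_sum
          integrable_mult_right int4 integral_mult_right_zero pow)
    also have "\<dots> = (1/192) * ((\<Sum>s\<in>?S. \<Sum>t\<in>?S. \<Sum>r\<in>?S. s * t * r * norm (?v a b c d s t r) ^ 4) * K)"
      unfolding scale' ..
    finally have *: "(\<integral>z. f (norm z) * ((a \<bullet> z) * (b \<bullet> z) * (c \<bullet> z) * (d \<bullet> z)) \<partial>\<mu>)
      = (1/192) * (64 * ((a \<bullet> b) * (c \<bullet> d) + (a \<bullet> c) * (b \<bullet> d) + (a \<bullet> d) * (b \<bullet> c)) * K)"
      unfolding normpow .
    have "(1/192) * (64 * Y * K) = Y * (K / 3)" for Y by simp
    then show ?thesis unfolding * .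
  qed
  have intT: "integrable \<mu> (\<lambda>z. f (norm z) * ((axis i 1 \<bullet> z) * (axis i 1 \<bullet> z) * (axis j 1 \<bullet> z) * (axis j 1 \<bullet> z)))" for i j :: 'k
  proof (rule integrable_radial_product[OF f int, where C=1])
    fix z :: "real^'k"
    have i: "\<bar>axis i 1 \<bullet> z\<bar> \<le> norm z" for i :: 'k by (simp add: inner_axis' component_le_norm_cart)
    have "\<bar>axis i 1 \<bullet> z\<bar> * \<bar>axis i 1 \<bullet> z\<bar> * \<bar>axis j 1 \<bullet> z\<bar> * \<bar>axis j 1 \<bullet> z\<bar> \<le> norm z * norm z * norm z * norm z"
      by (intro mult_mono i) auto
    then show "\<bar>(axis i 1 \<bullet> z) * (axis i 1 \<bullet> z) * (axis j 1 \<bullet> z) * (axis j 1 \<bullet> z)\<bar> \<le> 1 * norm z ^ 4"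
      by (simp add: abs_mult power4_eq_xxxx mult_ac)
  qed measurable
  have "(\<integral>z. f (norm z) * norm z ^ 4 \<partial>\<mu>) = (\<integral>z. (\<Sum>i\<in>UNIV. \<Sum>j\<in>UNIV.
      f (norm z) * ((axis i 1 \<bullet> z) * (axis i 1 \<bullet> z) * (axis j 1 \<bullet> z) * (axis j 1 \<bullet> z))) \<partial>\<mu>)"
  proof (rule Bochner_Integration.integral_cong[OF refl])
    fix z :: "real^'k"
    have "norm z ^ 4 = (z \<bullet> z) * (z \<bullet> z)" by (simp add: power2_norm_eq_inner[symmetric] power4_eq_xxxx power2_eq_square)
    also have "\<dots> = (\<Sum>i\<in>UNIV. \<Sum>j\<in>UNIV. (axis i 1 \<bullet> z) * (axis i 1 \<bullet> z) * ((axis j 1 \<bullet> z) * (axis j 1 \<bullet> z)))"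
    proof -
      have "(axis i 1 \<bullet> z) * (axis i 1 \<bullet> z) = z $ i * z $ i" for i by (simp add: inner_axis')
      then show ?thesis by (simp add: sum_product inner_vec_def)
    qed
    finally show "f (norm z) * norm z ^ 4 = (\<Sum>i\<in>UNIV. \<Sum>j\<in>UNIV.
      f (norm z) * ((axis i 1 \<bullet> z) * (axis i 1 \<bullet> z) * (axis j 1 \<bullet> z) * (axis j 1 \<bullet> z)))"
      by (simp only: sum_distrib_left mult.assoc)
  qed
  also have "\<dots> = (\<Sum>i\<in>(UNIV :: 'k set). \<Sum>j\<in>(UNIV :: 'k set). (1 + 2 * of_bool (i = j)) * (K / 3))"
  proof -
    have "(\<integral>z. f (norm z) * ((axis i 1 \<bullet> z) * (axis i 1 \<bullet> z) * (axis j 1 \<bullet> z) * (axis j 1 \<bullet> z)) \<partial>\<mu>)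
      = (1 + 2 * of_bool (i = j)) * (K / 3)" for i j :: 'k
      unfolding T by (simp add: inner_axis_axis)
    then show ?thesis
      by (simp only: Bochner_Integration.integral_sum Bochner_Integration.integrable_sum intT)
  qed
  also have "\<dots> = (\<Sum>i\<in>(UNIV :: 'k set). \<Sum>j\<in>(UNIV :: 'k set). 1 + 2 * of_bool (i = j)) * (K / 3)"
    by (simp only: sum_distrib_right)
  also have "(\<Sum>i\<in>(UNIV :: 'k set). \<Sum>j\<in>(UNIV :: 'k set). 1 + 2 * of_bool (i = j)) = (CARD('k) * (CARD('k) + 2) :: real)"
    by (simp add: sum.distrib sum_distrib_left[symmetric] algebra_simps of_bool_def)
  finally have total: "(\<integral>z. f (norm z) * norm z ^ 4 \<partial>\<mu>) = real (CARD('k) * (CARD('k) + 2)) * (K / 3)"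
    by simp
  have "real (CARD('k) * (CARD('k) + 2)) \<noteq> 0"
    by (simp only: of_nat_eq_0_iff mult_eq_0_iff) simp
  then have K3: "K / 3 = (\<integral>z. f (norm z) * norm z ^ 4 \<partial>\<mu>) / (CARD('k) * (CARD('k) + 2))"
    unfolding total by (rule nonzero_mult_div_cancel_left[symmetric])
  show ?thesis by (rule T[of a b c d, unfolded K3])
qed

lemma matrix_fourth_moment:
  fixes f :: "real \<Rightarrow> real" and E :: "real^'k^'k"
  assumes f [measurable]: "f \<in> borel_measurable borel"
    and int: "integrable \<mu> (\<lambda>z. f (norm z) * norm z ^ 4)"
  shows "(\<integral>z. f (norm z) * ((z \<bullet> (E *v z)) * (z $ i * z $ j)) \<partial>\<mu>)
    = (trace E * mat 1 $ i $ j + E $ i $ j + E $ j $ i) *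
      ((\<integral>z. f (norm z) * norm z ^ 4 \<partial>\<mu>) / (CARD('k) * (CARD('k) + 2)))"
    (is "_ = _ * ?K")
proof -
  have intT: "integrable \<mu> (\<lambda>z. f (norm z) * (z $ a * z $ b * z $ i * z $ j))" for a b
  proof (rule integrable_radial_product[OF f int, where C=1])
    fix z :: "real^'k"
    have "\<bar>z $ a\<bar> * \<bar>z $ b\<bar> * \<bar>z $ i\<bar> * \<bar>z $ j\<bar> \<le> norm z * norm z * norm z * norm z"
      by (intro mult_mono component_le_norm_cart) auto
    then show "\<bar>z $ a * z $ b * z $ i * z $ j\<bar> \<le> 1 * norm z ^ 4"
      by (simp add: abs_mult power4_eq_xxxx mult_ac)
  qed measurable
  have T: "(\<integral>z. f (norm z) * (z $ a * z $ b * z $ i * z $ j) \<partial>\<mu>)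
     = (mat 1 $ a $ b * mat 1 $ i $ j + mat 1 $ a $ i * mat 1 $ b $ j + mat 1 $ a $ j * mat 1 $ b $ i) * ?K" for a b
  proof -
    have ax: "axis a 1 \<bullet> (axis b 1 :: real^'k) = mat 1 $ a $ b" for a b
      by (simp add: inner_axis_axis mat_def)
    have az: "axis a 1 \<bullet> z = z $ a" for a and z :: "real^'k" by (simp add: inner_axis')
    show ?thesis using fourth_moment[OF f int, of "axis a 1" "axis b 1" "axis i 1" "axis j 1"]
      by (simp only: ax) (simp only: az)
  qed
  have "(\<integral>z. f (norm z) * ((z \<bullet> (E *v z)) * (z $ i * z $ j)) \<partial>\<mu>) =
    (\<integral>z. (\<Sum>a\<in>UNIV. \<Sum>b\<in>UNIV. E $ a $ b * (f (norm z) * (z $ a * z $ b * z $ i * z $ j))) \<partial>\<mu>)"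
    by (rule Bochner_Integration.integral_cong[OF refl])
      (simp add: inner_vec_def matrix_vector_mult_def sum_distrib_left sum_distrib_right mult_ac)
  also have "\<dots> = (\<Sum>a\<in>UNIV. \<Sum>b\<in>UNIV. E $ a $ b * ((mat 1 $ a $ b * mat 1 $ i $ j + mat 1 $ a $ i * mat 1 $ b $ j + mat 1 $ a $ j * mat 1 $ b $ i) * ?K))"
    by (simp only: Bochner_Integration.integral_sum Bochner_Integration.integrable_sum
        integrable_mult_right intT integral_mult_right_zero T)
  also have "\<dots> = (\<Sum>a\<in>UNIV. \<Sum>b\<in>UNIV. E $ a $ b * (mat 1 $ a $ b * mat 1 $ i $ j + mat 1 $ a $ i * mat 1 $ b $ j + mat 1 $ a $ j * mat 1 $ b $ i)) * ?K"
    by (simp only: sum_distrib_right mult.assoc)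
  also have "(\<Sum>a\<in>UNIV. \<Sum>b\<in>UNIV. E $ a $ b * (mat 1 $ a $ b * mat 1 $ i $ j + mat 1 $ a $ i * mat 1 $ b $ j + mat 1 $ a $ j * mat 1 $ b $ i))
    = trace E * mat 1 $ i $ j + E $ i $ j + E $ j $ i"
  proof -
    have 1: "(\<Sum>a\<in>UNIV. \<Sum>b\<in>UNIV. E $ a $ b * (mat 1 $ a $ b * mat 1 $ i $ j)) = trace E * mat 1 $ i $ j"
    proof -
      have "(\<Sum>b\<in>UNIV. E $ a $ b * (mat 1 $ a $ b * mat 1 $ i $ j)) = (\<Sum>b\<in>UNIV. if b = a then E $ a $ a * mat 1 $ i $ j else 0)" for a
        by (rule sum.cong) (auto simp: mat_def)
      then show ?thesis by (simp add: trace_def sum_distrib_right)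
    qed
    have 2: "(\<Sum>a\<in>UNIV. \<Sum>b\<in>UNIV. E $ a $ b * (mat 1 $ a $ i * mat 1 $ b $ j)) = E $ i $ j" for i j
    proof -
      have "(\<Sum>b\<in>UNIV. E $ a $ b * (mat 1 $ a $ i * mat 1 $ b $ j)) = (\<Sum>b\<in>UNIV. if b = j then (if a = i then E $ i $ j else 0) else 0)" for a
        by (rule sum.cong) (auto simp: mat_def)
      then show ?thesis by simp
    qed
    show ?thesis
      unfolding distrib_left sum.distrib 1 2 ..
  qed
  finally show ?thesis .
qed

end

text \<open>Orthogonal maps preserve both Lebesgue measure and the norm.\<close>

lemma spherical_law_density:
  fixes f :: "real \<Rightarrow> real"
  assumes [measurable]: "(\<lambda>z :: real^'k. f (norm z)) \<in> borel_measurable borel"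
    and total: "(\<integral>\<^sup>+z. ennreal (f (norm z)) \<partial>(lborel :: (real^'k) measure)) = 1"
  shows "spherical_law (density lborel (\<lambda>z :: real^'k. ennreal (f (norm z))))"
proof -
  let ?M = "density lborel (\<lambda>z :: real^'k. ennreal (f (norm z)))"
  interpret prob_space ?M
    by (rule prob_spaceI) (simp add: emeasure_density total del: nn_integral_density)
  show ?thesis
  proof
    show "sets ?M = sets borel" by simp
    fix U :: "real^'k \<Rightarrow> real^'k" assume U: "orthogonal_transformation U"
    then have U': "linear U" by (simp add: orthogonal_transformation)
    have [measurable]: "U \<in> borel_measurable borel"
      using U' by (intro borel_measurable_continuous_onI linear_continuous_on) (simp add: linear_linear)
    have om: "orthogonal_matrix (matrix U)" using U orthogonal_transformation_matrix by blast
    then have inv: "invertible (matrix U)"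
      by (auto simp: orthogonal_matrix_def invertible_def)
    have det: "\<bar>det (matrix U)\<bar> = 1" using det_orthogonal_matrix[OF om] by auto
    have Uv: "matrix U *v x = U x" for x by (simp add: matrix_works U')
    show "distr ?M borel U = ?M"
    proof (rule measure_eqI)
      fix A :: "(real^'k) set" assume "A \<in> sets (distr ?M borel U)"
      then have [measurable]: "A \<in> sets borel" by simp
      have "emeasure ?M A = (\<integral>\<^sup>+z. ennreal (f (norm z)) * indicator A z \<partial>lborel)"
        by (simp add: emeasure_density)
      also have "\<dots> = (\<integral>\<^sup>+z. ennreal (f (norm (U z))) * indicator A (U z) \<partial>lborel)"
        by (subst nn_integral_affine[OF inv, of _ 0]) (simp_all add: det Uv)
      also have "\<dots> = (\<integral>\<^sup>+z. ennreal (f (norm z)) * indicator (U -` A) z \<partial>lborel)"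
        by (simp add: orthogonal_transformation_norm[OF U] indicator_vimage[symmetric] indicator_def)
      also have "\<dots> = emeasure ?M (U -` A)"
        using measurable_sets_borel[of U borel A] by (simp add: emeasure_density)
      also have "\<dots> = emeasure (distr ?M borel U) A" by (simp add: emeasure_distr)
      finally show "emeasure (distr ?M borel U) A = emeasure ?M A" by simp
    qed simp
  next
    show "AE z in ?M. z \<noteq> 0"
      by (subst AE_density) (auto intro: AE_mp[OF AE_lborel_singleton])
  qed
qed

section \<open>Contaminated measures\<close>

lemma contaminated_measure:
  assumes "s \<in> space P" "0 \<le> h" "h \<le> 1"
  shows space_contaminated: "space (contaminated P s h) = space P"
    and sets_contaminated: "sets (contaminated P s h) = sets P"
    and emeasure_contaminated: "A \<in> sets P \<Longrightarrow> emeasure (contaminated P s h) A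
      = ennreal (1 - h) * emeasure P A + ennreal h * indicator A s"
proof -
  show sets: "sets (contaminated P s h) = sets P"
    unfolding contaminated_def by (simp add: sets.space_closed sets_measure_of sets.sigma_sets_eq)
  show "space (contaminated P s h) = space P"
    unfolding contaminated_def by (simp add: sets.space_closed space_measure_of)
  assume A: "A \<in> sets P"
  have "emeasure (contaminated P s h) A = ennreal (1 - h) * emeasure P A + ennreal h * emeasure (return P s) A"
  proof (rule emeasure_measure_of[OF contaminated_def])
    show "sets P \<subseteq> Pow (space P)" by (rule sets.space_closed)
    show "positive (sets (contaminated P s h)) (\<lambda>A. ennreal (1 - h) * emeasure P A + ennreal h * emeasure (return P s) A)"
      by (simp add: positive_def)
    show "countably_additive (sets (contaminated P s h)) (\<lambda>A. ennreal (1 - h) * emeasure P A + ennreal h * emeasure (return P s) A)"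
      unfolding countably_additive_def sets
    proof (intro allI impI)
      fix B :: "nat \<Rightarrow> _" assume B: "range B \<subseteq> sets P" "disjoint_family B"
      then have B': "range B \<subseteq> sets (return P s)" by simp
      have "(\<Sum>i. ennreal (1 - h) * emeasure P (B i) + ennreal h * emeasure (return P s) (B i))
        = (\<Sum>i. ennreal (1 - h) * emeasure P (B i)) + (\<Sum>i. ennreal h * emeasure (return P s) (B i))"
        by (rule suminf_add[symmetric]) auto
      also have "\<dots> = ennreal (1 - h) * (\<Sum>i. emeasure P (B i)) + ennreal h * (\<Sum>i. emeasure (return P s) (B i))"
        by (simp only: ennreal_suminf_cmult)
      also have "\<dots> = ennreal (1 - h) * emeasure P (\<Union>(range B)) + ennreal h * emeasure (return P s) (\<Union>(range B))"
        using suminf_emeasure[OF B] suminf_emeasure[OF B' B(2)] by simp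
      finally show "(\<Sum>i. ennreal (1 - h) * emeasure P (B i) + ennreal h * emeasure (return P s) (B i))
        = ennreal (1 - h) * emeasure P (\<Union>(range B)) + ennreal h * emeasure (return P s) (\<Union>(range B))" .
    qed
    show "A \<in> sets (contaminated P s h)" using A sets by simp
  qed
  then show "emeasure (contaminated P s h) A = ennreal (1 - h) * emeasure P A + ennreal h * indicator A s"
    using A by (simp add: emeasure_return)
qed

lemma nn_integral_contaminated:
  assumes s: "s \<in> space P" "0 \<le> h" "h \<le> 1" and f: "f \<in> borel_measurable P"
  shows "(\<integral>\<^sup>+x. f x \<partial>contaminated P s h) = ennreal (1 - h) * (\<integral>\<^sup>+x. f x \<partial>P) + ennreal h * f s"
  using f
proof (induction rule: borel_measurable_induct)
  note [measurable_cong] = sets_contaminated[OF s]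
  {
    case (cong f g)
    have "(\<integral>\<^sup>+x. f x \<partial>contaminated P s h) = (\<integral>\<^sup>+x. g x \<partial>contaminated P s h)"
      "(\<integral>\<^sup>+x. f x \<partial>P) = (\<integral>\<^sup>+x. g x \<partial>P)"
      using cong(3) by (auto intro!: nn_integral_cong simp: space_contaminated[OF s])
    then show ?case using cong(3,4) s(1) by simp
  next
    case (set A)
    then show ?case by (simp add: sets_contaminated[OF s] emeasure_contaminated[OF s])
  next
    case (mult u c)
    then show ?case by (simp add: nn_integral_cmult distrib_left mult_ac)
  next
    case (add u v)
    then show ?case by (simp add: nn_integral_add distrib_left add_ac)
  next
    case (seq U)
    have inc: "incseq (\<lambda>i. ennreal (1 - h) * (\<integral>\<^sup>+x. U i x \<partial>P))" "incseq (\<lambda>i. ennreal h * U i s)"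
      using seq(3) by (auto simp: incseq_def le_fun_def intro!: mult_left_mono nn_integral_mono)
    have sup: "(\<Squnion>(range U)) x = (SUP i. U i x)" for x by (simp add: SUP_apply image_image)
    have "(\<integral>\<^sup>+x. (SUP i. U i x) \<partial>contaminated P s h) = (SUP i. \<integral>\<^sup>+x. U i x \<partial>contaminated P s h)"
      using seq(1,3) by (intro nn_integral_monotone_convergence_SUP) auto
    also have "\<dots> = (SUP i. ennreal (1 - h) * (\<integral>\<^sup>+x. U i x \<partial>P) + ennreal h * U i s)"
      using seq.IH by simp
    also have "\<dots> = (SUP i. ennreal (1 - h) * (\<integral>\<^sup>+x. U i x \<partial>P)) + (SUP i. ennreal h * U i s)"
      by (rule ennreal_SUP_add[OF inc])
    also have "\<dots> = ennreal (1 - h) * (SUP i. (\<integral>\<^sup>+x. U i x \<partial>P)) + ennreal h * (SUP i. U i s)"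
      by (simp only: SUP_mult_left_ennreal)
    also have "(SUP i. (\<integral>\<^sup>+x. U i x \<partial>P)) = (\<integral>\<^sup>+x. (SUP i. U i x) \<partial>P)"
      using seq(1,3) by (intro nn_integral_monotone_convergence_SUP[symmetric]) auto
    finally show ?case unfolding sup .
  }
qed

lemma integral_contaminated:
  fixes f :: "'a \<Rightarrow> real"
  assumes s: "s \<in> space P" "0 \<le> h" "h \<le> 1" and f: "integrable P f"
  shows integrable_contaminated: "integrable (contaminated P s h) f"
    and "(\<integral>x. f x \<partial>contaminated P s h) = (1 - h) * (\<integral>x. f x \<partial>P) + h * f s"
proof -
  note [measurable_cong] = sets_contaminated[OF s]
  have [measurable]: "f \<in> borel_measurable P" using f by simp
  have fin: "(\<integral>\<^sup>+x. ennreal (f x) \<partial>P) < \<infinity>" "(\<integral>\<^sup>+x. ennreal (- f x) \<partial>P) < \<infinity>"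
    using f by (auto simp: real_integrable_def less_top)
  have fin': "(\<integral>\<^sup>+x. ennreal (norm (f x)) \<partial>P) < \<infinity>"
    using f by (simp add: integrable_iff_bounded)
  show i: "integrable (contaminated P s h) f"
    using fin' by (auto simp: integrable_iff_bounded nn_integral_contaminated[OF s] ennreal_mult_less_top)
  have part: "enn2real (\<integral>\<^sup>+x. ennreal (g x) \<partial>contaminated P s h)
     = (1 - h) * enn2real (\<integral>\<^sup>+x. ennreal (g x) \<partial>P) + h * max 0 (g s)"
    if [measurable]: "g \<in> borel_measurable P" and "(\<integral>\<^sup>+x. ennreal (g x) \<partial>P) < \<infinity>" for g :: "'a \<Rightarrow> real"
  proof -
    have "enn2real (ennreal h * ennreal (g s)) = h * max 0 (g s)"
      using s by (simp add: enn2real_mult max_def enn2real_eq_0_iff ennreal_neg)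
    then show ?thesis
      using s that(2)
      by (simp add: nn_integral_contaminated[OF s] enn2real_plus ennreal_mult_less_top enn2real_mult)
  qed
  have "(\<integral>x. f x \<partial>contaminated P s h) = (1 - h) * (\<integral>x. f x \<partial>P) + h * (max 0 (f s) - max 0 (- f s))"
    using part[of f] part[of "\<lambda>x. - f x"] fin
    by (simp add: real_lebesgue_integral_def[OF f] real_lebesgue_integral_def[OF i] algebra_simps)
  then show "(\<integral>x. f x \<partial>contaminated P s h) = (1 - h) * (\<integral>x. f x \<partial>P) + h * f s"
    by (simp add: max_def split: if_splits)
qed

lemma prob_space_contaminated:
  assumes "prob_space P" "s \<in> space P" "0 \<le> h" "h \<le> 1"
  shows "prob_space (contaminated P s h)"
proof (rule prob_spaceI)
  interpret prob_space P by fact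
  have "ennreal (1 - h) + ennreal h = 1"
    using assms by (subst ennreal_plus[symmetric]) auto
  then show "emeasure (contaminated P s h) (space (contaminated P s h)) = 1"
    using assms by (simp add: space_contaminated emeasure_contaminated emeasure_space_1)
qed

section \<open>Stationarity and mean values for weighted quadratic forms\<close>

context redescending_loss
begin

text \<open>Differentiation under the integral sign needs no bound on the derivative where the loss is
  locally constant, which is why only points with \<open>q t s \<le> c1\<^sup>2\<close> or \<open>q 0 s \<le> c1\<^sup>2\<close> matter.\<close>

lemma stationary_at_local_min:
  fixes q :: "real \<Rightarrow> 's \<Rightarrow> real" and q' G :: "'s \<Rightarrow> real"
  assumes Q: "finite_measure Q" and \<epsilon>: "0 < \<epsilon>"
    and meas: "\<And>t. \<bar>t\<bar> < \<epsilon> \<Longrightarrow> q t \<in> borel_measurable Q" "q' \<in> borel_measurable Q"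
    and nonneg: "\<And>t s. \<bar>t\<bar> < \<epsilon> \<Longrightarrow> 0 \<le> q t s"
    and deriv: "\<And>s. ((\<lambda>t. q t s) has_real_derivative q' s) (at 0)"
    and bound: "\<And>t s. \<bar>t\<bar> < \<epsilon> \<Longrightarrow> q t s \<le> c1\<^sup>2 \<or> q 0 s \<le> c1\<^sup>2 \<Longrightarrow> \<bar>q t s - q 0 s\<bar> \<le> \<bar>t\<bar> * G s"
    and G: "integrable Q G"
    and min: "\<forall>\<^sub>F t in at 0. (\<integral>s. \<rho> (sqrt (q 0 s)) \<partial>Q) \<le> (\<integral>s. \<rho> (sqrt (q t s)) \<partial>Q)"
  shows "(\<integral>s. w (q 0 s) * q' s \<partial>Q) = 0"
proof -
  interpret finite_measure Q by fact
  obtain M where M: "0 < M" "\<And>q. 0 \<le> q \<Longrightarrow> \<bar>\<rho> (sqrt q)\<bar> \<le> M" "\<And>q. 0 \<le> q \<Longrightarrow> \<bar>w q\<bar> \<le> M"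
    using bounded_weights by metis
  define F where "F t = (\<integral>s. \<rho> (sqrt (q t s)) \<partial>Q)" for t
  have I: "{- \<epsilon><..<\<epsilon>} = {t. \<bar>t\<bar> < \<epsilon>}" by auto
  have at: "at (0::real) within {- \<epsilon><..<\<epsilon>} = at 0" using \<epsilon> by (intro at_within_open) auto
  have meas_rho: "(\<lambda>s. \<rho> (sqrt (q t s))) \<in> borel_measurable Q" if "\<bar>t\<bar> < \<epsilon>" for t
    using meas(1)[OF that] by measurable
  have int: "integrable Q (\<lambda>s. \<rho> (sqrt (q t s)))" if "\<bar>t\<bar> < \<epsilon>" for t
    using M(2) nonneg[OF that] by (intro integrable_const_bound[where B=M] meas_rho that) auto
  have lim: "((\<lambda>t. (\<rho> (sqrt (q t s)) - \<rho> (sqrt (q 0 s))) / t) \<longlongrightarrow> w (q 0 s) / 2 * q' s) (at 0 within {- \<epsilon><..<\<epsilon>})" for s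
  proof -
    have "((\<lambda>q. \<rho> (sqrt q)) has_real_derivative w (q 0 s) / 2) (at (q 0 s) within (\<lambda>t. q t s) ` {- \<epsilon><..<\<epsilon>})"
      by (rule has_field_derivative_subset[OF rho_sqrt_has_derivative]) (use nonneg \<epsilon> in \<open>auto simp: I\<close>)
    from DERIV_image_chain[OF this, of "q' s"] deriv[of s]
    have "((\<lambda>q. \<rho> (sqrt q)) \<circ> (\<lambda>t. q t s) has_real_derivative w (q 0 s) / 2 * q' s) (at 0 within {- \<epsilon><..<\<epsilon>})"
      by (simp add: at)
    then show ?thesis by (simp add: has_field_derivative_iff o_def)
  qed
  have dom: "\<bar>(\<rho> (sqrt (q t s)) - \<rho> (sqrt (q 0 s))) / t\<bar> \<le> M * \<bar>G s\<bar>" if t: "\<bar>t\<bar> < \<epsilon>" "t \<noteq> 0" for t s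
  proof (cases "q t s \<le> c1\<^sup>2 \<or> q 0 s \<le> c1\<^sup>2")
    case True
    have "\<bar>\<rho> (sqrt (q t s)) - \<rho> (sqrt (q 0 s))\<bar> \<le> M * \<bar>q t s - q 0 s\<bar>"
      using M(3) nonneg t \<epsilon> by (intro rho_sqrt_lipschitz) auto
    also have "\<dots> \<le> M * (\<bar>t\<bar> * \<bar>G s\<bar>)"
      using bound[OF t(1) True] M(1) mult_left_mono[OF abs_ge_self[of "G s"], of "\<bar>t\<bar>"]
      by (intro mult_left_mono) auto
    finally show ?thesis using t by (simp add: abs_divide field_simps)
  next
    case False
    then show ?thesis using M(1) by (simp add: rho_sqrt_beyond)
  qed
  have "(F has_real_derivative (\<integral>s. w (q 0 s) / 2 * q' s \<partial>Q)) (at 0 within {- \<epsilon><..<\<epsilon>})"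
    unfolding has_field_derivative_iff tendsto_at_iff_sequentially
  proof (intro allI impI)
    fix X :: "nat \<Rightarrow> real" assume X: "\<forall>i. X i \<in> {- \<epsilon><..<\<epsilon>} - {0}" "X \<longlonglongrightarrow> 0"
    then have Xi: "\<bar>X i\<bar> < \<epsilon>" "X i \<noteq> 0" for i by (auto simp: I)
    have "(\<lambda>i. \<integral>s. (\<rho> (sqrt (q (X i) s)) - \<rho> (sqrt (q 0 s))) / X i \<partial>Q) \<longlonglongrightarrow> (\<integral>s. w (q 0 s) / 2 * q' s \<partial>Q)"
    proof (rule integral_dominated_convergence)
      show "(\<lambda>s. w (q 0 s) / 2 * q' s) \<in> borel_measurable Q"
      proof -
        have [measurable]: "q 0 \<in> borel_measurable Q" "q' \<in> borel_measurable Q"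
          using meas(1)[of 0] meas(2) \<epsilon> by auto
        show ?thesis by measurable
      qed
      show "(\<lambda>s. (\<rho> (sqrt (q (X i) s)) - \<rho> (sqrt (q 0 s))) / X i) \<in> borel_measurable Q" for i
        using meas_rho[OF Xi(1)] meas_rho[of 0] \<epsilon> by (intro borel_measurable_divide borel_measurable_diff) auto
      show "integrable Q (\<lambda>s. M * \<bar>G s\<bar>)" using G by simp
      show "AE s in Q. (\<lambda>i. (\<rho> (sqrt (q (X i) s)) - \<rho> (sqrt (q 0 s))) / X i) \<longlonglongrightarrow> w (q 0 s) / 2 * q' s"
        using lim X unfolding tendsto_at_iff_sequentially o_def by auto
      show "AE s in Q. norm ((\<rho> (sqrt (q (X i) s)) - \<rho> (sqrt (q 0 s))) / X i) \<le> M * \<bar>G s\<bar>" for i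
        using dom[OF Xi] by simp
    qed
    moreover have "(\<integral>s. (\<rho> (sqrt (q (X i) s)) - \<rho> (sqrt (q 0 s))) / X i \<partial>Q) = (F (X i) - F 0) / (X i - 0)" for i
      using int[OF Xi(1)[of i]] int[of 0] \<epsilon> by (simp add: F_def)
    ultimately show "((\<lambda>y. (F y - F 0) / (y - 0)) \<circ> X) \<longlonglongrightarrow> (\<integral>s. w (q 0 s) / 2 * q' s \<partial>Q)"
      by (simp only: o_def)
  qed
  then have D: "DERIV F 0 :> (\<integral>s. w (q 0 s) / 2 * q' s \<partial>Q)" by (simp add: at)
  obtain d where "0 < d" and d: "\<And>t. t \<noteq> 0 \<Longrightarrow> dist t 0 < d \<Longrightarrow> F 0 \<le> F t"
    using min unfolding eventually_at F_def by auto
  have "\<forall>t. \<bar>0 - t\<bar> < d \<longrightarrow> F 0 \<le> F t"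
  proof (intro allI impI)
    fix t :: real assume "\<bar>0 - t\<bar> < d"
    then show "F 0 \<le> F t" using d[of t] by (cases "t = 0") (auto simp: dist_real_def)
  qed
  from DERIV_local_min[OF D \<open>0 < d\<close> this] have "(\<integral>s. (1/2) * (w (q 0 s) * q' s) \<partial>Q) = 0"
    by simp
  then show ?thesis unfolding integral_mult_right_zero by simp
qed

text \<open>At a zero of \<open>q\<close>, where \<open>w\<close> need not be differentiable, the factor \<open>p\<close> vanishes, so continuity of \<open>w\<close>
  suffices to differentiate the product.\<close>

lemma DERIV_weighted:
  assumes q: "(q has_real_derivative q') (at t)" and p: "(p has_real_derivative p') (at t)"
    and "0 \<le> q t" and zero: "q t = 0 \<Longrightarrow> p t = 0"
  shows "((\<lambda>t. w (q t) * p t) has_real_derivative w (q t) * p' + \<kappa> (q t) * q' * p t) (at t)"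
proof (cases "q t = 0")
  case True
  have "((\<lambda>s. w (q s)) \<longlongrightarrow> w (q t)) (at t)"
    using continuous_w DERIV_isCont[OF q]
    by (intro isCont_tendsto_compose[where g=w]) (auto simp: continuous_on_eq_continuous_at isCont_def)
  moreover have "((\<lambda>s. (p s - p t) / (s - t)) \<longlongrightarrow> p') (at t)" using p by (simp add: has_field_derivative_iff)
  ultimately have "((\<lambda>s. w (q s) * ((p s - p t) / (s - t))) \<longlongrightarrow> w (q t) * p') (at t)"
    by (rule tendsto_mult)
  then show ?thesis using zero[OF True] by (simp add: has_field_derivative_iff True)
next
  case False
  then have "0 < q t" using assms(3) by simp
  from DERIV_mult[OF DERIV_chain2[OF DERIV_w[OF this] q] p] show ?thesis
    by (rule DERIV_cong) (simp add: mult_ac)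
qed

lemma weighted_mvt:
  assumes q: "\<And>t. 0 \<le> t \<Longrightarrow> t \<le> 1 \<Longrightarrow> (q has_real_derivative q' t) (at t)"
    and p: "\<And>t. 0 \<le> t \<Longrightarrow> t \<le> 1 \<Longrightarrow> (p has_real_derivative p' t) (at t)"
    and nonneg: "\<And>t. 0 \<le> t \<Longrightarrow> t \<le> 1 \<Longrightarrow> 0 \<le> q t"
    and zero: "\<And>t. 0 \<le> t \<Longrightarrow> t \<le> 1 \<Longrightarrow> q t = 0 \<Longrightarrow> p t = 0"
  obtains t where "0 \<le> t" "t \<le> 1" "w (q 1) * p 1 - w (q 0) * p 0 = w (q t) * p' t + \<kappa> (q t) * q' t * p t"
proof -
  have "\<exists>t. 0 < t \<and> t < 1 \<and> w (q 1) * p 1 - w (q 0) * p 0 = (1 - 0) * (w (q t) * p' t + \<kappa> (q t) * q' t * p t)"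
    by (rule MVT2) (use DERIV_weighted[OF q p nonneg zero] in auto)
  then obtain t where "0 < t" "t < 1"
    "w (q 1) * p 1 - w (q 0) * p 0 = (1 - 0) * (w (q t) * p' t + \<kappa> (q t) * q' t * p t)" by blast
  then show thesis by (intro that[of t]) auto
qed

end

lemma quadratic_path_derivative:
  fixes A E :: "real^'k^'k"
  defines "z' \<equiv> \<lambda>z x t. z - t *\<^sub>R x" and "A' \<equiv> \<lambda>t. A + t *\<^sub>R E"
  assumes "transpose A = A" "transpose E = E"
  shows "((\<lambda>t. z' z x t \<bullet> (A' t *v z' z x t)) has_real_derivative
    (z' z x t \<bullet> (E *v z' z x t) - 2 * (x \<bullet> (A' t *v z' z x t)))) (at t)"
proof -
  have z: "(z' z x has_vector_derivative - x) (at t)"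
    unfolding z'_def by (auto intro!: derivative_eq_intros)
  have A: "(A' has_vector_derivative E) (at t)"
    unfolding A'_def by (auto intro!: derivative_eq_intros)
  have sym: "transpose (A' t) = A' t" by (simp add: A'_def transpose_add transpose_scaleR assms)
  have "((\<lambda>t. z' z x t \<bullet> (A' t *v z' z x t)) has_vector_derivative
     (z' z x t \<bullet> (A' t *v (- x) + E *v z' z x t) + (- x) \<bullet> (A' t *v z' z x t))) (at t)"
    by (rule bounded_bilinear.has_vector_derivative[OF bounded_bilinear_inner z
        mv.has_vector_derivative[OF A z]])
  moreover have "z' z x t \<bullet> (A' t *v x) = x \<bullet> (A' t *v z' z x t)"
    using inner_symmetric_matrix[OF sym, of "z' z x t" x] by (simp add: inner_commute)
  ultimately show ?thesis
    unfolding has_real_derivative_iff_has_vector_derivative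
    by (simp add: inner_add_right mv.minus_right algebra_simps)
qed

section \<open>Linearizing the weighted moments in the standardized model\<close>

lemma borel_measurable_matrix_vector_right [measurable]:
  fixes b :: "real^'q" shows "(\<lambda>X :: real^'q^'k. X *v b) \<in> borel_measurable borel"
  by (intro borel_measurable_continuous_onI linear_continuous_on) (rule mv.bounded_linear_left)

lemma borel_measurable_vec_nth_comp [measurable (raw)]:
  fixes f :: "'a \<Rightarrow> real^'k"
  assumes "f \<in> borel_measurable M" shows "(\<lambda>x. f x $ i) \<in> borel_measurable M"
proof -
  have "(\<lambda>v :: real^'k. v $ i) \<in> borel_measurable borel"
    by (intro borel_measurable_continuous_onI continuous_intros)
  from measurable_compose[OF assms this] show ?thesis .
qed

lemma measurable_matrix_vector_comp [measurable (raw)]: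
  fixes A :: "'a \<Rightarrow> real^'q^'k" and B :: "real^'q^'k"
  shows "A \<in> borel_measurable M \<Longrightarrow> (\<lambda>x. A x *v b) \<in> borel_measurable M"
    and "f \<in> borel_measurable M \<Longrightarrow> (\<lambda>x. B *v f x) \<in> borel_measurable M"
  using measurable_compose[OF _ borel_measurable_matrix_vector_right] measurable_compose[OF _ borel_measurable_matrix_vector]
  by auto

context redescending_loss
begin

text \<open>Where \<open>w\<close> or \<open>\<kappa>\<close> does not vanish, the form \<open>q\<close> is at most \<open>c1\<^sup>2\<close>, so coercivity bounds \<open>norm y\<close>.
  The factor \<open>norm y ^ 2\<close> next to \<open>\<kappa>\<close> absorbs its singularity at \<open>q = 0\<close>.\<close>

lemma weighted_norm_bounds:
  assumes M: "\<And>q. 0 \<le> q \<Longrightarrow> \<bar>w q\<bar> \<le> M" "\<And>q. 0 \<le> q \<Longrightarrow> \<bar>q * \<kappa> q\<bar> \<le> M"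
    and L: "0 < L" and q: "L * (norm y)\<^sup>2 \<le> q"
  shows kappa_norm2: "\<bar>\<kappa> q\<bar> * (norm y)\<^sup>2 \<le> M / L"
    and w_norm: "\<bar>w q\<bar> * norm y ^ j \<le> M * (c1 / sqrt L) ^ j"
    and kappa_norm: "\<bar>\<kappa> q\<bar> * (norm y)\<^sup>2 * norm y ^ j \<le> (M / L) * (c1 / sqrt L) ^ j"
proof -
  have q0: "0 \<le> q" using L q by (meson mult_nonneg_nonneg order_trans zero_le_power2 less_imp_le)
  have M0: "0 \<le> M" using M(1)[OF q0] by linarith
  have "L * (\<bar>\<kappa> q\<bar> * (norm y)\<^sup>2) \<le> \<bar>\<kappa> q\<bar> * q"
    using mult_left_mono[OF q, of "\<bar>\<kappa> q\<bar>"] by (simp add: mult_ac)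
  also have "\<dots> \<le> M" using M(2)[OF q0] q0 by (simp add: abs_mult mult.commute)
  finally show k2: "\<bar>\<kappa> q\<bar> * (norm y)\<^sup>2 \<le> M / L" using L by (simp add: field_simps)
  have y: "norm y \<le> c1 / sqrt L" if "q < c1\<^sup>2"
  proof -
    have "(sqrt L * norm y)\<^sup>2 \<le> c1\<^sup>2" using q that L by (simp add: power_mult_distrib)
    then have "sqrt L * norm y \<le> c1" using c1_pos by (meson power2_le_imp_le less_imp_le)
    then show ?thesis using L by (simp add: field_simps)
  qed
  have nn: "0 \<le> c1 / sqrt L" using c1_pos L by simp
  show "\<bar>w q\<bar> * norm y ^ j \<le> M * (c1 / sqrt L) ^ j"
  proof (cases "q < c1\<^sup>2")
    case True
    then show ?thesis using M(1)[OF q0] M0 y by (intro mult_mono power_mono) auto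
  next
    case False
    then show ?thesis using M0 nn by (simp add: w_beyond)
  qed
  show "\<bar>\<kappa> q\<bar> * (norm y)\<^sup>2 * norm y ^ j \<le> (M / L) * (c1 / sqrt L) ^ j"
  proof (cases "q < c1\<^sup>2")
    case True
    then show ?thesis using k2 M0 L y by (intro mult_mono power_mono) auto
  next
    case False
    then show ?thesis using M0 nn L by (simp add: kappa_beyond)
  qed
qed

end

locale standardized_model = redescending_loss \<rho> c1 + spherical_law \<mu>
  for \<rho> :: "real \<Rightarrow> real" and c1 :: real and \<mu> :: "(real^'k) measure" +
  fixes \<nu> :: "(real^'q^'k) measure"
  assumes prob_nu: "prob_space \<nu>" and sets_nu [measurable_cong]: "sets \<nu> = sets borel"
    and moment_nu: "integrable \<nu> (\<lambda>X. (norm X)\<^sup>2)"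
begin

sublocale nu: prob_space \<nu> by (rule prob_nu)
sublocale pair: pair_prob_space \<mu> \<nu> ..

abbreviation N :: "((real^'k) \<times> (real^'q^'k)) measure" where "N \<equiv> \<mu> \<Otimes>\<^sub>M \<nu>"

lemma sets_N [measurable_cong]: "sets N = sets borel"
  by (metis borel_prod sets_mu sets_nu sets_pair_measure_cong)

lemma AE_N_nonzero: "AE s in N. fst s \<noteq> 0"
proof -
  have "AE s in \<mu> \<Otimes>\<^sub>M \<nu>. fst s \<noteq> 0"
    using AE_nonzero by (subst pair.AE_pair_iff[symmetric]) (auto intro: AE_I2)
  then show ?thesis .
qed

lemma integral_N:
  fixes F :: "_ \<Rightarrow> real" assumes "integrable N F"
  shows "(\<integral>s. F s \<partial>N) = (\<integral>X. (\<integral>z. F (z, X) \<partial>\<mu>) \<partial>\<nu>)"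
  using pair.integral_snd[of "\<lambda>z X. F (z, X)"] assms by simp

lemma integrable_N_norm: "integrable N (\<lambda>s. C * (1 + (norm (snd s))\<^sup>2))"
proof -
  have "distr N \<nu> snd = \<nu>"
  proof (rule measure_eqI)
    fix A assume "A \<in> sets (distr N \<nu> snd)"
    then have A: "A \<in> sets \<nu>" by simp
    have "emeasure (distr N \<nu> snd) A = emeasure N (space \<mu> \<times> A)"
      using A sets.sets_into_space[OF A]
      by (subst emeasure_distr) (auto simp: space_pair_measure intro!: arg_cong[where f="emeasure N"])
    also have "\<dots> = emeasure \<nu> A"
      using A by (simp add: nu.emeasure_pair_measure_Times emeasure_space_1)
    finally show "emeasure (distr N \<nu> snd) A = emeasure \<nu> A" .
  qed simp
  then have "integrable N (\<lambda>s. (norm (snd s))\<^sup>2)"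
    using moment_nu integrable_distr[of snd N \<nu> "\<lambda>X. (norm X)\<^sup>2"] by simp
  then show ?thesis by simp
qed

lemma integrable_N_bound:
  fixes f :: "_ \<Rightarrow> real"
  assumes "f \<in> borel_measurable borel" "\<And>z X. \<bar>f (z, X)\<bar> \<le> C * (1 + (norm X)\<^sup>2)"
  shows "integrable N f"
proof (rule Bochner_Integration.integrable_bound[OF integrable_N_norm[of "\<bar>C\<bar>"]])
  show "f \<in> borel_measurable N" using assms(1) by (simp cong: measurable_cong_sets)
  show "AE s in N. norm (f s) \<le> norm (\<bar>C\<bar> * (1 + (norm (snd s))\<^sup>2))"
  proof (rule AE_I2)
    fix s :: "(real^'k) \<times> (real^'q^'k)"
    have "\<bar>f s\<bar> \<le> C * (1 + (norm (snd s))\<^sup>2)" using assms(2)[of "fst s" "snd s"] by simp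
    also have "\<dots> \<le> \<bar>C\<bar> * (1 + (norm (snd s))\<^sup>2)" by (intro mult_right_mono) auto
    finally show "norm (f s) \<le> norm (\<bar>C\<bar> * (1 + (norm (snd s))\<^sup>2))" by simp
  qed
qed

definition resid :: "real^'q \<Rightarrow> (real^'k) \<times> (real^'q^'k) \<Rightarrow> real^'k" where
  "resid d s = fst s - snd s *v d"

lemma measurable_resid [measurable]: "resid d \<in> borel_measurable borel"
  unfolding resid_def[abs_def]
  by (intro borel_measurable_continuous_onI continuous_intros mv.continuous_on)

lemma measurable_snd_mult [measurable]:
  "(\<lambda>s :: (real^'k) \<times> (real^'q^'k). snd s *v d) \<in> borel_measurable borel"
  by (intro borel_measurable_continuous_onI continuous_intros mv.continuous_on)

lemma measurable_fst_borel [measurable]: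
  "(\<lambda>s :: (real^'k) \<times> (real^'q^'k). fst s) \<in> borel_measurable borel"
  by (intro borel_measurable_continuous_onI continuous_intros)

lemma norm_le_one_plus_square: "norm (X :: real^'q^'k) \<le> 1 + (norm X)\<^sup>2"
proof -
  have "0 \<le> (norm X - 1/2)\<^sup>2" by simp
  then show ?thesis by (simp add: power2_eq_square algebra_simps)
qed

text \<open>The weight vanishes unless the residual lies in a fixed ball, so only the factor \<open>X\<close> of the score
  is unbounded.\<close>

lemma integrable_regression_score:
  assumes L: "0 < L" and low: "\<And>x. L * (norm x)\<^sup>2 \<le> x \<bullet> (A *v x)"
  shows "integrable N (\<lambda>s. w (resid d s \<bullet> (A *v resid d s)) * ((snd s *v a) \<bullet> (A *v resid d s)))"
proof -
  obtain M where M: "\<And>q. 0 \<le> q \<Longrightarrow> \<bar>w q\<bar> \<le> M" "\<And>q. 0 \<le> q \<Longrightarrow> \<bar>q * \<kappa> q\<bar> \<le> M"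
    using bounded_weights by metis
  have M0: "0 \<le> M" using M(1)[of 0] by simp
  have bound: "\<bar>w (resid d (z, X) \<bullet> (A *v resid d (z, X))) * ((snd (z, X) *v a) \<bullet> (A *v resid d (z, X)))\<bar>
    \<le> (M * (c1 / sqrt L) ^ 1 * (norm A * norm a)) * (1 + (norm X)\<^sup>2)" for z X
  proof -
    let ?y = "resid d (z, X)"
    have "\<bar>w (?y \<bullet> (A *v ?y)) * ((X *v a) \<bullet> (A *v ?y))\<bar> \<le> \<bar>w (?y \<bullet> (A *v ?y))\<bar> * (norm X * norm a * (norm A * norm ?y))"
      unfolding abs_mult
      by (intro mult_left_mono order_trans[OF Cauchy_Schwarz_ineq2] mult_mono norm_matrix_vector_le) auto
    also have "\<dots> = (\<bar>w (?y \<bullet> (A *v ?y))\<bar> * norm ?y ^ 1) * (norm A * norm a * norm X)" by simp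
    also have "\<dots> \<le> (M * (c1 / sqrt L) ^ 1) * (norm A * norm a * norm X)"
      by (intro mult_right_mono w_norm[OF M L low]) auto
    also have "\<dots> \<le> (M * (c1 / sqrt L) ^ 1) * (norm A * norm a * (1 + (norm X)\<^sup>2))"
      by (intro mult_left_mono norm_le_one_plus_square) (use M0 c1_pos L in auto)
    finally show ?thesis by (simp add: mult_ac)
  qed
  show ?thesis by (rule integrable_N_bound[OF _ bound]) measurable
qed

lemma integrable_weighted_scatter:
  assumes L: "0 < L" and low: "\<And>x. L * (norm x)\<^sup>2 \<le> x \<bullet> (A *v x)"
  shows "integrable N (\<lambda>s. w (resid d s \<bullet> (A *v resid d s)) * (resid d s $ i * resid d s $ j))"
proof -
  obtain M where M: "\<And>q. 0 \<le> q \<Longrightarrow> \<bar>w q\<bar> \<le> M" "\<And>q. 0 \<le> q \<Longrightarrow> \<bar>q * \<kappa> q\<bar> \<le> M"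
    using bounded_weights by metis
  have M0: "0 \<le> M" using M(1)[of 0] by simp
  have bound: "\<bar>w (resid d (z, X) \<bullet> (A *v resid d (z, X))) * (resid d (z, X) $ i * resid d (z, X) $ j)\<bar>
    \<le> M * (c1 / sqrt L)\<^sup>2 * (1 + (norm X)\<^sup>2)" for z X
  proof -
    let ?y = "resid d (z, X)"
    have "\<bar>?y $ i * ?y $ j\<bar> \<le> (norm ?y)\<^sup>2"
      unfolding abs_mult power2_eq_square by (intro mult_mono component_le_norm_cart) auto
    then have "\<bar>w (?y \<bullet> (A *v ?y)) * (?y $ i * ?y $ j)\<bar> \<le> \<bar>w (?y \<bullet> (A *v ?y))\<bar> * (norm ?y)\<^sup>2"
      unfolding abs_mult[of "w _"] by (intro mult_left_mono) auto
    also have "\<dots> \<le> M * (c1 / sqrt L)\<^sup>2" by (rule w_norm[OF M L low])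
    also have "\<dots> \<le> M * (c1 / sqrt L)\<^sup>2 * (1 + (norm X)\<^sup>2)"
      using M0 mult_left_mono[of 1 "1 + (norm X)\<^sup>2" "M * (c1 / sqrt L)\<^sup>2"] by simp
    finally show ?thesis .
  qed
  show ?thesis by (rule integrable_N_bound[OF _ bound]) measurable
qed

text \<open>The sensitivity of the regression equation; it is the constant \<open>\<alpha>\<^sub>1\<close> rewritten in \<open>w\<close> and \<open>\<kappa>\<close>.
  The factor \<open>1 / CARD('k)\<close> comes from averaging \<open>z z\<^sup>T\<close> over rotations.\<close>

definition \<alpha> :: "real \<Rightarrow> real" where
  "\<alpha> g = (\<integral>z. w (g * (norm z)\<^sup>2) \<partial>\<mu>) + 2 * g / CARD('k) * (\<integral>z. \<kappa> (g * (norm z)\<^sup>2) * (norm z)\<^sup>2 \<partial>\<mu>)"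

lemma integrable_radial:
  assumes "0 < g"
  shows integrable_w_radial: "integrable \<mu> (\<lambda>z. w (g * (norm z)\<^sup>2) * norm z ^ j)"
    and integrable_kappa_radial: "integrable \<mu> (\<lambda>z. \<kappa> (g * (norm z)\<^sup>2) * (norm z)\<^sup>2 * norm z ^ j)"
proof -
  obtain M where M: "\<And>q. 0 \<le> q \<Longrightarrow> \<bar>w q\<bar> \<le> M" "\<And>q. 0 \<le> q \<Longrightarrow> \<bar>q * \<kappa> q\<bar> \<le> M"
    using bounded_weights by metis
  show "integrable \<mu> (\<lambda>z. w (g * (norm z)\<^sup>2) * norm z ^ j)"
    by (rule integrable_const_bound[where B="M * (c1 / sqrt g) ^ j"])
      (use w_norm[OF M assms order_refl] in \<open>auto simp: abs_mult power_abs\<close>)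
  show "integrable \<mu> (\<lambda>z. \<kappa> (g * (norm z)\<^sup>2) * (norm z)\<^sup>2 * norm z ^ j)"
    by (rule integrable_const_bound[where B="(M / g) * (c1 / sqrt g) ^ j"])
      (use kappa_norm[OF M assms order_refl] in \<open>auto simp: abs_mult power_abs\<close>)
qed

text \<open>The integrand at \<open>\<delta> n\<close> differs from the one at \<open>0\<close> by its derivative at an intermediate
  parameter; divided by \<open>e n\<close>, this derivative converges almost surely and is dominated by a multiple
  of \<open>norm X ^ 2\<close>.  The integral at \<open>0\<close> vanishes because the integrand is odd in \<open>z\<close>.\<close>

lemma regression_score_limit:
  fixes \<delta> :: "nat \<Rightarrow> real^'q" and A :: "nat \<Rightarrow> real^'k^'k" and e :: "nat \<Rightarrow> real"
  assumes g: "0 < g" and L: "0 < L" and e: "\<And>n. 0 < e n"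
    and sym: "\<And>n. transpose (A n) = A n"
    and low: "\<And>n x. L * (norm x)\<^sup>2 \<le> x \<bullet> (A n *v x)"
    and A: "A \<longlonglongrightarrow> g *\<^sub>R mat 1"
    and \<delta>_le: "\<And>n. norm (\<delta> n) \<le> e n" and \<delta>_0: "\<delta> \<longlonglongrightarrow> 0" and \<delta>: "(\<lambda>n. \<delta> n /\<^sub>R e n) \<longlonglongrightarrow> b"
  shows "(\<lambda>n. (\<integral>s. w (resid (\<delta> n) s \<bullet> (A n *v resid (\<delta> n) s)) * ((snd s *v a) \<bullet> (A n *v resid (\<delta> n) s)) \<partial>N) / e n)
    \<longlonglongrightarrow> - (g * \<alpha> g * (\<integral>X. (X *v a) \<bullet> (X *v b) \<partial>\<nu>))"
proof -
  obtain M where M0: "0 < M" and M: "\<And>q. 0 \<le> q \<Longrightarrow> \<bar>w q\<bar> \<le> M" "\<And>q. 0 \<le> q \<Longrightarrow> \<bar>q * \<kappa> q\<bar> \<le> M"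
    using bounded_weights by metis
  obtain K where K: "0 < K" "\<And>n. norm (A n) \<le> K"
    using convergent_imp_Bseq[OF convergentI[OF A]] by (auto simp: Bseq_def)
  have AK: "norm (A n *v y) \<le> K * norm y" for n y
    using norm_matrix_vector_le[of "A n" y] mult_right_mono[OF K(2)[of n], of "norm y"] by simp
  define f where "f n d s = w (resid d s \<bullet> (A n *v resid d s)) * ((snd s *v a) \<bullet> (A n *v resid d s))" for n d s
  have meas [measurable]: "f n d \<in> borel_measurable borel" for n d
    unfolding f_def[abs_def] by measurable
  have int: "integrable N (f n d)" for n d
    unfolding f_def[abs_def] by (rule integrable_regression_score[OF L low])
  have odd: "(\<integral>s. f n 0 s \<partial>N) = 0" for n
  proof -
    have "(\<integral>z. f n 0 (z, X) \<partial>\<mu>) = 0" for X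
    proof (rule integral_odd)
      have "(\<lambda>z. (z, X)) \<in> borel \<rightarrow>\<^sub>M (borel :: ((real^'k) \<times> (real^'q^'k)) measure)"
        by (intro borel_measurable_continuous_onI continuous_intros)
      then show "(\<lambda>z. f n 0 (z, X)) \<in> borel_measurable borel" by measurable
    qed (simp add: f_def resid_def mv.minus_right)
    then show ?thesis by (simp add: integral_N[OF int])
  qed
  define y where "y n s t = fst s - t *\<^sub>R (snd s *v \<delta> n)" for n and s :: "(real^'k) \<times> (real^'q^'k)" and t
  define q where "q n s t = y n s t \<bullet> (A n *v y n s t)" for n s t
  \<comment> \<open>The derivative of the integrand along the segment from the unperturbed to the perturbed parameters.\<close>
  define D where "D n s t = w (q n s t) * - ((snd s *v a) \<bullet> (A n *v (snd s *v \<delta> n)))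
      + \<kappa> (q n s t) * (- 2 * ((snd s *v \<delta> n) \<bullet> (A n *v y n s t))) * ((snd s *v a) \<bullet> (A n *v y n s t))" for n s t
  have qL: "L * (norm (y n s t))\<^sup>2 \<le> q n s t" for n s t unfolding q_def by (rule low)
  have "\<exists>t. 0 \<le> t \<and> t \<le> 1 \<and> f n (\<delta> n) s - f n 0 s = D n s t" for n s
  proof -
    have dq: "(q n s has_real_derivative (- 2 * ((snd s *v \<delta> n) \<bullet> (A n *v y n s t)))) (at t)" for t
      using quadratic_path_derivative[OF sym[of n], of 0 "fst s" "snd s *v \<delta> n" t]
      by (simp add: q_def[abs_def] y_def bounded_linear.linear[OF bounded_linear_transpose] linear_0)
    have dp: "((\<lambda>t. (snd s *v a) \<bullet> (A n *v y n s t)) has_real_derivative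
        (- ((snd s *v a) \<bullet> (A n *v (snd s *v \<delta> n))))) (at t)" for t
      unfolding y_def mv.diff_right mv.scaleR_right inner_diff_right inner_scaleR_right
      by (auto intro!: derivative_eq_intros)
    have q0: "0 \<le> q n s t" for t
      using qL[of n s t] L by (meson mult_nonneg_nonneg order_trans zero_le_power2 less_imp_le)
    have zero: "(snd s *v a) \<bullet> (A n *v y n s t) = 0" if "q n s t = 0" for t
    proof -
      have "y n s t = 0" using qL[of n s t] L that by (simp add: mult_le_0_iff)
      then show ?thesis by simp
    qed
    obtain t where "0 \<le> t" "t \<le> 1"
      "w (q n s 1) * ((snd s *v a) \<bullet> (A n *v y n s 1)) - w (q n s 0) * ((snd s *v a) \<bullet> (A n *v y n s 0)) = D n s t"
      unfolding D_def by (rule weighted_mvt[OF dq dp q0 zero]) auto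
    then show ?thesis
      by (intro exI[of _ t]) (simp add: f_def q_def y_def resid_def)
  qed
  then obtain \<tau> where \<tau>: "\<And>n s. 0 \<le> \<tau> n s" "\<And>n s. \<tau> n s \<le> 1" "\<And>n s. f n (\<delta> n) s - f n 0 s = D n s (\<tau> n s)"
    by metis
  define D0 where "D0 s = w (g * (norm (fst s))\<^sup>2) * - (g * ((snd s *v a) \<bullet> (snd s *v b)))
      + \<kappa> (g * (norm (fst s))\<^sup>2) * (- 2 * (g * ((snd s *v b) \<bullet> fst s))) * (g * ((snd s *v a) \<bullet> fst s))" for s :: "(real^'k) \<times> (real^'q^'k)"
  define C where "C = norm a * (M * K + 2 * K\<^sup>2 * (M / L))"
  have C0: "0 \<le> C" using M0 K L by (simp add: C_def)
  have bound: "\<bar>D n s t\<bar> \<le> C * (norm (snd s))\<^sup>2 * e n" for n s t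
  proof -
    let ?X = "snd s" and ?y = "y n s t"
    have x: "norm (?X *v \<delta> n) \<le> norm ?X * e n"
      by (rule order_trans[OF norm_matrix_vector_le mult_left_mono[OF \<delta>_le]]) simp
    have q0: "0 \<le> q n s t" using qL[of n s t] L by (meson mult_nonneg_nonneg order_trans zero_le_power2 less_imp_le)
    have "\<bar>w (q n s t) * - ((?X *v a) \<bullet> (A n *v (?X *v \<delta> n)))\<bar> \<le> M * ((norm ?X * norm a) * (K * (norm ?X * e n)))"
      unfolding abs_mult abs_minus_cancel using K e[of n] M0
      by (intro mult_mono M(1) q0 order_trans[OF Cauchy_Schwarz_ineq2] norm_matrix_vector_le
          order_trans[OF AK mult_left_mono[OF x]]) (auto simp: less_imp_le)
    moreover have "\<bar>\<kappa> (q n s t) * (- 2 * ((?X *v \<delta> n) \<bullet> (A n *v ?y))) * ((?X *v a) \<bullet> (A n *v ?y))\<bar>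
      \<le> \<bar>\<kappa> (q n s t)\<bar> * (2 * ((norm ?X * e n) * (K * norm ?y))) * ((norm ?X * norm a) * (K * norm ?y))"
      unfolding abs_mult using K e[of n]
      by (intro mult_mono order_trans[OF Cauchy_Schwarz_ineq2] norm_matrix_vector_le AK x) (auto simp: less_imp_le)
    moreover have "\<dots> = (\<bar>\<kappa> (q n s t)\<bar> * (norm ?y)\<^sup>2) * (2 * K\<^sup>2 * norm a * (norm ?X)\<^sup>2 * e n)"
      by (simp add: power2_eq_square mult_ac)
    moreover have "\<dots> \<le> (M / L) * (2 * K\<^sup>2 * norm a * (norm ?X)\<^sup>2 * e n)"
      using K e[of n] by (intro mult_right_mono kappa_norm2[OF M L qL]) (auto simp: less_imp_le)
    moreover have "M * ((norm ?X * norm a) * (K * (norm ?X * e n))) + (M / L) * (2 * K\<^sup>2 * norm a * (norm ?X)\<^sup>2 * e n)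
        = C * (norm ?X)\<^sup>2 * e n"
      by (simp add: C_def power2_eq_square algebra_simps)
    ultimately show ?thesis unfolding D_def by linarith
  qed
  have lim: "(\<lambda>n. D n s (\<tau> n s) / e n) \<longlonglongrightarrow> D0 s" if "fst s \<noteq> 0" for s
  proof -
    let ?X = "snd s"
    have "(\<lambda>n. ?X *v \<delta> n) \<longlonglongrightarrow> ?X *v 0" by (intro mv.tendsto tendsto_intros \<delta>_0)
    then have "(\<lambda>n. norm (?X *v \<delta> n)) \<longlonglongrightarrow> 0" using tendsto_norm by fastforce
    then have "(\<lambda>n. \<tau> n s *\<^sub>R (?X *v \<delta> n)) \<longlonglongrightarrow> 0"
      by (rule Lim_null_comparison[rotated])
        (simp add: \<tau>(1,2) mult_left_le_one_le)
    then have "(\<lambda>n. y n s (\<tau> n s)) \<longlonglongrightarrow> fst s - 0" unfolding y_def by (intro tendsto_intros)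
    then have y: "(\<lambda>n. y n s (\<tau> n s)) \<longlonglongrightarrow> fst s" by simp
    have Ay: "(\<lambda>n. A n *v y n s (\<tau> n s)) \<longlonglongrightarrow> g *\<^sub>R fst s"
      using mv.tendsto[OF A y] by (simp add: mv.scaleR_left)
    have "(\<lambda>n. q n s (\<tau> n s)) \<longlonglongrightarrow> fst s \<bullet> (g *\<^sub>R fst s)"
      unfolding q_def by (intro tendsto_intros y Ay)
    then have qlim: "(\<lambda>n. q n s (\<tau> n s)) \<longlonglongrightarrow> g * (norm (fst s))\<^sup>2" by (simp add: power2_norm_eq_inner)
    have w: "(\<lambda>n. w (q n s (\<tau> n s))) \<longlonglongrightarrow> w (g * (norm (fst s))\<^sup>2)"
      using continuous_w by (intro isCont_tendsto_compose[OF _ qlim]) (simp add: continuous_on_eq_continuous_at)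
    have k: "(\<lambda>n. \<kappa> (q n s (\<tau> n s))) \<longlonglongrightarrow> \<kappa> (g * (norm (fst s))\<^sup>2)"
      using g that by (intro isCont_tendsto_compose[OF _ qlim] continuous_kappa) simp
    have Xd: "(\<lambda>n. ?X *v (\<delta> n /\<^sub>R e n)) \<longlonglongrightarrow> ?X *v b" by (intro mv.tendsto tendsto_intros \<delta>)
    have AXd: "(\<lambda>n. A n *v (?X *v (\<delta> n /\<^sub>R e n))) \<longlonglongrightarrow> g *\<^sub>R (?X *v b)"
      using mv.tendsto[OF A Xd] by (simp add: mv.scaleR_left)
    have "(\<lambda>n. w (q n s (\<tau> n s)) * - ((?X *v a) \<bullet> (A n *v (?X *v (\<delta> n /\<^sub>R e n))))
      + \<kappa> (q n s (\<tau> n s)) * (- 2 * ((?X *v (\<delta> n /\<^sub>R e n)) \<bullet> (A n *v y n s (\<tau> n s)))) * ((?X *v a) \<bullet> (A n *v y n s (\<tau> n s))))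
      \<longlonglongrightarrow> w (g * (norm (fst s))\<^sup>2) * - ((?X *v a) \<bullet> (g *\<^sub>R (?X *v b)))
      + \<kappa> (g * (norm (fst s))\<^sup>2) * (- 2 * ((?X *v b) \<bullet> (g *\<^sub>R fst s))) * ((?X *v a) \<bullet> (g *\<^sub>R fst s))"
      by (intro tendsto_intros w k AXd Xd Ay)
    then show ?thesis
      by (simp add: D_def D0_def mv.scaleR_right divide_inverse algebra_simps)
  qed
  have measD0: "D0 \<in> borel_measurable borel" unfolding D0_def[abs_def] by measurable
  have fD: "(f n (\<delta> n) s - f n 0 s) / e n = D n s (\<tau> n s) / e n" for n s using \<tau> by simp
  have dom: "norm ((f n (\<delta> n) s - f n 0 s) / e n) \<le> C * (1 + (norm (snd s))\<^sup>2)" for n s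
  proof -
    have "\<bar>D n s (\<tau> n s)\<bar> / e n \<le> C * (norm (snd s))\<^sup>2"
      using bound[of n s] e[of n] by (simp add: divide_le_eq)
    also have "\<dots> \<le> C * (1 + (norm (snd s))\<^sup>2)" using C0 by (intro mult_left_mono) auto
    finally show ?thesis unfolding fD using e[of n] by simp
  qed
  have AElim: "AE s in N. (\<lambda>n. (f n (\<delta> n) s - f n 0 s) / e n) \<longlonglongrightarrow> D0 s"
    using AE_N_nonzero unfolding fD by eventually_elim (rule lim)
  have measN: "D0 \<in> borel_measurable N" "(\<lambda>s. (f n (\<delta> n) s - f n 0 s) / e n) \<in> borel_measurable N" for n
    using measD0 by (simp_all cong: measurable_cong_sets)
  have intD0: "integrable N D0"
    by (rule integrable_dominated_convergence[OF measN integrable_N_norm[of C] AElim AE_I2[OF dom]])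
  have "(\<lambda>n. \<integral>s. (f n (\<delta> n) s - f n 0 s) / e n \<partial>N) \<longlonglongrightarrow> (\<integral>s. D0 s \<partial>N)"
    by (rule integral_dominated_convergence[OF measN integrable_N_norm[of C] AElim AE_I2[OF dom]])
  moreover have "(\<integral>s. (f n (\<delta> n) s - f n 0 s) / e n \<partial>N) = (\<integral>s. f n (\<delta> n) s \<partial>N) / e n" for n
    by (simp add: Bochner_Integration.integral_diff[OF int int] odd)
  moreover have "(\<integral>s. D0 s \<partial>N) = - (g * \<alpha> g * (\<integral>X. (X *v a) \<bullet> (X *v b) \<partial>\<nu>))"
  proof -
    have "(\<integral>z. D0 (z, X) \<partial>\<mu>) = - (g * \<alpha> g * ((X *v a) \<bullet> (X *v b)))" for X
    proof -
      have w: "integrable \<mu> (\<lambda>z. w (g * (norm z)\<^sup>2))" using integrable_w_radial[OF g, of 0] by simp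
      have k: "integrable \<mu> (\<lambda>z. \<kappa> (g * (norm z)\<^sup>2) * (norm z)\<^sup>2)" using integrable_kappa_radial[OF g, of 0] by simp
      have kk: "integrable \<mu> (\<lambda>z. \<kappa> (g * (norm z)\<^sup>2) * (((X *v a) \<bullet> z) * ((X *v b) \<bullet> z)))"
      proof (rule integrable_radial_product[where p=2 and C="norm (X *v a) * norm (X *v b)"])
        fix z :: "real^'k"
        have "\<bar>(X *v a) \<bullet> z\<bar> * \<bar>(X *v b) \<bullet> z\<bar> \<le> (norm (X *v a) * norm z) * (norm (X *v b) * norm z)"
          by (intro mult_mono Cauchy_Schwarz_ineq2) auto
        then show "\<bar>(X *v a) \<bullet> z * ((X *v b) \<bullet> z)\<bar> \<le> norm (X *v a) * norm (X *v b) * (norm z)\<^sup>2"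
          by (simp add: abs_mult power2_eq_square mult_ac)
      qed (use k in \<open>auto\<close>)
      have "(\<integral>z. D0 (z, X) \<partial>\<mu>) = (\<integral>z. - (g * ((X *v a) \<bullet> (X *v b))) * w (g * (norm z)\<^sup>2)
          - 2 * g\<^sup>2 * (\<kappa> (g * (norm z)\<^sup>2) * (((X *v a) \<bullet> z) * ((X *v b) \<bullet> z))) \<partial>\<mu>)"
        by (rule Bochner_Integration.integral_cong[OF refl]) (simp add: D0_def power2_eq_square mult_ac)
      also have "\<dots> = - (g * ((X *v a) \<bullet> (X *v b))) * (\<integral>z. w (g * (norm z)\<^sup>2) \<partial>\<mu>)
          - 2 * g\<^sup>2 * (\<integral>z. \<kappa> (g * (norm z)\<^sup>2) * (((X *v a) \<bullet> z) * ((X *v b) \<bullet> z)) \<partial>\<mu>)"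
        using w kk by (subst Bochner_Integration.integral_diff) auto
      also have "(\<integral>z. \<kappa> (g * (norm z)\<^sup>2) * (((X *v a) \<bullet> z) * ((X *v b) \<bullet> z)) \<partial>\<mu>)
          = (X *v a) \<bullet> (X *v b) * (\<integral>z. \<kappa> (g * (norm z)\<^sup>2) * (norm z)\<^sup>2 \<partial>\<mu>) / CARD('k)"
        by (rule second_moment[where f="\<lambda>r. \<kappa> (g * r\<^sup>2)"]) (use k in auto)
      finally show ?thesis by (simp add: \<alpha>_def power2_eq_square algebra_simps)
    qed
    then show ?thesis by (simp add: integral_N[OF intD0])
  qed
  ultimately have "(\<lambda>n. (\<integral>s. f n (\<delta> n) s \<partial>N) / e n) \<longlonglongrightarrow> - (g * \<alpha> g * (\<integral>X. (X *v a) \<bullet> (X *v b) \<partial>\<nu>))"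
    by (simp only:)
  then show ?thesis by (simp only: f_def)
qed

text \<open>The second-moment matrix of the weighted residuals.  Its part of first order in the regression
  parameter is odd in \<open>z\<close> and disappears; the part of first order in the shape perturbation \<open>E\<close>
  is a fourth moment.\<close>

lemma weighted_scatter_limit:
  fixes \<delta> :: "nat \<Rightarrow> real^'q" and E :: "nat \<Rightarrow> real^'k^'k" and e g :: "nat \<Rightarrow> real"
  assumes g0: "0 < g0" and g: "g \<longlonglongrightarrow> g0" and L: "0 < L" "\<And>n. L \<le> g n" and e: "\<And>n. 0 < e n"
    and sym: "\<And>n. transpose (E n) = E n"
    and low: "\<And>n x. L * (norm x)\<^sup>2 \<le> x \<bullet> ((g n *\<^sub>R mat 1 + E n) *v x)"
    and E_le: "\<And>n. norm (E n) \<le> K1 * e n" and \<delta>_le: "\<And>n. norm (\<delta> n) \<le> K1 * e n" and e_0: "e \<longlonglongrightarrow> 0"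
    and \<delta>: "(\<lambda>n. \<delta> n /\<^sub>R e n) \<longlonglongrightarrow> b" and E: "(\<lambda>n. E n /\<^sub>R e n) \<longlonglongrightarrow> E'"
  shows "(\<lambda>n. ((\<integral>s. w (resid (\<delta> n) s \<bullet> ((g n *\<^sub>R mat 1 + E n) *v resid (\<delta> n) s)) *
        (resid (\<delta> n) s $ i * resid (\<delta> n) s $ j) \<partial>N)
      - mat 1 $ i $ j * (\<integral>z. w (g n * (norm z)\<^sup>2) * (norm z)\<^sup>2 \<partial>\<mu>) / CARD('k)) / e n)
    \<longlonglongrightarrow> (trace E' * mat 1 $ i $ j + E' $ i $ j + E' $ j $ i) *
      ((\<integral>z. \<kappa> (g0 * (norm z)\<^sup>2) * norm z ^ 4 \<partial>\<mu>) / (CARD('k) * (CARD('k) + 2)))"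
proof -
  obtain M where M0: "0 < M" and M: "\<And>q. 0 \<le> q \<Longrightarrow> \<bar>w q\<bar> \<le> M" "\<And>q. 0 \<le> q \<Longrightarrow> \<bar>q * \<kappa> q\<bar> \<le> M"
    using bounded_weights by metis
  define R where "R = c1 / sqrt L"
  have R: "0 < R" using c1_pos L by (simp add: R_def)
  have K1: "0 \<le> K1" using order_trans[OF norm_ge_zero \<delta>_le[of 0]] e[of 0] by (simp add: zero_le_mult_iff)
  define A where "A n t = g n *\<^sub>R mat 1 + t *\<^sub>R E n" for n t
  have E0: "E \<longlonglongrightarrow> 0"
    by (rule Lim_null_comparison[of _ "\<lambda>n. K1 * e n"]) (use E_le tendsto_mult_right_zero[OF e_0] in auto)
  have \<delta>0: "\<delta> \<longlonglongrightarrow> 0"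
    by (rule Lim_null_comparison[of _ "\<lambda>n. K1 * e n"]) (use \<delta>_le tendsto_mult_right_zero[OF e_0] in auto)
  obtain Kg where Kg: "\<And>n. norm (g n *\<^sub>R (mat 1 :: real^'k^'k)) \<le> Kg"
    using convergent_imp_Bseq[OF convergentI[OF tendsto_scaleR[OF g tendsto_const[of "mat 1 :: real^'k^'k"]]]]
    by (auto simp: Bseq_def)
  obtain KE where KE: "0 < KE" "\<And>n. norm (E n) \<le> KE"
    using convergent_imp_Bseq[OF convergentI[OF E0]] by (auto simp: Bseq_def)
  define K where "K = Kg + KE"
  have K: "0 < K" using Kg[of 0] KE(1) norm_ge_zero[of "g 0 *\<^sub>R (mat 1 :: real^'k^'k)"] unfolding K_def by linarith
  have AK: "norm (A n t *v y) \<le> K * norm y" if "0 \<le> t" "t \<le> 1" for n t y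
  proof -
    have "norm (t *\<^sub>R E n) \<le> KE"
      using KE(2)[of n] that by (simp add: order_trans[OF mult_left_le_one_le])
    then have "norm (A n t) \<le> K"
      unfolding A_def K_def by (intro order_trans[OF norm_triangle_ineq] add_mono Kg)
    then show ?thesis using norm_matrix_vector_le[of "A n t" y] mult_right_mono[of "norm (A n t)" K "norm y"] by simp
  qed
  have Alow: "L * (norm y)\<^sup>2 \<le> y \<bullet> (A n t *v y)" if "0 \<le> t" "t \<le> 1" for n t y
  proof -
    have 1: "y \<bullet> (A n t *v y) = (1 - t) * (g n * (norm y)\<^sup>2) + t * (y \<bullet> ((g n *\<^sub>R mat 1 + E n) *v y))"
      by (simp add: A_def mv.add_left mv.scaleR_left inner_add_right power2_norm_eq_inner algebra_simps)
    have "(1 - t) * (L * (norm y)\<^sup>2) + t * (L * (norm y)\<^sup>2) \<le> (1 - t) * (g n * (norm y)\<^sup>2) + t * (y \<bullet> ((g n *\<^sub>R mat 1 + E n) *v y))"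
      using that by (intro add_mono mult_left_mono low mult_right_mono L) auto
    then show ?thesis unfolding 1 by (simp add: algebra_simps)
  qed
  have symA: "transpose (A n t) = A n t" for n t
    by (simp add: A_def transpose_add transpose_scaleR sym)
  define f where "f n t d s = w (resid d s \<bullet> (A n t *v resid d s)) * (resid d s $ i * resid d s $ j)" for n t d s
  have meas [measurable]: "f n t d \<in> borel_measurable borel" for n t d
    unfolding f_def[abs_def] by measurable
  have cij: "\<bar>y $ i * y $ j\<bar> \<le> (norm y)\<^sup>2" for y :: "real^'k"
    unfolding abs_mult power2_eq_square by (intro mult_mono component_le_norm_cart) auto
  have int: "integrable N (f n t d)" if t: "0 \<le> t" "t \<le> 1" for n t d
    unfolding f_def[abs_def] by (rule integrable_weighted_scatter[OF L(1) Alow[OF t]])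
  have base: "(\<integral>s. f n 0 0 s \<partial>N) = mat 1 $ i $ j * (\<integral>z. w (g n * (norm z)\<^sup>2) * (norm z)\<^sup>2 \<partial>\<mu>) / CARD('k)" for n
  proof -
    have gn: "0 < g n" using L by (meson less_le_trans)
    have ax: "axis i 1 \<bullet> (axis j 1 :: real^'k) = mat 1 $ i $ j" by (simp add: inner_axis_axis mat_def)
    have "(\<integral>z. f n 0 0 (z, X) \<partial>\<mu>) = (\<integral>z. w (g n * (norm z)\<^sup>2) * ((axis i 1 \<bullet> z) * (axis j 1 \<bullet> z)) \<partial>\<mu>)" for X
      by (simp add: f_def resid_def A_def mv.scaleR_left power2_norm_eq_inner inner_axis')
    also have "\<dots> = (axis i 1 \<bullet> (axis j 1 :: real^'k)) * (\<integral>z. w (g n * (norm z)\<^sup>2) * (norm z)\<^sup>2 \<partial>\<mu>) / CARD('k)"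
      by (rule second_moment[where f="\<lambda>r. w (g n * r\<^sup>2)"]) (use integrable_w_radial[OF gn, of 2] in auto)
    finally show ?thesis unfolding ax by (simp add: integral_N[OF int] nu.prob_space)
  qed
  define y where "y n s t = fst s - t *\<^sub>R (snd s *v \<delta> n)" for n and s :: "(real^'k) \<times> (real^'q^'k)" and t
  define q where "q n s t = y n s t \<bullet> (A n t *v y n s t)" for n s t
  define q' where "q' n s t = y n s t \<bullet> (E n *v y n s t) - 2 * ((snd s *v \<delta> n) \<bullet> (A n t *v y n s t))" for n s t
  \<comment> \<open>The derivative of the integrand along the segment from the unperturbed to the perturbed parameters.\<close>
  define D where "D n s t = w (q n s t) * - ((snd s *v \<delta> n) $ i * y n s t $ j + y n s t $ i * (snd s *v \<delta> n) $ j)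
      + \<kappa> (q n s t) * q' n s t * (y n s t $ i * y n s t $ j)" for n s t
  have qL: "L * (norm (y n s t))\<^sup>2 \<le> q n s t" if "0 \<le> t" "t \<le> 1" for n s t
    unfolding q_def by (rule Alow[OF that])
  have "\<exists>t. 0 \<le> t \<and> t \<le> 1 \<and> f n 1 (\<delta> n) s - f n 0 0 s = D n s t" for n s
  proof -
    have dq: "(q n s has_real_derivative q' n s t) (at t)" for t
      using quadratic_path_derivative[OF _ sym[of n], of "g n *\<^sub>R mat 1" "fst s" "snd s *v \<delta> n" t]
      by (simp add: q_def[abs_def] q'_def y_def A_def transpose_scaleR)
    have comp: "((\<lambda>t. y n s t $ l) has_real_derivative - (snd s *v \<delta> n) $ l) (at t)" for t l
      unfolding y_def by (auto intro!: derivative_eq_intros)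
    have dp: "((\<lambda>t. y n s t $ i * y n s t $ j) has_real_derivative
        (- ((snd s *v \<delta> n) $ i * y n s t $ j + y n s t $ i * (snd s *v \<delta> n) $ j))) (at t)" for t
      by (rule DERIV_cong[OF DERIV_mult[OF comp comp]]) (simp add: algebra_simps)
    have q0: "0 \<le> q n s t" if "0 \<le> t" "t \<le> 1" for t
      using qL[OF that, of n s] L(1) by (meson mult_nonneg_nonneg order_trans zero_le_power2 less_imp_le)
    have zero: "y n s t $ i * y n s t $ j = 0" if "0 \<le> t" "t \<le> 1" "q n s t = 0" for t
    proof -
      have "y n s t = 0" using qL[OF that(1,2), of n s] L(1) that(3) by (simp add: mult_le_0_iff)
      then show ?thesis by simp
    qed
    obtain t where "0 \<le> t" "t \<le> 1"
      "w (q n s 1) * (y n s 1 $ i * y n s 1 $ j) - w (q n s 0) * (y n s 0 $ i * y n s 0 $ j) = D n s t"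
      unfolding D_def by (rule weighted_mvt[OF dq dp q0 zero]) auto
    then show ?thesis
      by (intro exI[of _ t]) (simp add: f_def q_def y_def resid_def)
  qed
  then obtain \<tau> where \<tau>: "\<And>n s. 0 \<le> \<tau> n s" "\<And>n s. \<tau> n s \<le> 1" "\<And>n s. f n 1 (\<delta> n) s - f n 0 0 s = D n s (\<tau> n s)"
    by metis
  \<comment> \<open>The limit of \<open>D n s t / e n\<close> splits by parity in \<open>z\<close>; only the even part has a nonzero integral.\<close>
  define odd_part where "odd_part s = w (g0 * (norm (fst s))\<^sup>2) * - ((snd s *v b) $ i * fst s $ j + fst s $ i * (snd s *v b) $ j)
      + \<kappa> (g0 * (norm (fst s))\<^sup>2) * (- 2 * (g0 * ((snd s *v b) \<bullet> fst s))) * (fst s $ i * fst s $ j)" for s :: "(real^'k) \<times> (real^'q^'k)"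
  define even_part where "even_part z = \<kappa> (g0 * (norm z)\<^sup>2) * ((z \<bullet> (E' *v z)) * (z $ i * z $ j))" for z :: "real^'k"
  define D0 where "D0 s = odd_part s + even_part (fst s)" for s
  define C where "C = 2 * (K1 * (M * R)) + (M / L) * (K1 * R\<^sup>2) + (M / L) * (2 * K1 * K * R)"
  have C0: "0 \<le> C" using M0 K L K1 R by (simp add: C_def)
  have bound: "\<bar>D n s t\<bar> \<le> 2 * C * (1 + (norm (snd s))\<^sup>2) * e n" if t: "0 \<le> t" "t \<le> 1" for n s t
  proof -
    let ?X = "snd s" and ?y = "y n s t" and ?x = "norm (snd s) * (K1 * e n)"
    have x: "norm (?X *v \<delta> n) \<le> ?x"
      by (rule order_trans[OF norm_matrix_vector_le mult_left_mono[OF \<delta>_le]]) simp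
    have x0: "0 \<le> ?x" using x norm_ge_zero order_trans by blast
    have xc: "\<bar>(?X *v \<delta> n) $ l\<bar> \<le> ?x" for l using component_le_norm_cart x order_trans by blast
    have yc: "\<bar>?y $ l\<bar> \<le> norm ?y" for l by (rule component_le_norm_cart)
    have "\<bar>(?X *v \<delta> n) $ i * ?y $ j + ?y $ i * (?X *v \<delta> n) $ j\<bar> \<le> ?x * norm ?y + norm ?y * ?x"
      unfolding abs_mult using x0
      by (intro order_trans[OF abs_triangle_ineq] add_mono) (auto simp: abs_mult intro!: mult_mono xc yc)
    then have "\<bar>w (q n s t) * - ((?X *v \<delta> n) $ i * ?y $ j + ?y $ i * (?X *v \<delta> n) $ j)\<bar>
        \<le> \<bar>w (q n s t)\<bar> * (?x * norm ?y + norm ?y * ?x)"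
      unfolding abs_mult abs_minus_cancel by (rule mult_left_mono) simp
    also have "\<dots> = (\<bar>w (q n s t)\<bar> * norm ?y ^ 1) * (2 * ?x)" by (simp add: algebra_simps)
    also have "\<dots> \<le> (M * R ^ 1) * (2 * ?x)"
      unfolding R_def by (intro mult_right_mono w_norm[OF M L(1) qL[OF t]]) (use x0 in auto)
    finally have 1: "\<bar>w (q n s t) * - ((?X *v \<delta> n) $ i * ?y $ j + ?y $ i * (?X *v \<delta> n) $ j)\<bar> \<le> M * R * (2 * ?x)" by simp
    have q': "\<bar>q' n s t\<bar> \<le> norm ?y * (K1 * e n * norm ?y) + 2 * (?x * (K * norm ?y))"
    proof -
      have "\<bar>?y \<bullet> (E n *v ?y)\<bar> \<le> norm ?y * (K1 * e n * norm ?y)"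
        by (intro order_trans[OF Cauchy_Schwarz_ineq2] mult_left_mono
            order_trans[OF norm_matrix_vector_le] mult_right_mono E_le) auto
      moreover have "\<bar>(?X *v \<delta> n) \<bullet> (A n t *v ?y)\<bar> \<le> ?x * (K * norm ?y)"
        using x0 by (intro order_trans[OF Cauchy_Schwarz_ineq2] mult_mono x AK t) auto
      ultimately show ?thesis unfolding q'_def by linarith
    qed
    have "\<bar>\<kappa> (q n s t) * q' n s t * (?y $ i * ?y $ j)\<bar>
      \<le> \<bar>\<kappa> (q n s t)\<bar> * (norm ?y * (K1 * e n * norm ?y) + 2 * (?x * (K * norm ?y))) * (norm ?y)\<^sup>2"
      unfolding abs_mult[of "_ * _" "_ * _"] abs_mult[of "\<kappa> _"]
      by (intro mult_mono cij mult_left_mono q') (use K1 e[of n] K x0 in \<open>auto simp: less_imp_le\<close>)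
    also have "\<dots> = (\<bar>\<kappa> (q n s t)\<bar> * (norm ?y)\<^sup>2 * norm ?y ^ 2) * (K1 * e n)
        + (\<bar>\<kappa> (q n s t)\<bar> * (norm ?y)\<^sup>2 * norm ?y ^ 1) * (2 * K * ?x)"
      by (simp add: power2_eq_square algebra_simps)
    also have "\<dots> \<le> ((M / L) * R ^ 2) * (K1 * e n) + ((M / L) * R ^ 1) * (2 * K * ?x)"
      unfolding R_def
      by (intro add_mono mult_right_mono kappa_norm[OF M L(1) qL[OF t]]) (use K1 e[of n] K x0 in \<open>auto simp: less_imp_le\<close>)
    finally have 2: "\<bar>\<kappa> (q n s t) * q' n s t * (?y $ i * ?y $ j)\<bar>
      \<le> (M / L) * R ^ 2 * (K1 * e n) + (M / L) * R * (2 * K * ?x)" by simp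
    have "\<bar>D n s t\<bar> \<le> M * R * (2 * ?x) + ((M / L) * R ^ 2 * (K1 * e n) + (M / L) * R * (2 * K * ?x))"
      unfolding D_def by (rule order_trans[OF abs_triangle_ineq add_mono[OF 1 2]])
    also have "\<dots> = (2 * (K1 * (M * R))) * (norm ?X * e n) + ((M / L) * (K1 * R\<^sup>2)) * e n + ((M / L) * (2 * K1 * K * R)) * (norm ?X * e n)"
      by (simp add: algebra_simps)
    also have "\<dots> \<le> C * (norm ?X * e n) + C * e n + C * (norm ?X * e n)"
      using M0 K L(1) K1 R e[of n] by (intro add_mono mult_right_mono) (auto simp: C_def less_imp_le)
    also have "\<dots> = C * (1 + 2 * norm ?X) * e n" by (simp add: algebra_simps)
    also have "\<dots> \<le> C * (2 * (1 + (norm ?X)\<^sup>2)) * e n"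
    proof -
      have "0 \<le> (norm ?X - 1)\<^sup>2" by simp
      then have le: "2 * norm ?X \<le> 1 + (norm ?X)\<^sup>2" by (simp add: power2_eq_square algebra_simps)
      have "1 + 2 * a \<le> 2 * (1 + b)" if "2 * a \<le> 1 + b" "0 \<le> b" for a b :: real
        using that by (simp add: distrib_left)
      from this[OF le zero_le_power2] have "1 + 2 * norm ?X \<le> 2 * (1 + (norm ?X)\<^sup>2)" .
      then show ?thesis using C0 e[of n] by (intro mult_right_mono mult_left_mono) (auto simp: less_imp_le)
    qed
    finally show ?thesis by (simp add: mult_ac)
  qed
  have lim: "(\<lambda>n. D n s (\<tau> n s) / e n) \<longlonglongrightarrow> D0 s" if "fst s \<noteq> 0" for s
  proof -
    let ?X = "snd s"
    have "(\<lambda>n. ?X *v \<delta> n) \<longlonglongrightarrow> ?X *v 0" by (intro mv.tendsto tendsto_intros \<delta>0)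
    then have "(\<lambda>n. norm (?X *v \<delta> n)) \<longlonglongrightarrow> 0" using tendsto_norm by fastforce
    then have "(\<lambda>n. \<tau> n s *\<^sub>R (?X *v \<delta> n)) \<longlonglongrightarrow> 0"
      by (rule Lim_null_comparison[rotated])
        (simp add: \<tau>(1,2) mult_left_le_one_le)
    then have "(\<lambda>n. y n s (\<tau> n s)) \<longlonglongrightarrow> fst s - 0" unfolding y_def by (intro tendsto_intros)
    then have y: "(\<lambda>n. y n s (\<tau> n s)) \<longlonglongrightarrow> fst s" by simp
    have yc: "(\<lambda>n. y n s (\<tau> n s) $ l) \<longlonglongrightarrow> fst s $ l" for l by (rule tendsto_vec_nth[OF y])
    have "(\<lambda>n. \<tau> n s *\<^sub>R E n) \<longlonglongrightarrow> 0"
      using tendsto_norm_zero[OF E0] by (rule Lim_null_comparison[rotated])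
        (simp add: \<tau>(1,2) mult_left_le_one_le)
    then have "(\<lambda>n. A n (\<tau> n s)) \<longlonglongrightarrow> g0 *\<^sub>R mat 1 + 0" unfolding A_def by (intro tendsto_intros g)
    then have A: "(\<lambda>n. A n (\<tau> n s)) \<longlonglongrightarrow> g0 *\<^sub>R mat 1" by simp
    have Ay: "(\<lambda>n. A n (\<tau> n s) *v y n s (\<tau> n s)) \<longlonglongrightarrow> g0 *\<^sub>R fst s"
      using mv.tendsto[OF A y] by (simp add: mv.scaleR_left)
    have "(\<lambda>n. q n s (\<tau> n s)) \<longlonglongrightarrow> fst s \<bullet> (g0 *\<^sub>R fst s)"
      unfolding q_def by (intro tendsto_intros y Ay)
    then have qlim: "(\<lambda>n. q n s (\<tau> n s)) \<longlonglongrightarrow> g0 * (norm (fst s))\<^sup>2" by (simp add: power2_norm_eq_inner)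
    have w: "(\<lambda>n. w (q n s (\<tau> n s))) \<longlonglongrightarrow> w (g0 * (norm (fst s))\<^sup>2)"
      using continuous_w by (intro isCont_tendsto_compose[OF _ qlim]) (simp add: continuous_on_eq_continuous_at)
    have k: "(\<lambda>n. \<kappa> (q n s (\<tau> n s))) \<longlonglongrightarrow> \<kappa> (g0 * (norm (fst s))\<^sup>2)"
      using g0 that by (intro isCont_tendsto_compose[OF _ qlim] continuous_kappa) simp
    have Xd: "(\<lambda>n. ?X *v (\<delta> n /\<^sub>R e n)) \<longlonglongrightarrow> ?X *v b" by (intro mv.tendsto tendsto_intros \<delta>)
    have Xdc: "(\<lambda>n. (?X *v (\<delta> n /\<^sub>R e n)) $ l) \<longlonglongrightarrow> (?X *v b) $ l" for l by (rule tendsto_vec_nth[OF Xd])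
    have Ey: "(\<lambda>n. (E n /\<^sub>R e n) *v y n s (\<tau> n s)) \<longlonglongrightarrow> E' *v fst s" by (rule mv.tendsto[OF E y])
    have "(\<lambda>n. w (q n s (\<tau> n s)) * - ((?X *v (\<delta> n /\<^sub>R e n)) $ i * y n s (\<tau> n s) $ j + y n s (\<tau> n s) $ i * (?X *v (\<delta> n /\<^sub>R e n)) $ j)
      + \<kappa> (q n s (\<tau> n s)) * (y n s (\<tau> n s) \<bullet> ((E n /\<^sub>R e n) *v y n s (\<tau> n s))
          - 2 * ((?X *v (\<delta> n /\<^sub>R e n)) \<bullet> (A n (\<tau> n s) *v y n s (\<tau> n s)))) * (y n s (\<tau> n s) $ i * y n s (\<tau> n s) $ j))
      \<longlonglongrightarrow> w (g0 * (norm (fst s))\<^sup>2) * - ((?X *v b) $ i * fst s $ j + fst s $ i * (?X *v b) $ j)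
      + \<kappa> (g0 * (norm (fst s))\<^sup>2) * (fst s \<bullet> (E' *v fst s) - 2 * ((?X *v b) \<bullet> (g0 *\<^sub>R fst s))) * (fst s $ i * fst s $ j)"
      by (intro tendsto_intros w k y yc Xd Xdc Ay Ey)
    moreover have "w (g0 * (norm (fst s))\<^sup>2) * - ((?X *v b) $ i * fst s $ j + fst s $ i * (?X *v b) $ j)
      + \<kappa> (g0 * (norm (fst s))\<^sup>2) * (fst s \<bullet> (E' *v fst s) - 2 * ((?X *v b) \<bullet> (g0 *\<^sub>R fst s))) * (fst s $ i * fst s $ j)
      = D0 s"
      by (simp add: D0_def odd_part_def even_part_def algebra_simps)
    moreover have "w (q n s (\<tau> n s)) * - ((?X *v (\<delta> n /\<^sub>R e n)) $ i * y n s (\<tau> n s) $ j + y n s (\<tau> n s) $ i * (?X *v (\<delta> n /\<^sub>R e n)) $ j)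
      + \<kappa> (q n s (\<tau> n s)) * (y n s (\<tau> n s) \<bullet> ((E n /\<^sub>R e n) *v y n s (\<tau> n s))
          - 2 * ((?X *v (\<delta> n /\<^sub>R e n)) \<bullet> (A n (\<tau> n s) *v y n s (\<tau> n s)))) * (y n s (\<tau> n s) $ i * y n s (\<tau> n s) $ j)
      = D n s (\<tau> n s) / e n" for n
      by (simp add: D_def q'_def mv.scaleR_right mv.scaleR_left divide_inverse algebra_simps)
    ultimately show ?thesis by simp
  qed
  have measD0: "D0 \<in> borel_measurable borel"
    unfolding D0_def[abs_def] odd_part_def even_part_def by measurable
  have fD: "(f n 1 (\<delta> n) s - f n 0 0 s) / e n = D n s (\<tau> n s) / e n" for n s using \<tau> by simp
  have dom: "norm ((f n 1 (\<delta> n) s - f n 0 0 s) / e n) \<le> 2 * C * (1 + (norm (snd s))\<^sup>2)" for n s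
    unfolding fD using bound[OF \<tau>(1,2), of n s n s] e[of n] by (simp add: divide_le_eq)
  have AElim: "AE s in N. (\<lambda>n. (f n 1 (\<delta> n) s - f n 0 0 s) / e n) \<longlonglongrightarrow> D0 s"
    using AE_N_nonzero unfolding fD by eventually_elim (rule lim)
  have measN: "D0 \<in> borel_measurable N" "(\<lambda>s. (f n 1 (\<delta> n) s - f n 0 0 s) / e n) \<in> borel_measurable N" for n
    using measD0 by (simp_all cong: measurable_cong_sets)
  have intD0: "integrable N D0"
    by (rule integrable_dominated_convergence[OF measN integrable_N_norm[of "2 * C"] AElim AE_I2[OF dom]])
  have "(\<lambda>n. \<integral>s. (f n 1 (\<delta> n) s - f n 0 0 s) / e n \<partial>N) \<longlonglongrightarrow> (\<integral>s. D0 s \<partial>N)"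
    by (rule integral_dominated_convergence[OF measN integrable_N_norm[of "2 * C"] AElim AE_I2[OF dom]])
  moreover have "(\<integral>s. (f n 1 (\<delta> n) s - f n 0 0 s) / e n \<partial>N) = ((\<integral>s. f n 1 (\<delta> n) s \<partial>N) - (\<integral>s. f n 0 0 s \<partial>N)) / e n" for n
    by (simp add: Bochner_Integration.integral_diff[OF int int])
  moreover have "(\<integral>s. D0 s \<partial>N) = (\<integral>z. even_part z \<partial>\<mu>)"
  proof -
    have "(\<integral>z. D0 (z, X) \<partial>\<mu>) = (\<integral>z. even_part z \<partial>\<mu>)" for X
    proof -
      have k: "integrable \<mu> (\<lambda>z. \<kappa> (g0 * (norm z)\<^sup>2) * norm z ^ 4)"
        using integrable_kappa_radial[OF g0, of 2] by (simp add: power2_eq_square power4_eq_xxxx mult_ac)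
      have k3: "integrable \<mu> (\<lambda>z. \<kappa> (g0 * (norm z)\<^sup>2) * norm z ^ 3)"
        using integrable_kappa_radial[OF g0, of 1] by (simp add: power2_eq_square power3_eq_cube mult_ac)
      have w1: "integrable \<mu> (\<lambda>z. w (g0 * (norm z)\<^sup>2) * norm z ^ 1)"
        using integrable_w_radial[OF g0, of 1] by simp
      have "integrable \<mu> even_part"
        unfolding even_part_def
      proof (rule integrable_radial_product[where p=4 and C="norm E'"])
        fix z :: "real^'k"
        have "\<bar>z \<bullet> (E' *v z)\<bar> * \<bar>z $ i * z $ j\<bar> \<le> (norm z * (norm E' * norm z)) * (norm z)\<^sup>2"
          by (intro mult_mono cij order_trans[OF Cauchy_Schwarz_ineq2] mult_left_mono norm_matrix_vector_le) auto
        then show "\<bar>z \<bullet> (E' *v z) * (z $ i * z $ j)\<bar> \<le> norm E' * norm z ^ 4"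
          by (simp add: abs_mult power2_eq_square power4_eq_xxxx mult_ac)
      qed (use k in \<open>auto\<close>)
      moreover have "integrable \<mu> (\<lambda>z. odd_part (z, X))"
      proof -
        let ?x = "norm (X *v b)"
        have "integrable \<mu> (\<lambda>z. w (g0 * (norm z)\<^sup>2) * - ((X *v b) $ i * z $ j + z $ i * (X *v b) $ j))"
        proof (rule integrable_radial_product[where p=1 and C="2 * ?x"])
          fix z :: "real^'k"
          have "\<bar>(X *v b) $ i * z $ j + z $ i * (X *v b) $ j\<bar> \<le> ?x * norm z + norm z * ?x"
            by (intro order_trans[OF abs_triangle_ineq] add_mono)
              (auto simp: abs_mult intro!: mult_mono component_le_norm_cart)
          then show "\<bar>- ((X *v b) $ i * z $ j + z $ i * (X *v b) $ j)\<bar> \<le> 2 * ?x * norm z ^ 1"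
            unfolding abs_minus_cancel by (simp add: algebra_simps)
        qed (use w1 in auto)
        moreover have "integrable \<mu> (\<lambda>z. \<kappa> (g0 * (norm z)\<^sup>2) * ((- 2 * (g0 * ((X *v b) \<bullet> z))) * (z $ i * z $ j)))"
        proof (rule integrable_radial_product[where p=3 and C="2 * g0 * ?x"])
          fix z :: "real^'k"
          have "\<bar>- 2 * (g0 * ((X *v b) \<bullet> z))\<bar> * \<bar>z $ i * z $ j\<bar> \<le> (2 * (g0 * (?x * norm z))) * (norm z)\<^sup>2"
            using g0 by (intro mult_mono cij) (auto simp: abs_mult Cauchy_Schwarz_ineq2)
          then show "\<bar>(- 2 * (g0 * ((X *v b) \<bullet> z))) * (z $ i * z $ j)\<bar> \<le> 2 * g0 * ?x * norm z ^ 3"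
            unfolding abs_mult[of "- 2 * _"] by (simp add: power2_eq_square power3_eq_cube mult_ac)
        qed (use k3 in auto)
        ultimately show ?thesis
          unfolding odd_part_def fst_conv snd_conv mult.assoc[of "\<kappa> _"] by (rule Bochner_Integration.integrable_add)
      qed
      moreover have "(\<integral>z. odd_part (z, X) \<partial>\<mu>) = 0"
        by (rule integral_odd) (auto simp: odd_part_def algebra_simps)
      ultimately show ?thesis by (simp add: D0_def Bochner_Integration.integral_add)
    qed
    then show ?thesis by (simp add: integral_N[OF intD0] nu.prob_space)
  qed
  moreover have "(\<integral>z. even_part z \<partial>\<mu>) = (trace E' * mat 1 $ i $ j + E' $ i $ j + E' $ j $ i) *
      ((\<integral>z. \<kappa> (g0 * (norm z)\<^sup>2) * norm z ^ 4 \<partial>\<mu>) / (CARD('k) * (CARD('k) + 2)))"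
    unfolding even_part_def
    by (rule matrix_fourth_moment[where f="\<lambda>r. \<kappa> (g0 * r\<^sup>2)"])
      (use integrable_kappa_radial[OF g0, of 2] in \<open>auto simp: power2_eq_square power4_eq_xxxx mult_ac\<close>)
  ultimately have "(\<lambda>n. ((\<integral>s. f n 1 (\<delta> n) s \<partial>N) - (\<integral>s. f n 0 0 s \<partial>N)) / e n) \<longlonglongrightarrow>
      (trace E' * mat 1 $ i $ j + E' $ i $ j + E' $ j $ i) *
      ((\<integral>z. \<kappa> (g0 * (norm z)\<^sup>2) * norm z ^ 4 \<partial>\<mu>) / (CARD('k) * (CARD('k) + 2)))"
    by (simp only:)
  then show ?thesis unfolding base unfolding f_def A_def scaleR_one .
qed

end

section \<open>Rates from limiting directions\<close>

text \<open>If every limit \<open>(b, \<eta>)\<close> of the normalized pairs \<open>(f h, h) / (h + norm (f h))\<close> satisfies the linear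
  relation \<open>b = \<eta> l\<close>, then \<open>f h / h\<close> tends to \<open>l\<close>: by compactness such limits exist along
  subsequences, and \<open>norm b + \<eta> = 1\<close> excludes \<open>\<eta> = 0\<close>.\<close>

lemma rate_at_right:
  fixes f :: "real \<Rightarrow> 'a::euclidean_space"
  assumes ev: "eventually Pr (at_right 0)"
    and main: "\<And>x b \<eta>. (\<And>n. 0 < x n) \<Longrightarrow> (\<And>n. Pr (x n)) \<Longrightarrow> x \<longlonglongrightarrow> 0 \<Longrightarrow>
      (\<lambda>n. f (x n) /\<^sub>R (x n + norm (f (x n)))) \<longlonglongrightarrow> b \<Longrightarrow> (\<lambda>n. x n / (x n + norm (f (x n)))) \<longlonglongrightarrow> \<eta> \<Longrightarrow> b = \<eta> *\<^sub>R l"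
  shows "((\<lambda>h. f h /\<^sub>R h) \<longlongrightarrow> l) (at_right 0)"
proof (rule ccontr)
  assume "\<not> ?thesis"
  then obtain \<epsilon> where \<epsilon>: "0 < \<epsilon>" and "\<not> (\<forall>\<^sub>F h in at_right 0. dist (f h /\<^sub>R h) l < \<epsilon>)"
    by (auto simp: tendsto_iff)
  with ev have "\<not> (\<forall>\<^sub>F h in at_right 0. \<not> (Pr h \<and> \<epsilon> \<le> dist (f h /\<^sub>R h) l))"
  proof (intro notI)
    assume nl: "\<not> (\<forall>\<^sub>F h in at_right 0. dist (f h /\<^sub>R h) l < \<epsilon>)"
      and "\<forall>\<^sub>F h in at_right 0. \<not> (Pr h \<and> \<epsilon> \<le> dist (f h /\<^sub>R h) l)"
    from this(2) ev have "\<forall>\<^sub>F h in at_right 0. dist (f h /\<^sub>R h) l < \<epsilon>"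
      by eventually_elim (auto simp: not_le)
    with nl show False by blast
  qed
  then have "\<exists>h>0. h < d \<and> Pr h \<and> \<epsilon> \<le> dist (f h /\<^sub>R h) l" if "0 < d" for d :: real
    using that unfolding eventually_at_right_field by blast
  then have "\<forall>n. \<exists>h>0. h < inverse (real (Suc n)) \<and> Pr h \<and> \<epsilon> \<le> dist (f h /\<^sub>R h) l" by simp
  then obtain x where x: "\<And>n. 0 < x n" "\<And>n. x n < inverse (real (Suc n))" "\<And>n. Pr (x n)"
    "\<And>n. \<epsilon> \<le> dist (f (x n) /\<^sub>R x n) l" by metis
  have x0: "x \<longlonglongrightarrow> 0"
    by (rule tendsto_sandwich[OF _ _ tendsto_const LIMSEQ_inverse_real_of_nat])
      (use x(1,2) in \<open>auto intro!: always_eventually less_imp_le\<close>)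
  define e where "e n = x n + norm (f (x n))" for n
  have e: "0 < e n" for n using x(1)[of n] by (simp add: e_def add_pos_nonneg)
  define u where "u n = (f (x n) /\<^sub>R e n, x n / e n)" for n
  have one: "norm (f (x n) /\<^sub>R e n) + x n / e n = 1" for n
  proof -
    have "norm (f (x n) /\<^sub>R e n) + x n / e n = (norm (f (x n)) + x n) / e n"
      using e[of n] by (simp add: field_simps)
    then show ?thesis using e[of n] by (simp add: e_def add.commute)
  qed
  have "norm (u n) \<le> 1" for n
  proof -
    have "norm (u n) \<le> norm (f (x n) /\<^sub>R e n) + norm (x n / e n)" unfolding u_def by (rule norm_Pair_le)
    also have "\<dots> = 1" using one[of n] x(1)[of n] e[of n] by simp
    finally show ?thesis .
  qed
  then have "bounded (range u)" by (auto simp: bounded_iff)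
  then obtain p r where r: "strict_mono r" and p: "(u \<circ> r) \<longlonglongrightarrow> p"
    using bounded_imp_convergent_subsequence by blast
  have b: "(\<lambda>n. f (x (r n)) /\<^sub>R e (r n)) \<longlonglongrightarrow> fst p" and \<eta>: "(\<lambda>n. x (r n) / e (r n)) \<longlonglongrightarrow> snd p"
    using tendsto_fst[OF p] tendsto_snd[OF p] by (simp_all add: u_def o_def)
  have rel: "fst p = snd p *\<^sub>R l"
    by (rule main[of "x \<circ> r"]) (use x x0 r b \<eta> in \<open>auto simp: e_def o_def intro: LIMSEQ_subseq_LIMSEQ[unfolded o_def]\<close>)
  have "(\<lambda>n. norm (f (x (r n)) /\<^sub>R e (r n)) + x (r n) / e (r n)) \<longlonglongrightarrow> norm (fst p) + snd p"
    by (intro tendsto_intros b \<eta>)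
  then have "norm (fst p) + snd p = 1" using one LIMSEQ_unique[OF _ tendsto_const] by simp
  then have nz: "snd p \<noteq> 0" using rel by auto
  have "(\<lambda>n. (f (x (r n)) /\<^sub>R e (r n)) /\<^sub>R (x (r n) / e (r n))) \<longlonglongrightarrow> fst p /\<^sub>R snd p"
    by (intro tendsto_intros b \<eta> nz)
  moreover have "(f (x (r n)) /\<^sub>R e (r n)) /\<^sub>R (x (r n) / e (r n)) = f (x (r n)) /\<^sub>R x (r n)" for n
    using e[of "r n"] x(1)[of "r n"] by (simp add: inverse_eq_divide)
  moreover have "fst p /\<^sub>R snd p = l" using rel nz by simp
  ultimately have "(\<lambda>n. f (x (r n)) /\<^sub>R x (r n)) \<longlonglongrightarrow> l" by (simp only:)
  then have "\<forall>\<^sub>F n in sequentially. dist (f (x (r n)) /\<^sub>R x (r n)) l < \<epsilon>" using \<epsilon> by (rule tendstoD)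
  then show False using x(4) by (auto simp: eventually_sequentially not_less[symmetric])
qed

lemma has_vector_derivative_at_0_iff:
  fixes v :: "real \<Rightarrow> 'a::real_normed_vector"
  shows "(v has_vector_derivative v') (at 0) \<longleftrightarrow> ((\<lambda>t. (v t - v 0) /\<^sub>R t) \<longlongrightarrow> v') (at 0)"
proof -
  have eq: "norm (v t - v 0 - t *\<^sub>R v') / norm t = norm ((v t - v 0) /\<^sub>R t - v')" if "t \<noteq> 0" for t
  proof -
    have "(v t - v 0) /\<^sub>R t - v' = (v t - v 0 - t *\<^sub>R v') /\<^sub>R t" using that by (simp add: scaleR_diff_right)
    then show ?thesis by (simp add: divide_inverse mult.commute)
  qed
  have "(v has_vector_derivative v') (at 0) \<longleftrightarrow> ((\<lambda>t. norm (v t - v 0 - t *\<^sub>R v') / norm t) \<longlongrightarrow> 0) (at 0)"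
    unfolding has_vector_derivative_def has_derivative_at by (simp add: bounded_linear_scaleR_left)
  also have "\<dots> \<longleftrightarrow> ((\<lambda>t. norm ((v t - v 0) /\<^sub>R t - v')) \<longlongrightarrow> 0) (at 0)"
    by (rule tendsto_cong) (use eq in \<open>auto simp: eventually_at_filter\<close>)
  also have "\<dots> \<longleftrightarrow> ((\<lambda>t. (v t - v 0) /\<^sub>R t) \<longlongrightarrow> v') (at 0)"
    unfolding tendsto_norm_zero_iff by (rule LIM_zero_iff)
  finally show ?thesis .
qed

lemma matrix_inv_has_vector_derivative:
  fixes v :: "real \<Rightarrow> real^'n^'n"
  assumes v: "(v has_vector_derivative v') (at 0)" and V: "v 0 \<in> PDS"
  shows "((\<lambda>t. matrix_inv (v t)) has_vector_derivative - (matrix_inv (v 0) ** v' ** matrix_inv (v 0))) (at 0)"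
proof -
  have cont: "(v \<longlongrightarrow> v 0) (at 0)"
    using has_vector_derivative_continuous[OF v] by (simp add: continuous_within)
  have "\<forall>\<^sub>F t in at 0. det (v t) \<noteq> 0"
  proof -
    have "isCont det (v 0)"
      using det_has_derivative[OF PDS_invertible[OF V]] has_derivative_continuous by blast
    then have "((\<lambda>t. det (v t)) \<longlongrightarrow> det (v 0)) (at 0)" using cont by (rule isCont_tendsto_compose)
    then show ?thesis using PDS_det_pos[OF V] by (intro tendsto_imp_eventually_ne) auto
  qed
  then have inv: "\<forall>\<^sub>F t in at 0. invertible (v t)" by (simp add: invertible_det_nz)
  have lim: "((\<lambda>t. matrix_inv (v t)) \<longlongrightarrow> matrix_inv (v 0)) (at 0)"
    by (rule tendsto_matrix_inv[OF cont V inv])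
  have "((\<lambda>t. (v t - v 0) /\<^sub>R t) \<longlongrightarrow> v') (at 0)"
    using v by (simp only: has_vector_derivative_at_0_iff)
  then have "((\<lambda>t. - (matrix_inv (v t) ** ((v t - v 0) /\<^sub>R t) ** matrix_inv (v 0))) \<longlongrightarrow>
      - (matrix_inv (v 0) ** v' ** matrix_inv (v 0))) (at 0)"
    by (intro tendsto_intros mm.tendsto lim)
  moreover have "\<forall>\<^sub>F t in at 0. - (matrix_inv (v t) ** ((v t - v 0) /\<^sub>R t) ** matrix_inv (v 0))
      = (matrix_inv (v t) - matrix_inv (v 0)) /\<^sub>R t"
    using inv by eventually_elim
      (simp add: matrix_inv_diff[OF PDS_invertible[OF V]] mm.scaleR_left mm.scaleR_right)
  ultimately have "((\<lambda>t. (matrix_inv (v t) - matrix_inv (v 0)) /\<^sub>R t) \<longlongrightarrow>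
      - (matrix_inv (v 0) ** v' ** matrix_inv (v 0))) (at 0)"
    by (rule Lim_transform_eventually)
  then show ?thesis by (simp only: has_vector_derivative_at_0_iff)
qed

section \<open>Stationarity in the regression and the shape parameter\<close>

context redescending_loss
begin

lemma norm_le_of_small_form:
  assumes "0 < L" "L * (norm y)\<^sup>2 \<le> q" "q \<le> c1\<^sup>2"
  shows "norm y \<le> c1 / sqrt L"
proof -
  have "(sqrt L * norm y)\<^sup>2 \<le> c1\<^sup>2" using assms by (simp add: power_mult_distrib)
  then have "sqrt L * norm y \<le> c1" using c1_pos by (meson power2_le_imp_le less_imp_le)
  then show ?thesis using assms by (simp add: field_simps)
qed

text \<open>The residual moves along the line \<open>r - t Y a\<close>.  On the bounded set of residuals where the loss is not
  constant, the quadratic form changes at a rate that the second moment of \<open>Y\<close> dominates.\<close>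

lemma regression_stationary:
  fixes Z :: "'s \<Rightarrow> real^'k" and Y :: "'s \<Rightarrow> real^'q^'k"
  assumes Q: "finite_measure Q" and [measurable]: "Z \<in> borel_measurable Q" "Y \<in> borel_measurable Q"
    and Y2: "integrable Q (\<lambda>s. (norm (Y s))\<^sup>2)" and T: "T \<in> PDS"
    and min: "\<forall>\<^sub>F t in at 0. (\<integral>s. \<rho> (sqrt ((Z s - Y s *v d) \<bullet> (T *v (Z s - Y s *v d)))) \<partial>Q)
      \<le> (\<integral>s. \<rho> (sqrt ((Z s - Y s *v (d + t *\<^sub>R a)) \<bullet> (T *v (Z s - Y s *v (d + t *\<^sub>R a))))) \<partial>Q)"
  shows "(\<integral>s. w ((Z s - Y s *v d) \<bullet> (T *v (Z s - Y s *v d))) * ((Y s *v a) \<bullet> (T *v (Z s - Y s *v d))) \<partial>Q) = 0"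
proof -
  interpret finite_measure Q by fact
  obtain L where L: "0 < L" "\<And>x. L * (norm x)\<^sup>2 \<le> x \<bullet> (T *v x)" using PDS_coercive[OF T] by blast
  note symT = PDS_sym[OF T]
  define r where "r t s = Z s - Y s *v d - t *\<^sub>R (Y s *v a)" for t s
  define q where "q t s = r t s \<bullet> (T *v r t s)" for t s
  define K where "K = norm T"
  define R where "R = c1 / sqrt L"
  have K: "0 \<le> K" and R: "0 < R" using c1_pos L by (auto simp: K_def R_def)
  have r: "Z s - Y s *v (d + t *\<^sub>R a) = r t s" for s t
    by (simp add: r_def mv.add_right mv.scaleR_right)
  have r0: "Z s - Y s *v d = r 0 s" for s by (simp add: r_def)
  have [measurable]: "r t \<in> borel_measurable Q" for t unfolding r_def by measurable
  have [measurable]: "q t \<in> borel_measurable Q" for t unfolding q_def by measurable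
  have "(\<integral>s. w (q 0 s) * (- 2 * ((Y s *v a) \<bullet> (T *v r 0 s))) \<partial>Q) = 0"
  proof (rule stationary_at_local_min[where q=q and \<epsilon>=1
        and G="\<lambda>s. 2 * (norm a * (1 + (norm (Y s))\<^sup>2) * (K * R)) + K * ((norm a)\<^sup>2 * (norm (Y s))\<^sup>2)"])
    show "finite_measure Q" by fact
    show "(\<lambda>s. - 2 * ((Y s *v a) \<bullet> (T *v r 0 s))) \<in> borel_measurable Q" by measurable
    show "0 \<le> q t s" for t s unfolding q_def by (rule PDS_nonneg[OF T])
    show "((\<lambda>t. q t s) has_real_derivative - 2 * ((Y s *v a) \<bullet> (T *v r 0 s))) (at 0)" for s
      using quadratic_path_derivative[OF symT, of 0 "Z s - Y s *v d" "Y s *v a" 0]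
      by (simp add: q_def r_def bounded_linear.linear[OF bounded_linear_transpose] linear_0)
    show "integrable Q (\<lambda>s. 2 * (norm a * (1 + (norm (Y s))\<^sup>2) * (K * R)) + K * ((norm a)\<^sup>2 * (norm (Y s))\<^sup>2))"
      using Y2 by simp
    show "\<forall>\<^sub>F t in at 0. (\<integral>s. \<rho> (sqrt (q 0 s)) \<partial>Q) \<le> (\<integral>s. \<rho> (sqrt (q t s)) \<partial>Q)"
      using min unfolding r unfolding r0 q_def .
    fix t s assume t: "\<bar>t\<bar> < (1::real)" and "q t s \<le> c1\<^sup>2 \<or> q 0 s \<le> c1\<^sup>2"
    let ?x = "Y s *v a"
    have rt: "r t s = r 0 s - t *\<^sub>R ?x" by (simp add: r_def)
    have sym2: "r 0 s \<bullet> (T *v ?x) = ?x \<bullet> (T *v r 0 s)"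
      using inner_symmetric_matrix[OF symT, of "r 0 s" ?x] by (simp add: inner_commute)
    have e0: "q t s - q 0 s = - (2 * t * (?x \<bullet> (T *v r 0 s))) + t\<^sup>2 * (?x \<bullet> (T *v ?x))"
      unfolding q_def rt by (simp add: mv.diff_right mv.scaleR_right inner_diff_left inner_diff_right
          sym2 power2_eq_square algebra_simps)
    have et: "q t s - q 0 s = - (2 * t * (?x \<bullet> (T *v r t s))) - t\<^sup>2 * (?x \<bullet> (T *v ?x))"
      unfolding e0 rt by (simp add: mv.diff_right mv.scaleR_right inner_diff_right power2_eq_square algebra_simps)
    obtain y where y: "norm y \<le> R" and
      ey: "\<bar>q t s - q 0 s\<bar> \<le> 2 * (\<bar>t\<bar> * \<bar>?x \<bullet> (T *v y)\<bar>) + t\<^sup>2 * \<bar>?x \<bullet> (T *v ?x)\<bar>"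
    proof -
      have "\<bar>q t s - q 0 s\<bar> \<le> 2 * (\<bar>t\<bar> * \<bar>?x \<bullet> (T *v r 0 s)\<bar>) + t\<^sup>2 * \<bar>?x \<bullet> (T *v ?x)\<bar>"
        unfolding e0 by (rule order_trans[OF abs_triangle_ineq]) (simp add: abs_mult)
      moreover have "\<bar>q t s - q 0 s\<bar> \<le> 2 * (\<bar>t\<bar> * \<bar>?x \<bullet> (T *v r t s)\<bar>) + t\<^sup>2 * \<bar>?x \<bullet> (T *v ?x)\<bar>"
        unfolding et by (rule order_trans[OF abs_triangle_ineq4]) (simp add: abs_mult)
      moreover have "norm (r u s) \<le> R" if "q u s \<le> c1\<^sup>2" for u
        unfolding R_def by (rule norm_le_of_small_form[OF L(1) L(2) that[unfolded q_def]])
      ultimately show thesis using that \<open>q t s \<le> c1\<^sup>2 \<or> q 0 s \<le> c1\<^sup>2\<close> by blast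
    qed
    have x: "norm ?x \<le> norm a * norm (Y s)" using norm_matrix_vector_le[of "Y s" a] by (simp add: mult.commute)
    have Y1: "norm (Y s) \<le> 1 + (norm (Y s))\<^sup>2"
    proof -
      have "0 \<le> (norm (Y s) - 1/2)\<^sup>2" by simp
      then show ?thesis by (simp add: power2_eq_square algebra_simps)
    qed
    have Ty: "norm (T *v y) \<le> K * R"
      unfolding K_def by (rule order_trans[OF norm_matrix_vector_le mult_left_mono[OF y]]) simp
    have 1: "\<bar>?x \<bullet> (T *v y)\<bar> \<le> norm a * (1 + (norm (Y s))\<^sup>2) * (K * R)"
      by (rule order_trans[OF Cauchy_Schwarz_ineq2])
        (intro mult_mono order_trans[OF x mult_left_mono[OF Y1]] Ty, use K R in auto)
    have "\<bar>?x \<bullet> (T *v ?x)\<bar> \<le> (norm a * norm (Y s)) * (K * (norm a * norm (Y s)))"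
      unfolding K_def
      by (intro order_trans[OF Cauchy_Schwarz_ineq2] mult_mono x order_trans[OF norm_matrix_vector_le]) auto
    then have 2: "\<bar>?x \<bullet> (T *v ?x)\<bar> \<le> K * ((norm a)\<^sup>2 * (norm (Y s))\<^sup>2)"
      by (simp add: power2_eq_square mult_ac)
    have tt: "t\<^sup>2 \<le> \<bar>t\<bar>" using t mult_left_le[of "\<bar>t\<bar>" "\<bar>t\<bar>"] by (simp add: power2_eq_square)
    have "\<bar>q t s - q 0 s\<bar> \<le> 2 * (\<bar>t\<bar> * (norm a * (1 + (norm (Y s))\<^sup>2) * (K * R))) + \<bar>t\<bar> * (K * ((norm a)\<^sup>2 * (norm (Y s))\<^sup>2))"
      by (rule order_trans[OF ey], intro add_mono mult_left_mono mult_mono 1 2 tt) (use K in auto)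
    then show "\<bar>q t s - q 0 s\<bar> \<le> \<bar>t\<bar> * (2 * (norm a * (1 + (norm (Y s))\<^sup>2) * (K * R)) + K * ((norm a)\<^sup>2 * (norm (Y s))\<^sup>2))"
      by (simp add: algebra_simps)
  qed simp_all
  then have "- 2 * (\<integral>s. w (q 0 s) * ((Y s *v a) \<bullet> (T *v r 0 s)) \<partial>Q) = 0"
    by (subst integral_mult_right_zero[symmetric]) (simp add: mult_ac)
  then show ?thesis unfolding q_def r0 by simp
qed

text \<open>The residual stays fixed and the form varies, so where the loss is not constant the rate of change
  is bounded by a constant.\<close>

lemma shape_stationary:
  fixes r :: "'s \<Rightarrow> real^'k" and T :: "real \<Rightarrow> real^'k^'k"
  assumes Q: "finite_measure Q" and [measurable]: "r \<in> borel_measurable Q"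
    and PD: "\<forall>\<^sub>F t in nhds 0. T t \<in> PDS" and dT: "(T has_vector_derivative T') (at 0)"
    and min: "\<forall>\<^sub>F t in at 0. (\<integral>s. \<rho> (sqrt (r s \<bullet> (T 0 *v r s))) \<partial>Q) \<le> (\<integral>s. \<rho> (sqrt (r s \<bullet> (T t *v r s))) \<partial>Q)"
  shows "(\<integral>s. w (r s \<bullet> (T 0 *v r s)) * (r s \<bullet> (T' *v r s)) \<partial>Q) = 0"
proof -
  interpret finite_measure Q by fact
  have T0: "T 0 \<in> PDS" using PD by (rule eventually_nhds_x_imp_x)
  obtain L where L: "0 < L" "\<And>x. L * (norm x)\<^sup>2 \<le> x \<bullet> (T 0 *v x)" using PDS_coercive[OF T0] by blast
  have cont: "(T \<longlongrightarrow> T 0) (at 0)"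
    using has_vector_derivative_continuous[OF dT] by (simp add: continuous_within)
  have co: "\<forall>\<^sub>F t in at 0. \<forall>x. L/2 * (norm x)\<^sup>2 \<le> x \<bullet> (T t *v x)"
    by (rule PDS_coercive_nearby[OF cont L(2)]) (use L in auto)
  have lip: "\<forall>\<^sub>F t in at 0. norm (T t - T 0) \<le> \<bar>t\<bar> * (norm T' + 1)"
  proof -
    have "\<forall>\<^sub>F t in at 0. norm ((T t - T 0) /\<^sub>R t) < norm T' + 1"
      using dT unfolding has_vector_derivative_at_0_iff
      by (intro order_tendstoD(2)[OF tendsto_norm]) auto
    then show ?thesis using eventually_neq_at_within[of 0 0 UNIV]
    proof eventually_elim
      case (elim t)
      have "norm ((T t - T 0) /\<^sub>R t) = norm (T t - T 0) / \<bar>t\<bar>" by (simp add: divide_inverse mult.commute)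
      with elim show ?case by (simp add: divide_less_eq mult.commute)
    qed
  qed
  have "\<forall>\<^sub>F t in at 0. T t \<in> PDS \<and> (\<forall>x. L/2 * (norm x)\<^sup>2 \<le> x \<bullet> (T t *v x)) \<and> norm (T t - T 0) \<le> \<bar>t\<bar> * (norm T' + 1)"
    using co lip PD by (auto simp: eventually_conj_iff eventually_at_filter elim: eventually_mono)
  then obtain \<epsilon> where \<epsilon>: "0 < \<epsilon>" and near': "\<And>t. t \<noteq> 0 \<Longrightarrow> \<bar>t\<bar> < \<epsilon> \<Longrightarrow>
      T t \<in> PDS \<and> (\<forall>x. L/2 * (norm x)\<^sup>2 \<le> x \<bullet> (T t *v x)) \<and> norm (T t - T 0) \<le> \<bar>t\<bar> * (norm T' + 1)"
    unfolding eventually_at by (auto simp: dist_real_def)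
  have half: "L/2 * (norm x)\<^sup>2 \<le> x \<bullet> (T 0 *v x)" for x
    by (rule order_trans[OF _ L(2)]) (use L in auto)
  have near: "T t \<in> PDS" "L/2 * (norm x)\<^sup>2 \<le> x \<bullet> (T t *v x)" "norm (T t - T 0) \<le> \<bar>t\<bar> * (norm T' + 1)"
    if "\<bar>t\<bar> < \<epsilon>" for t x
    using near'[OF _ that] T0 half by (cases "t = 0"; simp)+
  define R where "R = c1 / sqrt (L/2)"
  have R: "0 < R" using c1_pos L by (simp add: R_def)
  show ?thesis
  proof (rule stationary_at_local_min[where q="\<lambda>t s. r s \<bullet> (T t *v r s)" and \<epsilon>=\<epsilon> and G="\<lambda>s. (norm T' + 1) * R\<^sup>2"])
    show "finite_measure Q" by fact
    show "0 < \<epsilon>" by fact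
    show "(\<lambda>s. r s \<bullet> (T t *v r s)) \<in> borel_measurable Q" for t by measurable
    show "(\<lambda>s. r s \<bullet> (T' *v r s)) \<in> borel_measurable Q" by measurable
    show "0 \<le> r s \<bullet> (T t *v r s)" if "\<bar>t\<bar> < \<epsilon>" for t s by (rule PDS_nonneg[OF near(1)[OF that]])
    show "((\<lambda>t. r s \<bullet> (T t *v r s)) has_real_derivative r s \<bullet> (T' *v r s)) (at 0)" for s
      unfolding has_real_derivative_iff_has_vector_derivative
      by (rule bounded_linear.has_vector_derivative[OF bounded_linear_inner_right
            bounded_linear.has_vector_derivative[OF mv.bounded_linear_left dT]])
    show "integrable Q (\<lambda>s. (norm T' + 1) * R\<^sup>2)" by simp
    show "\<forall>\<^sub>F t in at 0. (\<integral>s. \<rho> (sqrt (r s \<bullet> (T 0 *v r s))) \<partial>Q) \<le> (\<integral>s. \<rho> (sqrt (r s \<bullet> (T t *v r s))) \<partial>Q)" by (rule min)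
    fix t s assume t: "\<bar>t\<bar> < \<epsilon>" and small: "r s \<bullet> (T t *v r s) \<le> c1\<^sup>2 \<or> r s \<bullet> (T 0 *v r s) \<le> c1\<^sup>2"
    have L2: "0 < L/2" using L by simp
    have rR: "norm (r s) \<le> R"
      using small norm_le_of_small_form[OF L2 near(2)[OF t]] norm_le_of_small_form[OF L2 half] unfolding R_def by blast
    have "\<bar>r s \<bullet> (T t *v r s) - r s \<bullet> (T 0 *v r s)\<bar> = \<bar>r s \<bullet> ((T t - T 0) *v r s)\<bar>"
      by (simp add: mv.diff_left inner_diff_right)
    also have "\<dots> \<le> norm (r s) * (norm (T t - T 0) * norm (r s))"
      by (intro order_trans[OF Cauchy_Schwarz_ineq2] mult_left_mono norm_matrix_vector_le) auto
    also have "\<dots> \<le> R * ((\<bar>t\<bar> * (norm T' + 1)) * R)"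
      using R by (intro mult_mono rR near(3)[OF t]) auto
    finally show "\<bar>r s \<bullet> (T t *v r s) - r s \<bullet> (T 0 *v r s)\<bar> \<le> \<bar>t\<bar> * ((norm T' + 1) * R\<^sup>2)"
      by (simp add: power2_eq_square mult_ac)
  qed
qed

end

context standardized_model
begin

text \<open>The sensitivity of the shape equation; it is the constant \<open>\<gamma>\<^sub>1\<close> rewritten in \<open>w\<close> and \<open>\<kappa>\<close>.\<close>

definition \<gamma>c :: "real \<Rightarrow> real" where
  "\<gamma>c g = g * (\<integral>z. w (g * (norm z)\<^sup>2) * (norm z)\<^sup>2 \<partial>\<mu>)
     + 2 * g\<^sup>2 / (CARD('k) + 2) * (\<integral>z. \<kappa> (g * (norm z)\<^sup>2) * norm z ^ 4 \<partial>\<mu>)"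

lemma weighted_radius_limit:
  assumes g0: "0 < g0" and g: "g \<longlonglongrightarrow> g0" and L: "0 < L" "\<And>n. L \<le> g n"
  shows "(\<lambda>n. \<integral>z. w (g n * (norm z)\<^sup>2) * (norm z)\<^sup>2 \<partial>\<mu>) \<longlonglongrightarrow> (\<integral>z. w (g0 * (norm z)\<^sup>2) * (norm z)\<^sup>2 \<partial>\<mu>)"
proof -
  obtain M where M: "\<And>q. 0 \<le> q \<Longrightarrow> \<bar>w q\<bar> \<le> M" "\<And>q. 0 \<le> q \<Longrightarrow> \<bar>q * \<kappa> q\<bar> \<le> M"
    using bounded_weights by metis
  show ?thesis
  proof (rule integral_dominated_convergence)
    show "integrable \<mu> (\<lambda>_. M * (c1 / sqrt L)\<^sup>2)" by simp
    show "AE z in \<mu>. (\<lambda>n. w (g n * (norm z)\<^sup>2) * (norm z)\<^sup>2) \<longlonglongrightarrow> w (g0 * (norm z)\<^sup>2) * (norm z)\<^sup>2"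
    proof (rule AE_I2)
      fix z :: "real^'k"
      have "(\<lambda>n. g n * (norm z)\<^sup>2) \<longlonglongrightarrow> g0 * (norm z)\<^sup>2" by (intro tendsto_intros g)
      then have "(\<lambda>n. w (g n * (norm z)\<^sup>2)) \<longlonglongrightarrow> w (g0 * (norm z)\<^sup>2)"
        using continuous_w by (intro isCont_tendsto_compose[where g=w]) (simp_all add: continuous_on_eq_continuous_at)
      then show "(\<lambda>n. w (g n * (norm z)\<^sup>2) * (norm z)\<^sup>2) \<longlonglongrightarrow> w (g0 * (norm z)\<^sup>2) * (norm z)\<^sup>2"
        by (intro tendsto_intros)
    qed
    show "AE z in \<mu>. norm (w (g n * (norm z)\<^sup>2) * (norm z)\<^sup>2) \<le> M * (c1 / sqrt L)\<^sup>2" for n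
    proof (rule AE_I2)
      fix z :: "real^'k"
      have "L * (norm z)\<^sup>2 \<le> g n * (norm z)\<^sup>2" by (intro mult_right_mono L) simp
      from w_norm[OF M L(1) this, of 2] show "norm (w (g n * (norm z)\<^sup>2) * (norm z)\<^sup>2) \<le> M * (c1 / sqrt L)\<^sup>2"
        by (simp add: abs_mult)
    qed
  qed measurable
qed

text \<open>In the score of the shape parameter, the leading scatter matrix, a multiple of the identity, only
  contributes through the trace of the test matrix, which is of first order in the perturbation.\<close>

lemma shape_score_limit:
  fixes \<delta> :: "nat \<Rightarrow> real^'q" and W :: "nat \<Rightarrow> real^'k^'k" and A :: "nat \<Rightarrow> real^'k^'k" and e g :: "nat \<Rightarrow> real"
    and Lt W' :: "real^'k^'k"
  assumes g0: "0 < g0" and g: "g \<longlonglongrightarrow> g0" and L: "0 < L" "\<And>n. L \<le> g n" and e: "\<And>n. 0 < e n"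
    and sym: "\<And>n. transpose (A n) = A n" and A: "A \<longlonglongrightarrow> g0 *\<^sub>R mat 1"
    and low: "\<And>n x. L * (norm x)\<^sup>2 \<le> x \<bullet> (A n *v x)"
    and AW: "\<And>n. A n = g n *\<^sub>R mat 1 - a *\<^sub>R (A n ** W n)"
    and \<delta>_le: "\<And>n. norm (\<delta> n) \<le> K0 * e n" and e_0: "e \<longlonglongrightarrow> 0"
    and \<delta>: "(\<lambda>n. \<delta> n /\<^sub>R e n) \<longlonglongrightarrow> b" and W: "(\<lambda>n. W n /\<^sub>R e n) \<longlonglongrightarrow> W'"
    and symW: "transpose W' = W'" and trW: "trace W' = 0" and symL: "transpose Lt = Lt"
  shows "(\<lambda>n. (\<integral>s. w (resid (\<delta> n) s \<bullet> (A n *v resid (\<delta> n) s)) *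
        (resid (\<delta> n) s \<bullet> ((real CARD('k) *\<^sub>R (A n ** Lt ** A n) - trace (A n ** Lt) *\<^sub>R A n) *v resid (\<delta> n) s)) \<partial>N) / e n)
    \<longlonglongrightarrow> - (a * g0 * \<gamma>c g0 * (Lt \<bullet> W'))"
proof -
  let ?k = "real CARD('k)"
  define E where "E n = - (a *\<^sub>R (A n ** W n))" for n
  define E' where "E' = - (a * g0) *\<^sub>R W'"
  have AE: "A n = g n *\<^sub>R mat 1 + E n" for n using AW[of n] by (simp add: E_def)
  have symE: "transpose (E n) = E n" for n
  proof -
    have "E n = A n - g n *\<^sub>R mat 1" using AE[of n] by simp
    then show ?thesis by (simp add: transpose_diff transpose_scaleR sym)
  qed
  have "(\<lambda>n. - (a *\<^sub>R (A n ** (W n /\<^sub>R e n)))) \<longlonglongrightarrow> - (a *\<^sub>R (g0 *\<^sub>R mat 1 ** W'))"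
    by (intro tendsto_intros mm.tendsto A W)
  then have E: "(\<lambda>n. E n /\<^sub>R e n) \<longlonglongrightarrow> E'"
    by (simp add: E_def E'_def mm.scaleR_right mm.scaleR_left mult.commute)
  have symE': "transpose E' = E'" by (simp only: E'_def transpose_scaleR symW)
  have trE': "trace E' = 0" by (simp only: E'_def trace_scaleR trW scaleR_zero_right)
  obtain KE where KE: "\<And>n. norm (E n /\<^sub>R e n) \<le> KE"
    using convergent_imp_Bseq[OF convergentI[OF E]] by (auto simp: Bseq_def)
  have E_le: "norm (E n) \<le> max K0 KE * e n" for n
  proof -
    have "norm (E n) = norm (E n /\<^sub>R e n) * e n" using e[of n] by simp
    also have "\<dots> \<le> max K0 KE * e n" using KE[of n] e[of n] by (intro mult_right_mono) auto
    finally show ?thesis .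
  qed
  have \<delta>_le': "norm (\<delta> n) \<le> max K0 KE * e n" for n
    by (rule order_trans[OF \<delta>_le mult_right_mono]) (use e[of n] in auto)
  define B where "B n = ?k *\<^sub>R (A n ** Lt ** A n) - trace (A n ** Lt) *\<^sub>R A n" for n
  define B0 where "B0 = (?k * g0\<^sup>2) *\<^sub>R Lt - (g0\<^sup>2 * trace Lt) *\<^sub>R (mat 1 :: real^'k^'k)"
  have AL: "(\<lambda>n. A n ** Lt) \<longlonglongrightarrow> g0 *\<^sub>R Lt"
    using mm.tendsto[OF A tendsto_const[of Lt]] by (simp add: mm.scaleR_left)
  have trAL: "(\<lambda>n. trace (A n ** Lt)) \<longlonglongrightarrow> g0 * trace Lt"
    using bounded_linear.tendsto[OF bounded_linear_trace AL] by (simp add: trace_scaleR)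
  have "(\<lambda>n. B n) \<longlonglongrightarrow> ?k *\<^sub>R ((g0 *\<^sub>R Lt) ** (g0 *\<^sub>R mat 1)) - (g0 * trace Lt) *\<^sub>R (g0 *\<^sub>R mat 1)"
    unfolding B_def by (intro tendsto_intros mm.tendsto AL A trAL)
  then have B: "B \<longlonglongrightarrow> B0"
    by (simp add: B0_def mm.scaleR_left mm.scaleR_right power2_eq_square mult_ac)
  have trB: "trace (B n) = ?k * trace (A n ** Lt ** E n) - trace (A n ** Lt) * trace (E n)" for n
  proof -
    have "trace (A n ** Lt ** A n) = g n * trace (A n ** Lt) + trace (A n ** Lt ** E n)"
      by (subst (2) AE) (simp add: matrix_add_ldistrib mm.scaleR_right trace_add trace_scaleR)
    moreover have "trace (A n) = g n * ?k + trace (E n)"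
      by (subst AE) (simp add: trace_add trace_scaleR trace_I)
    ultimately show ?thesis
      by (simp add: B_def trace_sub trace_scaleR algebra_simps)
  qed
  have "(\<lambda>n. ?k * trace (A n ** Lt ** (E n /\<^sub>R e n)) - trace (A n ** Lt) * trace (E n /\<^sub>R e n)) \<longlonglongrightarrow>
      ?k * trace ((g0 *\<^sub>R Lt) ** E') - (g0 * trace Lt) * trace E'"
    by (intro tendsto_intros bounded_linear.tendsto[OF bounded_linear_trace] mm.tendsto AL E trAL)
  moreover have "?k * trace (A n ** Lt ** (E n /\<^sub>R e n)) - trace (A n ** Lt) * trace (E n /\<^sub>R e n) = trace (B n) / e n" for n
    by (simp add: trB mm.scaleR_right trace_scaleR divide_inverse algebra_simps)
  moreover have "?k * trace ((g0 *\<^sub>R Lt) ** E') - (g0 * trace Lt) * trace E' = - (?k * a * g0\<^sup>2) * (Lt \<bullet> W')"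
    unfolding trE' by (simp add: E'_def mm.scaleR_left mm.scaleR_right mm.minus_right
        linear_neg[OF bounded_linear.linear[OF bounded_linear_trace]] trace_scaleR inner_eq_trace symL power2_eq_square)
  ultimately have trB_lim: "(\<lambda>n. trace (B n) / e n) \<longlonglongrightarrow> - (?k * a * g0\<^sup>2) * (Lt \<bullet> W')" by simp
  define s where "s n = (\<integral>z. w (g n * (norm z)\<^sup>2) * (norm z)\<^sup>2 \<partial>\<mu>)" for n
  define s0 where "s0 = (\<integral>z. w (g0 * (norm z)\<^sup>2) * (norm z)\<^sup>2 \<partial>\<mu>)"
  have s: "s \<longlonglongrightarrow> s0" using weighted_radius_limit[OF g0 g L] by (simp add: s_def[abs_def] s0_def)
  define C4 where "C4 = (\<integral>z. \<kappa> (g0 * (norm z)\<^sup>2) * norm z ^ 4 \<partial>\<mu>) / (CARD('k) * (CARD('k) + 2))"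
  define S where "S n = (\<chi> i j. (\<integral>s. w (resid (\<delta> n) s \<bullet> (A n *v resid (\<delta> n) s)) * (resid (\<delta> n) s $ i * resid (\<delta> n) s $ j) \<partial>N))" for n
  have S: "(\<lambda>n. (S n - (s n / ?k) *\<^sub>R mat 1) /\<^sub>R e n) \<longlonglongrightarrow> (2 * C4) *\<^sub>R E'"
  proof (intro vec_tendstoI)
    fix i j
    have "E' $ j $ i = E' $ i $ j" using symE' by (metis transpose_def vec_lambda_beta)
    then show "(\<lambda>n. ((S n - (s n / ?k) *\<^sub>R mat 1) /\<^sub>R e n) $ i $ j) \<longlonglongrightarrow> ((2 * C4) *\<^sub>R E') $ i $ j"
      using weighted_scatter_limit[OF g0 g L e symE low[unfolded AE] E_le \<delta>_le' e_0 \<delta> E, of i j]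
      unfolding AE[symmetric]
      by (simp add: S_def s_def C4_def trE' divide_inverse mult_ac)
  qed
  have int: "(\<integral>s. w (resid (\<delta> n) s \<bullet> (A n *v resid (\<delta> n) s)) * (resid (\<delta> n) s \<bullet> (B n *v resid (\<delta> n) s)) \<partial>N) = B n \<bullet> S n" for n
  proof -
    have "w (resid (\<delta> n) s \<bullet> (A n *v resid (\<delta> n) s)) * (resid (\<delta> n) s \<bullet> (B n *v resid (\<delta> n) s))
      = (\<Sum>i\<in>UNIV. \<Sum>j\<in>UNIV. B n $ i $ j * (w (resid (\<delta> n) s \<bullet> (A n *v resid (\<delta> n) s)) * (resid (\<delta> n) s $ i * resid (\<delta> n) s $ j)))" for s
    proof -
      have "y \<bullet> (B n *v y) = (\<Sum>i\<in>UNIV. \<Sum>j\<in>UNIV. B n $ i $ j * (y $ i * y $ j))" for y :: "real^'k"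
        by (simp add: inner_vec_def matrix_vector_mult_def sum_distrib_left mult_ac)
      then show ?thesis by (simp only: sum_distrib_left mult.left_commute[of "w _"])
    qed
    then show ?thesis
      by (simp only: Bochner_Integration.integral_sum Bochner_Integration.integrable_sum integrable_mult_right
          integrable_weighted_scatter[OF L(1) low] integral_mult_right_zero)
        (simp add: inner_vec_def S_def)
  qed
  have "(\<lambda>n. B n \<bullet> ((S n - (s n / ?k) *\<^sub>R mat 1) /\<^sub>R e n) + (s n / ?k) * (trace (B n) / e n)) \<longlonglongrightarrow>
      B0 \<bullet> ((2 * C4) *\<^sub>R E') + (s0 / ?k) * (- (?k * a * g0\<^sup>2) * (Lt \<bullet> W'))"
    by (intro tendsto_intros B S s trB_lim) simp
  moreover have "B n \<bullet> ((S n - (s n / ?k) *\<^sub>R mat 1) /\<^sub>R e n) + (s n / ?k) * (trace (B n) / e n) = (B n \<bullet> S n) / e n" for n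
    by (simp add: inner_diff_right inner_mat_1 divide_inverse algebra_simps)
  moreover have "B0 \<bullet> ((2 * C4) *\<^sub>R E') + (s0 / ?k) * (- (?k * a * g0\<^sup>2) * (Lt \<bullet> W')) = - (a * g0 * \<gamma>c g0 * (Lt \<bullet> W'))"
  proof -
    have k0: "?k \<noteq> 0" by simp
    have BE: "B0 \<bullet> E' = - (?k * a * g0 ^ 3) * (Lt \<bullet> W')"
      using trW by (simp add: B0_def E'_def inner_diff_left inner_commute[of "mat 1"] inner_mat_1 power2_eq_square power3_eq_cube)
    have "?k * C4 = (\<integral>z. \<kappa> (g0 * (norm z)\<^sup>2) * norm z ^ 4 \<partial>\<mu>) / (?k + 2)"
    proof -
      have "real (CARD('k) * (CARD('k) + 2)) = ?k * (?k + 2)" by (simp add: algebra_simps)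
      then show ?thesis
        unfolding C4_def by (simp only: times_divide_eq_right nonzero_mult_divide_mult_cancel_left[OF k0])
    qed
    then have gc: "\<gamma>c g0 = g0 * s0 + 2 * g0\<^sup>2 * (?k * C4)" by (simp add: \<gamma>c_def s0_def)
    have "(s0 / ?k) * (- (?k * a * g0\<^sup>2) * (Lt \<bullet> W')) = - (s0 * a * g0\<^sup>2 * (Lt \<bullet> W'))" using k0 by simp
    then show ?thesis unfolding gc inner_scaleR_right BE by (simp add: power2_eq_square power3_eq_cube algebra_simps)
  qed
  ultimately have "(\<lambda>n. (B n \<bullet> S n) / e n) \<longlonglongrightarrow> - (a * g0 * \<gamma>c g0 * (Lt \<bullet> W'))" by simp
  then show ?thesis unfolding int[symmetric] unfolding B_def .
qed

end

section \<open>Limits along curves and level sets\<close>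

lemma eventually_local_min_along_curve:
  assumes min: "local_min_on f S x" and c: "(c \<longlongrightarrow> x) (at (0::real))" and S: "\<forall>\<^sub>F t in at 0. c t \<in> S"
  shows "\<forall>\<^sub>F t in at 0. f x \<le> f (c t)"
proof -
  have "\<forall>\<^sub>F y in nhds x. y \<noteq> x \<longrightarrow> y \<in> S \<longrightarrow> f x \<le> f y"
    using min by (auto simp: local_min_on_def eventually_at_filter)
  then have "\<forall>\<^sub>F t in at 0. c t \<noteq> x \<longrightarrow> c t \<in> S \<longrightarrow> f x \<le> f (c t)"
    by (rule eventually_compose_filterlim[OF _ c])
  with S show ?thesis by eventually_elim auto
qed

text \<open>Dividing the first order expansion of \<open>F\<close> at \<open>0\<close> by \<open>e n\<close> leaves only \<open>D b\<close>, since the increments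
  of \<open>F\<close> vanish.\<close>

lemma derivative_vanishes_along_level_set:
  fixes F :: "'a::real_normed_vector \<Rightarrow> real"
  assumes F: "(F has_derivative D) (at 0)" and level: "\<And>n. F (\<delta> n) = F 0" and \<delta>0: "\<delta> \<longlonglongrightarrow> 0"
    and e: "\<And>n. 0 < e n" "\<And>n. norm (\<delta> n) \<le> e n" and \<delta>: "(\<lambda>n. \<delta> n /\<^sub>R e n) \<longlonglongrightarrow> b"
  shows "D b = 0"
proof -
  have D: "bounded_linear D" using F by (rule has_derivative_bounded_linear)
  then interpret D: bounded_linear D .
  have "\<bar>D b\<bar> \<le> \<epsilon>" if "0 < \<epsilon>" for \<epsilon>
  proof -
    have "\<exists>d>0. \<forall>y. norm y < d \<longrightarrow> norm (F y - F 0 - D y) \<le> \<epsilon> * norm y"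
      using F that unfolding has_derivative_at_alt by simp
    then obtain d where d: "0 < d" "\<And>y. norm y < d \<Longrightarrow> norm (F y - F 0 - D y) \<le> \<epsilon> * norm y"
      by blast
    have "\<forall>\<^sub>F n in sequentially. norm (\<delta> n) < d"
      using order_tendstoD(2)[OF tendsto_norm[OF \<delta>0], of d] d(1) by simp
    then have "\<forall>\<^sub>F n in sequentially. \<bar>D (\<delta> n /\<^sub>R e n)\<bar> \<le> \<epsilon>"
    proof eventually_elim
      case (elim n)
      have "\<bar>D (\<delta> n)\<bar> \<le> \<epsilon> * norm (\<delta> n)" using d(2)[of "\<delta> n"] elim level by simp
      also have "\<dots> \<le> \<epsilon> * e n" using that by (intro mult_left_mono e) auto
      finally show ?case using e(1)[of n] by (simp add: D.scaleR abs_mult field_simps)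
    qed
    moreover have "(\<lambda>n. \<bar>D (\<delta> n /\<^sub>R e n)\<bar>) \<longlonglongrightarrow> \<bar>D b\<bar>" by (intro tendsto_intros D.tendsto \<delta>)
    ultimately show ?thesis by (intro tendsto_upperbound) auto
  qed
  then have "\<bar>D b\<bar> \<le> 0" by (rule field_le_epsilon[rule_format]) simp
  then show ?thesis by simp
qed

section \<open>Vectorization and Kronecker products\<close>

lemma inner_vectorize: fixes A B :: "real^'n^'m" shows "vectorize A \<bullet> vectorize B = A \<bullet> B"
proof -
  have "vectorize A \<bullet> vectorize B = (\<Sum>(c, r)\<in>UNIV \<times> UNIV. A $ r $ c * B $ r $ c)"
    by (simp add: vectorize_def inner_vec_def case_prod_beta)
  also have "\<dots> = (\<Sum>c\<in>UNIV. \<Sum>r\<in>UNIV. A $ r $ c * B $ r $ c)"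
    by (simp only: sum.cartesian_product)
  also have "\<dots> = A \<bullet> B" unfolding inner_vec_def by simp (rule sum.swap)
  finally show ?thesis .
qed

lemma kronecker_vectorize:
  fixes A :: "real^'n^'m" and B :: "real^'b^'a" and C :: "real^'n^'b"
  shows "kronecker A B *v vectorize C = vectorize (B ** C ** transpose A)"
proof -
  have "(\<Sum>(c, r)\<in>UNIV \<times> UNIV. A $ i $ c * B $ j $ r * C $ r $ c)
    = (\<Sum>c\<in>UNIV. (\<Sum>r\<in>UNIV. B $ j $ r * C $ r $ c) * A $ i $ c)" for i j
    by (simp only: sum.cartesian_product[symmetric] sum_distrib_right) (simp only: mult_ac)
  then show ?thesis
    by (simp add: vec_eq_iff kronecker_def vectorize_def matrix_vector_mult_def matrix_matrix_mult_def
        transpose_def case_prod_beta)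
qed

lemma vectorized_columns_mult:
  fixes L :: "'l::finite \<Rightarrow> real^'k^'k"
  shows "vectorized_columns L *v x = vectorize (\<Sum>j\<in>UNIV. x $ j *\<^sub>R L j)"
  by (simp add: vec_eq_iff vectorized_columns_def vectorize_def matrix_vector_mult_def mult.commute)

lemma transpose_vectorized_columns_mult:
  fixes L :: "'l::finite \<Rightarrow> real^'k^'k"
  shows "(transpose (vectorized_columns L) *v vectorize C) $ j = L j \<bullet> C"
proof -
  have "(transpose (vectorized_columns L) *v vectorize C) $ j = vectorize (L j) \<bullet> vectorize C"
    unfolding vectorized_columns_def transpose_def matrix_vector_mult_def inner_vec_def
    by (simp add: mult.commute)
  then show ?thesis by (simp add: inner_vectorize)
qed

section \<open>The standardized law\<close>

lemma inv_sqrt_facts: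
  fixes \<Sigma> :: "real^'k^'k" assumes "\<Sigma> \<in> PDS"
  shows inv_sqrt_left: "inv_sqrt \<Sigma> ** pd_sqrt \<Sigma> = mat 1" and inv_sqrt_right: "pd_sqrt \<Sigma> ** inv_sqrt \<Sigma> = mat 1"
    and inv_sqrt_PDS: "inv_sqrt \<Sigma> \<in> PDS" and inv_sqrt_square: "inv_sqrt \<Sigma> ** inv_sqrt \<Sigma> = matrix_inv \<Sigma>"
    and det_pd_sqrt: "0 < det (pd_sqrt \<Sigma>)" "det \<Sigma> = (det (pd_sqrt \<Sigma>))\<^sup>2"
proof -
  note i = PDS_invertible[OF pd_sqrt_PDS[OF assms]]
  show 1: "inv_sqrt \<Sigma> ** pd_sqrt \<Sigma> = mat 1" and 2: "pd_sqrt \<Sigma> ** inv_sqrt \<Sigma> = mat 1"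
    unfolding inv_sqrt_def by (rule matrix_inv_left[OF i], rule matrix_inv_right[OF i])
  show "inv_sqrt \<Sigma> \<in> PDS" unfolding inv_sqrt_def by (rule PDS_inv[OF pd_sqrt_PDS[OF assms]])
  have "\<Sigma> ** (inv_sqrt \<Sigma> ** inv_sqrt \<Sigma>) = (pd_sqrt \<Sigma> ** pd_sqrt \<Sigma>) ** (inv_sqrt \<Sigma> ** inv_sqrt \<Sigma>)"
    by (simp only: pd_sqrt_square[OF assms])
  also have "\<dots> = pd_sqrt \<Sigma> ** (pd_sqrt \<Sigma> ** inv_sqrt \<Sigma>) ** inv_sqrt \<Sigma>"
    by (simp only: matrix_mul_assoc)
  also have "\<dots> = mat 1" by (simp add: 2)
  finally show "inv_sqrt \<Sigma> ** inv_sqrt \<Sigma> = matrix_inv \<Sigma>" by (rule matrix_inv_eqI[symmetric])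
  show "0 < det (pd_sqrt \<Sigma>)" by (rule PDS_det_pos[OF pd_sqrt_PDS[OF assms]])
  show "det \<Sigma> = (det (pd_sqrt \<Sigma>))\<^sup>2"
    by (metis assms det_mul pd_sqrt_square power2_eq_square)
qed

lemma matrix_inv_mat_1: "matrix_inv (mat 1 :: real^'k^'k) = mat 1"
  by (rule matrix_inv_eqI) simp

lemma elliptical_density_standard:
  "elliptical_density m 0 (mat 1) z = m ((norm z)\<^sup>2)" for z :: "real^'k"
  by (simp add: elliptical_density_def matrix_inv_mat_1 power2_norm_eq_inner)

lemma elliptical_density_affine:
  fixes \<Sigma> :: "real^'k^'k" assumes "\<Sigma> \<in> PDS"
  shows "det (pd_sqrt \<Sigma>) * elliptical_density m \<mu> \<Sigma> (\<mu> + pd_sqrt \<Sigma> *v z) = elliptical_density m 0 (mat 1) z"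
proof -
  let ?S = "pd_sqrt \<Sigma>" and ?H = "inv_sqrt \<Sigma>"
  note f = inv_sqrt_facts[OF assms]
  have "det \<Sigma> powr (- 1 / 2) = 1 / sqrt (det \<Sigma>)"
    using PDS_det_pos[OF assms] powr_minus_divide[of "det \<Sigma>" "1/2"] powr_half_sqrt[of "det \<Sigma>"] by simp
  also have "\<dots> = 1 / det ?S" using f(5) by (simp add: f(6))
  finally have d: "det ?S * det \<Sigma> powr (- 1 / 2) = 1" using f(5) by simp
  have "matrix_inv \<Sigma> *v (?S *v z) = ?H *v z"
    by (simp add: f(4)[symmetric] matrix_vector_mul_assoc matrix_mul_assoc[symmetric] f(1))
  then have "(?S *v z) \<bullet> (matrix_inv \<Sigma> *v (?S *v z)) = z \<bullet> (?S *v (?H *v z))"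
    using inner_symmetric_matrix[OF PDS_sym[OF pd_sqrt_PDS[OF assms]]] by simp
  also have "\<dots> = (norm z)\<^sup>2" by (simp add: matrix_vector_mul_assoc f(2) power2_norm_eq_inner)
  finally have q: "(?S *v z) \<bullet> (matrix_inv \<Sigma> *v (?S *v z)) = (norm z)\<^sup>2" .
  show ?thesis
    unfolding elliptical_density_standard
    unfolding elliptical_density_def add_diff_cancel_left' q mult.assoc[symmetric] d by simp
qed

lemma nn_integral_elliptical_density:
  fixes \<Sigma> :: "real^'k^'k" and F :: "real^'k \<Rightarrow> ennreal"
  assumes \<Sigma>: "\<Sigma> \<in> PDS" and [measurable]: "F \<in> borel_measurable borel"
    "elliptical_density m \<mu> \<Sigma> \<in> borel_measurable borel"
  shows "(\<integral>\<^sup>+y. ennreal (elliptical_density m \<mu> \<Sigma> y) * F y \<partial>lborel)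
    = (\<integral>\<^sup>+z. ennreal (elliptical_density m 0 (mat 1) z) * F (\<mu> + pd_sqrt \<Sigma> *v z) \<partial>lborel)"
proof -
  let ?S = "pd_sqrt \<Sigma>"
  note d = det_pd_sqrt(1)[OF \<Sigma>]
  have "(\<integral>\<^sup>+y. ennreal (elliptical_density m \<mu> \<Sigma> y) * F y \<partial>lborel)
    = ennreal \<bar>det ?S\<bar> * (\<integral>\<^sup>+z. ennreal (elliptical_density m \<mu> \<Sigma> (\<mu> + ?S *v z)) * F (\<mu> + ?S *v z) \<partial>lborel)"
    by (rule nn_integral_affine[OF PDS_invertible[OF pd_sqrt_PDS[OF \<Sigma>]]]) measurable
  also have "\<dots> = (\<integral>\<^sup>+z. ennreal \<bar>det ?S\<bar> * (ennreal (elliptical_density m \<mu> \<Sigma> (\<mu> + ?S *v z)) * F (\<mu> + ?S *v z)) \<partial>lborel)"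
    by (rule nn_integral_cmult[symmetric]) measurable
  also have "\<dots> = (\<integral>\<^sup>+z. ennreal (elliptical_density m 0 (mat 1) z) * F (\<mu> + ?S *v z) \<partial>lborel)"
    unfolding elliptical_density_affine[OF \<Sigma>, of m \<mu>, symmetric]
    using d by (simp add: ennreal_mult' mult.assoc)
  finally show ?thesis .
qed

lemma measurable_matrix_mult [measurable]:
  fixes A :: "real^'k^'k" shows "(\<lambda>X :: real^'q^'k. A ** X) \<in> borel_measurable borel"
  by (intro borel_measurable_continuous_onI linear_continuous_on) (rule mm.bounded_linear_right)

definition standardize :: "real^'k^'k \<Rightarrow> real^'q \<Rightarrow> ('k, 'q) obs \<Rightarrow> ('k, 'q) obs" where
  "standardize \<Sigma> \<beta> s = (inv_sqrt \<Sigma> *v (fst s - snd s *v \<beta>), inv_sqrt \<Sigma> ** snd s)"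

lemma measurable_standardize [measurable]: "standardize \<Sigma> \<beta> \<in> borel_measurable borel"
proof -
  have "continuous_on UNIV (standardize \<Sigma> \<beta>)"
    unfolding standardize_def[abs_def]
    by (intro continuous_intros mv.continuous_on mm.continuous_on)
  then show ?thesis by (rule borel_measurable_continuous_onI)
qed

text \<open>Given \<open>X\<close>, the affine map \<open>y = X \<beta> + \<Sigma>\<^sup>1\<^sup>/\<^sup>2 z\<close> carries the spherical density to the
  elliptical one, so the standardized residual does not depend on \<open>X\<close>.\<close>

lemma standardized_law:
  fixes P :: "('k::finite, 'q::finite) obs measure" and \<Sigma> :: "real^'k^'k" and m :: "real \<Rightarrow> real"
  defines "\<mu> \<equiv> density lborel (\<lambda>z :: real^'k. ennreal (elliptical_density m 0 (mat 1) z))"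
    and "\<nu> \<equiv> distr P borel (\<lambda>s. inv_sqrt \<Sigma> ** snd s)"
  assumes P: "prob_space P" "sets P = sets borel" and \<Sigma>: "\<Sigma> \<in> PDS"
    and elliptical: "has_conditional_density P (\<lambda>X. elliptical_density m (X *v \<beta>) \<Sigma>)"
  shows "spherical_law \<mu>" and "prob_space \<nu>" and "distr P borel (standardize \<Sigma> \<beta>) = \<mu> \<Otimes>\<^sub>M \<nu>"
proof -
  interpret P: prob_space P by fact
  note [measurable_cong] = P(2)
  let ?g = "\<lambda>X y. elliptical_density m (X *v \<beta>) \<Sigma> y" and ?f = "\<lambda>z :: real^'k. elliptical_density m 0 (mat 1) z"
  have joint: "(\<lambda>(y, X). ?g X y) \<in> borel_measurable borel"
    and total: "\<And>X. (\<integral>\<^sup>+y. ennreal (?g X y) \<partial>lborel) = 1"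
    and law: "\<And>A. A \<in> sets borel \<Longrightarrow> emeasure P A =
        (\<integral>\<^sup>+X. (\<integral>\<^sup>+y. ennreal (?g X y) * indicator A (y, X) \<partial>lborel) \<partial>distr P borel snd)"
    using elliptical unfolding has_conditional_density_def by auto
  have g [measurable]: "?g X \<in> borel_measurable borel" for X
  proof -
    have "(\<lambda>y. (y, X)) \<in> borel \<rightarrow>\<^sub>M (borel :: ('k, 'q) obs measure)"
      by (intro borel_measurable_continuous_onI continuous_intros)
    from measurable_compose[OF this joint] show ?thesis by simp
  qed
  have "(\<lambda>z. det (pd_sqrt \<Sigma>) * ?g 0 (0 *v \<beta> + pd_sqrt \<Sigma> *v z)) \<in> borel_measurable borel"
    by measurable
  then have f [measurable]: "?f \<in> borel_measurable borel"
    unfolding elliptical_density_affine[OF \<Sigma>] .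
  have f1: "(\<integral>\<^sup>+z. ennreal (?f z) \<partial>lborel) = 1"
    using nn_integral_elliptical_density[OF \<Sigma> _ g[of 0], of "\<lambda>_. 1"] total[of 0] by simp
  show sph: "spherical_law \<mu>"
    unfolding \<mu>_def elliptical_density_standard
    by (rule spherical_law_density[of "\<lambda>r. m (r\<^sup>2)"])
      (use f f1 in \<open>simp_all only: elliptical_density_standard\<close>)
  interpret mu: spherical_law \<mu> by (rule sph)
  have [measurable]: "(\<lambda>s. inv_sqrt \<Sigma> ** snd s) \<in> borel_measurable P"
  proof -
    have "continuous_on UNIV (\<lambda>s :: ('k, 'q) obs. inv_sqrt \<Sigma> ** snd s)"
      by (intro continuous_intros mm.continuous_on)
    then show ?thesis by (simp add: borel_measurable_continuous_onI measurable_cong_sets[OF P(2) refl])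
  qed
  show nu: "prob_space \<nu>" unfolding \<nu>_def by (rule P.prob_space_distr) measurable
  interpret nu: prob_space \<nu> by (rule nu)
  have sndm [measurable]: "snd \<in> borel_measurable P"
    by (simp add: borel_measurable_continuous_onI continuous_on_snd measurable_cong_sets[OF P(2) refl])
  have std [measurable]: "standardize \<Sigma> \<beta> \<in> borel_measurable P"
    by (simp add: measurable_cong_sets[OF P(2) refl])
  have "\<mu> \<Otimes>\<^sub>M \<nu> = distr P borel (standardize \<Sigma> \<beta>)"
  proof (rule pair_measure_eqI)
    show "sigma_finite_measure \<mu>" "sigma_finite_measure \<nu>" by unfold_locales
    have "sets (\<mu> \<Otimes>\<^sub>M \<nu>) = sets (borel \<Otimes>\<^sub>M borel :: ('k, 'q) obs measure)"
      by (rule sets_pair_measure_cong) (simp_all add: \<mu>_def \<nu>_def)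
    also have "(borel \<Otimes>\<^sub>M borel :: ('k, 'q) obs measure) = borel" by (rule borel_prod)
    finally show "sets (\<mu> \<Otimes>\<^sub>M \<nu>) = sets (distr P borel (standardize \<Sigma> \<beta>))"
      by (simp only: sets_distr)
    fix A B assume "A \<in> sets \<mu>" "B \<in> sets \<nu>"
    then have A [measurable]: "A \<in> sets borel" and B [measurable]: "B \<in> sets borel"
      by (simp_all add: \<mu>_def \<nu>_def)
    have AB: "A \<times> B \<in> sets borel" using A B by (simp add: borel_prod[symmetric])
    have pre: "standardize \<Sigma> \<beta> -` (A \<times> B) \<in> sets borel"
      using measurable_sets[OF measurable_standardize AB] by simp
    have sp: "space P = UNIV" using sets_eq_imp_space_eq[OF P(2)] by simp
    have inner: "(\<integral>\<^sup>+y. ennreal (?g X y) * indicator (standardize \<Sigma> \<beta> -` (A \<times> B)) (y, X) \<partial>lborel)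
      = emeasure \<mu> A * indicator B (inv_sqrt \<Sigma> ** X)" for X
    proof -
      have ind: "indicator (standardize \<Sigma> \<beta> -` (A \<times> B)) (y, X)
        = (indicator A (inv_sqrt \<Sigma> *v (y - X *v \<beta>)) * indicator B (inv_sqrt \<Sigma> ** X) :: ennreal)" for y
        by (auto simp: standardize_def indicator_def)
      have "(\<integral>\<^sup>+y. ennreal (?g X y) * indicator (standardize \<Sigma> \<beta> -` (A \<times> B)) (y, X) \<partial>lborel)
        = (\<integral>\<^sup>+z. ennreal (?f z) * (indicator A (inv_sqrt \<Sigma> *v (X *v \<beta> + pd_sqrt \<Sigma> *v z - X *v \<beta>)) * indicator B (inv_sqrt \<Sigma> ** X)) \<partial>lborel)"
        unfolding ind by (rule nn_integral_elliptical_density[OF \<Sigma>]) measurable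
      also have "\<dots> = (\<integral>\<^sup>+z. (ennreal (?f z) * indicator A z) * indicator B (inv_sqrt \<Sigma> ** X) \<partial>lborel)"
        by (simp add: matrix_vector_mul_assoc inv_sqrt_left[OF \<Sigma>] mult.assoc)
      also have "\<dots> = emeasure \<mu> A * indicator B (inv_sqrt \<Sigma> ** X)"
        by (subst nn_integral_multc) (simp_all add: \<mu>_def emeasure_density)
      finally show ?thesis .
    qed
    have "emeasure (distr P borel (standardize \<Sigma> \<beta>)) (A \<times> B) = emeasure P (standardize \<Sigma> \<beta> -` (A \<times> B))"
      using AB by (simp add: emeasure_distr sp)
    also have "\<dots> = (\<integral>\<^sup>+X. emeasure \<mu> A * indicator B (inv_sqrt \<Sigma> ** X) \<partial>distr P borel snd)"
      unfolding law[OF pre] inner ..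
    also have "\<dots> = emeasure \<mu> A * (\<integral>\<^sup>+X. indicator B (inv_sqrt \<Sigma> ** X) \<partial>distr P borel snd)"
      by (rule nn_integral_cmult) measurable
    also have "(\<integral>\<^sup>+X. indicator B (inv_sqrt \<Sigma> ** X) \<partial>distr P borel snd) = emeasure \<nu> B"
    proof -
      have "(\<integral>\<^sup>+X. indicator B (inv_sqrt \<Sigma> ** X) \<partial>distr P borel snd) = (\<integral>\<^sup>+s. indicator B (inv_sqrt \<Sigma> ** snd s) \<partial>P)"
        by (rule nn_integral_distr) measurable
      also have "\<dots> = (\<integral>\<^sup>+X. indicator B X \<partial>\<nu>)" unfolding \<nu>_def by (rule nn_integral_distr[symmetric]) measurable
      also have "\<dots> = emeasure \<nu> B" using B by (simp add: \<nu>_def)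
      finally show ?thesis .
    qed
    finally show "emeasure \<mu> A * emeasure \<nu> B = emeasure (distr P borel (standardize \<Sigma> \<beta>)) (A \<times> B)" by simp
  qed
  then show "distr P borel (standardize \<Sigma> \<beta>) = \<mu> \<Otimes>\<^sub>M \<nu>" by simp
qed

text \<open>The trial pair \<open>(\<beta>', C)\<close> acts on standardized data through \<open>\<beta>' - \<beta>\<close> and a quadratic form \<open>T\<close>.\<close>

lemma mahalanobis_standardize:
  fixes s :: "('k::finite, 'q::finite) obs" and \<Sigma> C :: "real^'k^'k" and \<beta> \<beta>' :: "real^'q" and \<sigma> :: real
  assumes \<Sigma>: "\<Sigma> \<in> PDS" and \<sigma>: "0 < \<sigma>"
  defines "T \<equiv> (1 / \<sigma>\<^sup>2) *\<^sub>R (pd_sqrt \<Sigma> ** matrix_inv C ** pd_sqrt \<Sigma>)"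
    and "r \<equiv> fst (standardize \<Sigma> \<beta> s) - snd (standardize \<Sigma> \<beta> s) *v (\<beta>' - \<beta>)"
  shows "mahalanobis \<beta>' C s / \<sigma> = sqrt (r \<bullet> (T *v r))"
proof -
  let ?S = "pd_sqrt \<Sigma>" and ?y = "fst s - snd s *v \<beta>'"
  have r: "r = inv_sqrt \<Sigma> *v ?y"
    by (simp add: r_def standardize_def matrix_vector_mul_assoc[symmetric] mv.diff_right)
  then have Sr: "?S *v r = ?y" by (simp add: matrix_vector_mul_assoc inv_sqrt_right[OF \<Sigma>])
  have "r \<bullet> (T *v r) = (1 / \<sigma>\<^sup>2) * (r \<bullet> (?S *v (matrix_inv C *v (?S *v r))))"
    by (simp add: T_def mv.scaleR_left matrix_vector_mul_assoc matrix_mul_assoc)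
  also have "r \<bullet> (?S *v (matrix_inv C *v (?S *v r))) = (?S *v r) \<bullet> (matrix_inv C *v (?S *v r))"
    by (rule inner_symmetric_matrix[OF PDS_sym[OF pd_sqrt_PDS[OF \<Sigma>]], symmetric])
  finally have "r \<bullet> (T *v r) = (?y \<bullet> (matrix_inv C *v ?y)) / \<sigma>\<^sup>2" by (simp add: Sr)
  then show ?thesis
    using \<sigma> by (simp add: mahalanobis_def case_prod_beta real_sqrt_divide)
qed

section \<open>Curves of matrices with determinant one\<close>

lemma PDS_congruence:
  fixes A S :: "real^'k^'k" assumes "A \<in> PDS" "S \<in> PDS" shows "S ** A ** S \<in> PDS"
proof -
  note sym = PDS_sym[OF assms(2)]
  have "transpose (S ** A ** S) = S ** A ** S"
    by (simp add: matrix_transpose_mul PDS_sym[OF assms(1)] sym matrix_mul_assoc)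
  moreover have "0 < x \<bullet> ((S ** A ** S) *v x)" if "x \<noteq> 0" for x
  proof -
    have "S *v x \<noteq> 0" using PDS_pos[OF assms(2) that] by auto
    then have "0 < (S *v x) \<bullet> (A *v (S *v x))" by (rule PDS_pos[OF assms(1)])
    then show ?thesis
      by (simp add: inner_symmetric_matrix[OF sym] matrix_vector_mul_assoc matrix_mul_assoc)
  qed
  ultimately show ?thesis by (simp add: PDS_def)
qed

lemma det_scaleR_matrix: fixes A :: "real^'k^'k" shows "det (c *\<^sub>R A) = c ^ CARD('k) * det A"
proof -
  have "c *\<^sub>R A = matrix ((*\<^sub>R) c) ** A"
    by (simp add: matrix_scaleR vec_eq_iff matrix_matrix_mult_def mat_def if_distrib if_distribR cong: if_cong)
  then show ?thesis by (simp add: det_mul)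
qed

definition linear_structure :: "('l::finite \<Rightarrow> real^'k^'k) \<Rightarrow> real^'l \<Rightarrow> real^'k^'k" where
  "linear_structure L \<theta> = (\<Sum>j\<in>UNIV. \<theta> $ j *\<^sub>R L j)"

lemma bounded_linear_linear_structure: "bounded_linear (linear_structure L)"
  unfolding linear_conv_bounded_linear[symmetric]
  by (rule linearI) (simp_all add: linear_structure_def sum.distrib scaleR_add_left scaleR_sum_right)

lemma linear_structure_axis: "linear_structure L (axis j 1) = L j"
proof -
  have "linear_structure L (axis j 1) = (\<Sum>i\<in>UNIV. if i = j then L j else 0)"
    unfolding linear_structure_def by (rule sum.cong) (auto simp: axis_def)
  then show ?thesis by simp
qed

text \<open>Rescaling a line to determinant one keeps it inside the linear structure and replaces the
  constrained problem by an unconstrained one in the line parameter.\<close>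

lemma normalized_line:
  fixes L :: "'l::finite \<Rightarrow> real^'k^'k" and \<theta> :: "real^'l" and j :: 'l
  defines "D \<equiv> \<lambda>t. det (linear_structure L (\<theta> + t *\<^sub>R axis j 1))"
  defines "c \<equiv> \<lambda>t. (D t powr (- 1 / CARD('k))) *\<^sub>R (\<theta> + t *\<^sub>R axis j 1)"
  assumes PD: "linear_structure L \<theta> \<in> PDS" and det1: "det (linear_structure L \<theta>) = 1"
  shows "c 0 = \<theta>" and "(c \<longlongrightarrow> \<theta>) (at 0)"
    and "\<forall>\<^sub>F t in nhds 0. det (linear_structure L (c t)) = 1"
    and "((\<lambda>t. linear_structure L (c t)) has_vector_derivative
      (L j - (trace (matrix_inv (linear_structure L \<theta>) ** L j) / CARD('k)) *\<^sub>R linear_structure L \<theta>)) (at 0)"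
proof -
  let ?V = "linear_structure L" and ?k = "real CARD('k)"
  interpret V: bounded_linear ?V by (rule bounded_linear_linear_structure)
  have D0: "D 0 = 1" by (simp add: D_def det1)
  show c0: "c 0 = \<theta>" by (simp add: c_def D0)
  have line: "((\<lambda>t. ?V (\<theta> + t *\<^sub>R axis j 1)) has_vector_derivative L j) (at t)" for t
    unfolding V.add V.scaleR linear_structure_axis by (auto intro!: derivative_eq_intros)
  have dV: "(det has_derivative (\<lambda>H. det (?V \<theta>) * trace (matrix_inv (?V \<theta>) ** H))) (at (?V (\<theta> + 0 *\<^sub>R axis j 1)))"
    using det_has_derivative[OF PDS_invertible[OF PD]] by simp
  have "(D has_derivative (\<lambda>h. det (?V \<theta>) * trace (matrix_inv (?V \<theta>) ** (h *\<^sub>R L j)))) (at 0)"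
    unfolding D_def by (rule has_derivative_compose[OF line[unfolded has_vector_derivative_def] dV])
  then have dD: "(D has_real_derivative trace (matrix_inv (?V \<theta>) ** L j)) (at 0)"
    unfolding has_field_derivative_def
    by (simp add: det1 mm.scaleR_right trace_scaleR mult.commute[of _ "trace _"])
  have dp: "((\<lambda>t. D t powr (- 1 / ?k)) has_real_derivative - (trace (matrix_inv (?V \<theta>) ** L j) / ?k)) (at 0)"
    by (rule DERIV_cong[OF DERIV_fun_powr[where r="- 1 / ?k", OF dD]]) (simp_all add: D0)
  have "(c has_vector_derivative (D 0 powr (- 1 / ?k)) *\<^sub>R axis j 1 + (- (trace (matrix_inv (?V \<theta>) ** L j) / ?k)) *\<^sub>R (\<theta> + 0 *\<^sub>R axis j 1)) (at 0)"
    unfolding c_def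
    by (rule has_vector_derivative_scaleR[OF dp]) (auto intro!: derivative_eq_intros)
  then have dc: "(c has_vector_derivative axis j 1 - (trace (matrix_inv (?V \<theta>) ** L j) / ?k) *\<^sub>R \<theta>) (at 0)"
    by (simp add: D0)
  show "(c \<longlongrightarrow> \<theta>) (at 0)"
    using has_vector_derivative_continuous[OF dc] by (simp add: continuous_within c0)
  from bounded_linear.has_vector_derivative[OF bounded_linear_linear_structure[of L] dc]
  show "((\<lambda>t. ?V (c t)) has_vector_derivative (L j - (trace (matrix_inv (?V \<theta>) ** L j) / ?k) *\<^sub>R ?V \<theta>)) (at 0)"
    by (simp only: V.diff V.scaleR linear_structure_axis)
  have "isCont D 0" using dD by (rule DERIV_isCont)
  then have "\<forall>\<^sub>F t in at 0. 0 < D t" using D0 by (intro order_tendstoD(1)[of D "D 0"]) (auto simp: isCont_def)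
  then have "\<forall>\<^sub>F t in nhds 0. 0 < D t" using D0 by (auto simp: eventually_at_filter elim: eventually_mono)
  then show "\<forall>\<^sub>F t in nhds 0. det (?V (c t)) = 1"
  proof eventually_elim
    case (elim t)
    have "(D t powr (- 1 / ?k)) ^ CARD('k) = D t powr (real CARD('k) * (- 1 / ?k))"
      using elim by (simp add: powr_power)
    also have "\<dots> = 1 / D t" using elim by (simp add: powr_minus_divide)
    finally show ?case using elim by (simp add: c_def V.scaleR det_scaleR_matrix D_def)
  qed
qed

section \<open>The sensitivity constants\<close>

context standardized_model
begin

lemma measurable_derivatives [measurable]:
  "deriv \<rho> \<in> borel_measurable borel" "deriv (deriv \<rho>) \<in> borel_measurable borel"
  by (rule borel_measurable_continuous_onI[OF continuous_deriv_rho],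
      rule borel_measurable_continuous_onI[OF continuous_deriv2])

lemma alpha_eq:
  assumes c: "0 < c"
  shows "(\<integral>z. (1 - 1 / CARD('k)) * (deriv \<rho> (c * norm z) / (c * norm z))
       + 1 / CARD('k) * deriv (deriv \<rho>) (c * norm z) \<partial>\<mu>) = \<alpha> (c\<^sup>2)"
proof -
  have c2: "0 < c\<^sup>2" using c by simp
  have pt: "(1 - 1 / CARD('k)) * (deriv \<rho> (c * norm z) / (c * norm z)) + 1 / CARD('k) * deriv (deriv \<rho>) (c * norm z)
    = w (c\<^sup>2 * (norm z)\<^sup>2) + 2 * c\<^sup>2 / CARD('k) * (\<kappa> (c\<^sup>2 * (norm z)\<^sup>2) * (norm z)\<^sup>2)" if "z \<noteq> 0" for z
  proof -
    define s where "s = c * norm z"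
    have s: "0 < s" using c that by (simp add: s_def)
    have q: "c\<^sup>2 * (norm z)\<^sup>2 = s\<^sup>2" by (simp add: s_def power_mult_distrib)
    have rt: "sqrt (s\<^sup>2) = s" using s by simp
    have ws: "w (s\<^sup>2) = deriv \<rho> s / s" using s by (simp add: w_def u_fun_def)
    have "2 * s\<^sup>2 * \<kappa> (s\<^sup>2) = deriv (deriv \<rho>) s - u_fun \<rho> (sqrt (s\<^sup>2))" using two_q_kappa[of "s\<^sup>2"] s by simp
    then have k: "2 * s\<^sup>2 * \<kappa> (s\<^sup>2) = deriv (deriv \<rho>) s - deriv \<rho> s / s" using s by (simp add: u_fun_def)
    have "2 * c\<^sup>2 / CARD('k) * (\<kappa> (s\<^sup>2) * (norm z)\<^sup>2) = (2 * (c\<^sup>2 * (norm z)\<^sup>2) * \<kappa> (s\<^sup>2)) / CARD('k)"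
      by (simp add: mult_ac)
    also have "\<dots> = (deriv (deriv \<rho>) s - deriv \<rho> s / s) / CARD('k)" unfolding q k ..
    finally show ?thesis unfolding q ws s_def[symmetric] by (simp add: diff_divide_distrib algebra_simps)
  qed
  have "(\<integral>z. (1 - 1 / CARD('k)) * (deriv \<rho> (c * norm z) / (c * norm z))
       + 1 / CARD('k) * deriv (deriv \<rho>) (c * norm z) \<partial>\<mu>)
    = (\<integral>z. w (c\<^sup>2 * (norm z)\<^sup>2) + 2 * c\<^sup>2 / CARD('k) * (\<kappa> (c\<^sup>2 * (norm z)\<^sup>2) * (norm z)\<^sup>2) \<partial>\<mu>)"
  proof (rule integral_cong_AE)
    show "AE z in \<mu>. (1 - 1 / CARD('k)) * (deriv \<rho> (c * norm z) / (c * norm z)) + 1 / CARD('k) * deriv (deriv \<rho>) (c * norm z)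
      = w (c\<^sup>2 * (norm z)\<^sup>2) + 2 * c\<^sup>2 / CARD('k) * (\<kappa> (c\<^sup>2 * (norm z)\<^sup>2) * (norm z)\<^sup>2)"
      using AE_nonzero by eventually_elim (rule pt)
  qed measurable
  also have "\<dots> = \<alpha> (c\<^sup>2)"
    using integrable_w_radial[OF c2, of 0] integrable_kappa_radial[OF c2, of 0]
    by (simp add: \<alpha>_def Bochner_Integration.integral_add)
  finally show ?thesis .
qed

lemma gamma_eq:
  assumes c: "0 < c"
  shows "(\<integral>z. deriv (deriv \<rho>) (c * norm z) * (c * norm z)\<^sup>2
       + (CARD('k) + 1) * deriv \<rho> (c * norm z) * (c * norm z) \<partial>\<mu>) / (CARD('k) + 2) = \<gamma>c (c\<^sup>2)"
proof -
  have c2: "0 < c\<^sup>2" using c by simp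
  let ?k = "real CARD('k)"
  have pt: "deriv (deriv \<rho>) (c * norm z) * (c * norm z)\<^sup>2 + (CARD('k) + 1) * deriv \<rho> (c * norm z) * (c * norm z)
    = (?k + 2) * c\<^sup>2 * (w (c\<^sup>2 * (norm z)\<^sup>2) * (norm z)\<^sup>2) + 2 * (c\<^sup>2)\<^sup>2 * (\<kappa> (c\<^sup>2 * (norm z)\<^sup>2) * norm z ^ 4)" for z
  proof -
    define s where "s = c * norm z"
    have s: "0 \<le> s" using c by (simp add: s_def)
    have q: "c\<^sup>2 * (norm z)\<^sup>2 = s\<^sup>2" by (simp add: s_def power_mult_distrib)
    have ws: "w (s\<^sup>2) = u_fun \<rho> s" using s by (simp add: w_def)
    have k: "2 * \<kappa> (s\<^sup>2) * s\<^sup>2 * s\<^sup>2 = (deriv (deriv \<rho>) s - u_fun \<rho> s) * s\<^sup>2"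
    proof (cases "s = 0")
      case False
      then have "2 * s\<^sup>2 * \<kappa> (s\<^sup>2) = deriv (deriv \<rho>) s - u_fun \<rho> s" using two_q_kappa[of "s\<^sup>2"] s by simp
      then show ?thesis by (simp add: mult_ac)
    qed simp
    have 1: "(?k + 2) * c\<^sup>2 * (w (s\<^sup>2) * (norm z)\<^sup>2) = (?k + 2) * u_fun \<rho> s * (c\<^sup>2 * (norm z)\<^sup>2)"
      unfolding ws by (simp add: mult_ac)
    have 2: "2 * (c\<^sup>2)\<^sup>2 * (\<kappa> (s\<^sup>2) * norm z ^ 4) = 2 * \<kappa> (s\<^sup>2) * (c\<^sup>2 * (norm z)\<^sup>2) * (c\<^sup>2 * (norm z)\<^sup>2)"
      by (simp add: power2_eq_square power4_eq_xxxx mult_ac)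
    show ?thesis
      unfolding q 1 2 k s_def[symmetric] deriv_rho_eq by (simp add: power2_eq_square algebra_simps)
  qed
  have w: "integrable \<mu> (\<lambda>z. w (c\<^sup>2 * (norm z)\<^sup>2) * (norm z)\<^sup>2)" by (rule integrable_w_radial[OF c2])
  have k: "integrable \<mu> (\<lambda>z. \<kappa> (c\<^sup>2 * (norm z)\<^sup>2) * norm z ^ 4)"
    using integrable_kappa_radial[OF c2, of 2] by (simp add: power2_eq_square power4_eq_xxxx mult_ac)
  have "(\<integral>z. deriv (deriv \<rho>) (c * norm z) * (c * norm z)\<^sup>2 + (CARD('k) + 1) * deriv \<rho> (c * norm z) * (c * norm z) \<partial>\<mu>)
    = (?k + 2) * c\<^sup>2 * (\<integral>z. w (c\<^sup>2 * (norm z)\<^sup>2) * (norm z)\<^sup>2 \<partial>\<mu>)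
      + 2 * (c\<^sup>2)\<^sup>2 * (\<integral>z. \<kappa> (c\<^sup>2 * (norm z)\<^sup>2) * norm z ^ 4 \<partial>\<mu>)"
    unfolding pt using w k by (subst Bochner_Integration.integral_add) auto
  also have "\<dots> / (?k + 2) = \<gamma>c (c\<^sup>2)"
  proof -
    have "?k + 2 \<noteq> 0" by (simp add: add_nonneg_eq_0_iff)
    then show ?thesis by (simp add: \<gamma>c_def add_divide_distrib)
  qed
  finally show ?thesis by (simp add: add.commute)
qed

end

section \<open>Variation of the shape in standardized coordinates\<close>

text \<open>Along a line rescaled to determinant one, the form \<open>T\<close> of the standardized residuals moves in the
  direction \<open>k T Lt T - tr (T Lt) T\<close>, up to a factor.  This direction is the test matrix of the
  stationarity equation for the shape; scaling \<open>T\<close> itself is not possible under the determinant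
  constraint, which explains the trace correction.\<close>

lemma standardized_direction:
  fixes A V L S H :: "real^'k^'k" and \<sigma> :: real
  assumes AV: "A ** V = mat 1" and HS: "H ** S = mat 1" and SH: "S ** H = mat 1" and \<sigma>: "\<sigma> \<noteq> 0"
  defines "T \<equiv> (1 / \<sigma>\<^sup>2) *\<^sub>R (S ** A ** S)" and "Lt \<equiv> H ** L ** H"
  shows "(1 / \<sigma>\<^sup>2) *\<^sub>R (S ** (- (A ** (L - (trace (A ** L) / CARD('k)) *\<^sub>R V) ** A)) ** S)
    = (- (\<sigma>\<^sup>2 / CARD('k))) *\<^sub>R (real CARD('k) *\<^sub>R (T ** Lt ** T) - trace (T ** Lt) *\<^sub>R T)"
proof -
  let ?k = "real CARD('k)"
  have SHL: "S ** (H ** M) = M" for M :: "real^'k^'k" by (simp add: matrix_mul_assoc SH)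
  have HSL: "H ** (S ** M) = M" for M :: "real^'k^'k" by (simp add: matrix_mul_assoc HS)
  have TLT: "T ** Lt ** T = (1 / \<sigma>\<^sup>2 / \<sigma>\<^sup>2) *\<^sub>R (S ** A ** L ** A ** S)"
    by (simp add: T_def Lt_def mm.scaleR_left mm.scaleR_right matrix_mul_assoc[symmetric] SHL HSL)
  have "trace (S ** A ** S ** (H ** L ** H)) = trace (A ** L)"
  proof -
    have "S ** A ** S ** (H ** L ** H) = S ** (A ** L ** H)" by (simp add: matrix_mul_assoc[symmetric] SHL)
    then have "trace (S ** A ** S ** (H ** L ** H)) = trace (A ** L ** H ** S)"
      by (simp only: trace_mul_sym[of S "A ** L ** H"])
    also have "A ** L ** H ** S = A ** L" by (simp add: matrix_mul_assoc[symmetric] HS)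
    finally show ?thesis .
  qed
  then have trT: "trace (T ** Lt) = trace (A ** L) / \<sigma>\<^sup>2"
    by (simp add: T_def Lt_def mm.scaleR_left trace_scaleR)
  have AVA: "A ** V ** A = A" by (simp add: AV)
  have mid: "A ** (L - (trace (A ** L) / ?k) *\<^sub>R V) ** A = A ** L ** A - (trace (A ** L) / ?k) *\<^sub>R A"
    by (simp add: mm.diff_left mm.diff_right mm.scaleR_left mm.scaleR_right AVA)
  then have lhs: "(1 / \<sigma>\<^sup>2) *\<^sub>R (S ** (- (A ** (L - (trace (A ** L) / ?k) *\<^sub>R V) ** A)) ** S)
    = - ((1 / \<sigma>\<^sup>2) *\<^sub>R (S ** A ** L ** A ** S)) + (trace (A ** L) / ?k) *\<^sub>R T"
    unfolding mid
    by (simp add: mm.minus_left mm.minus_right mm.diff_left mm.diff_right mm.scaleR_left mm.scaleR_right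
        T_def matrix_mul_assoc algebra_simps)
  have "(- (\<sigma>\<^sup>2 / ?k)) *\<^sub>R (?k *\<^sub>R (T ** Lt ** T) - trace (T ** Lt) *\<^sub>R T)
    = - (\<sigma>\<^sup>2 *\<^sub>R (T ** Lt ** T)) + (\<sigma>\<^sup>2 * trace (T ** Lt) / ?k) *\<^sub>R T"
    by (simp add: scaleR_diff_right)
  also have "\<dots> = - ((1 / \<sigma>\<^sup>2) *\<^sub>R (S ** A ** L ** A ** S)) + (trace (A ** L) / ?k) *\<^sub>R T"
  proof -
    have cancel: "p * (1 / p / p) = 1 / p" "p * (x / p) = x" if "p \<noteq> 0" for p x :: real
      using that by simp_all
    note cancel = cancel[OF power_not_zero[OF \<sigma>]]
    show ?thesis unfolding TLT trT scaleR_scaleR cancel ..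
  qed
  finally show ?thesis unfolding lhs by simp
qed

section \<open>The influence functions\<close>

lemma borel_measurable_transfer_sets:
  assumes "sets M = sets borel" and "f \<in> borel_measurable borel"
  shows "f \<in> borel_measurable M"
  using assms(2) by (simp add: measurable_cong_sets[OF assms(1) refl])

theorem theorem6:
  fixes P :: "('k::finite, 'q::finite) obs measure"
    and \<Theta> :: "(real ^ 'l) set"
    and V :: "real ^ 'l \<Rightarrow> real ^ 'k ^ 'k"
    and L :: "'l \<Rightarrow> real ^ 'k ^ 'k"
    and m \<rho>0 \<rho>1 :: "real \<Rightarrow> real" and b0 :: real
    and \<beta>0 \<beta>1 :: "('k, 'q) obs measure \<Rightarrow> real ^ 'q"
    and \<theta>0 \<gamma> :: "('k, 'q) obs measure \<Rightarrow> real ^ 'l"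
    and \<sigma> :: "('k, 'q) obs measure \<Rightarrow> real"
    and \<beta>s :: "real ^ 'q" and \<theta>s :: "real ^ 'l"
    and y0 :: "real ^ 'k" and X0 :: "real ^ 'q ^ 'k"
  defines "\<Sigma> \<equiv> V \<theta>s"
  defines "\<Sigma>i \<equiv> matrix_inv \<Sigma>" and "\<Sigma>h \<equiv> inv_sqrt \<Sigma>"
  defines "c\<sigma> \<equiv> det \<Sigma> powr (1 / (2 * CARD('k))) / \<sigma> P"
  defines "z0 \<equiv> \<Sigma>h *v (y0 - X0 *v \<beta>s)"
  defines "\<alpha>\<^sub>1 \<equiv> alpha1 TYPE('k) m \<rho>1 c\<sigma>" and "\<gamma>\<^sub>1 \<equiv> gamma1 TYPE('k) m \<rho>1 c\<sigma>"
  defines "Lm \<equiv> vectorized_columns L"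
  defines "Ph \<equiv> contaminated P (y0, X0)"
  assumes P: "prob_space P" "sets P = sets borel"
    and V: "V ` \<Theta> \<subseteq> PDS" "inj_on V \<Theta>" "C2_on V \<Theta>"
    and L: "\<And>j. transpose (L j) = L j"
    and linear: "\<And>\<theta>. \<theta> \<in> \<Theta> \<Longrightarrow> V \<theta> = (\<Sum>j\<in>UNIV. \<theta> $ j *\<^sub>R L j)"
    and \<rho>0: "\<And>s. 0 \<le> \<rho>0 s" "0 < b0" "ereal b0 < (SUP s. ereal (\<rho>0 s))"
    and \<rho>1: "\<And>s. 0 \<le> \<rho>1 s"
      "\<exists>c1>0. mono_on {0..c1} \<rho>1 \<and> (\<forall>s\<ge>c1. \<rho>1 s = \<rho>1 c1)"
      "C2_on \<rho>1 UNIV" "continuous_on UNIV (u_fun \<rho>1)"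
    and m: "\<And>t. 0 \<le> t \<Longrightarrow> 0 \<le> m t"
    and \<theta>s: "\<theta>s \<in> \<Theta>"
    and elliptical: "has_conditional_density P (\<lambda>X. elliptical_density m (X *v \<beta>s) \<Sigma>)"
    and moment: "integrable P (\<lambda>(y, X). (norm X)\<^sup>2)"
    and initial: "\<theta>0 P \<in> \<Theta>" "\<forall>\<^sub>F h in at_right 0. \<theta>0 (Ph h) \<in> \<Theta>"
    and scale: "scale_solution \<rho>0 b0 V \<beta>0 \<theta>0 P (\<sigma> P)"
      "\<forall>\<^sub>F h in at_right 0. scale_solution \<rho>0 b0 V \<beta>0 \<theta>0 (Ph h) (\<sigma> (Ph h))"
    and local_min: "R_local_min \<rho>1 V \<Theta> P (\<sigma> P) (\<beta>1 P, \<gamma> P)"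
      "\<forall>\<^sub>F h in at_right 0. R_local_min \<rho>1 V \<Theta> (Ph h) (\<sigma> (Ph h)) (\<beta>1 (Ph h), \<gamma> (Ph h))"
    and at_P: "\<beta>1 P = \<beta>s" "V (\<gamma> P) = det_normalized \<Sigma>"
    and conv: "((\<lambda>h. ((\<beta>1 (Ph h), \<gamma> (Ph h)), \<sigma> (Ph h)))
                 \<longlongrightarrow> ((\<beta>1 P, \<gamma> P), \<sigma> P)) (at_right 0)"
    and \<alpha>1: "\<alpha>\<^sub>1 \<noteq> 0"
    and full_rank: "AE s in P. rank (snd s) = CARD('q)"
  shows "has_influence \<beta>1 P (y0, X0)
           ((u_fun \<rho>1 (c\<sigma> * norm z0) / \<alpha>\<^sub>1) *\<^sub>R
             (matrix_inv (\<integral>s. transpose (snd s) ** \<Sigma>i ** snd s \<partial>P)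
               *v (transpose X0 *v (\<Sigma>h *v z0))))
       \<and> ((\<exists>d. has_influence \<sigma> P (y0, X0) d) \<longrightarrow> \<gamma>\<^sub>1 > 0 \<longrightarrow> rank Lm = CARD('l) \<longrightarrow>
           \<gamma> P \<in> interior \<Theta> \<longrightarrow>
           has_influence \<gamma> P (y0, X0)
             ((CARD('k) * u_fun \<rho>1 (c\<sigma> * norm z0) / ((\<sigma> P)\<^sup>2 * \<gamma>\<^sub>1)) *\<^sub>R
                (matrix_inv (transpose Lm ** kronecker \<Sigma>i \<Sigma>i ** Lm)
                  *v (transpose Lm *v (kronecker \<Sigma>h \<Sigma>h *v vectorize (outer z0))))
              - (v_fun \<rho>1 (c\<sigma> * norm z0) / (det \<Sigma> powr (1 / CARD('k)) * \<gamma>\<^sub>1)) *\<^sub>R \<theta>s))"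
proof -
  let ?\<phi> = "standardize \<Sigma> \<beta>s" and ?k = "real CARD('k)"
  have \<Sigma>: "\<Sigma> \<in> PDS" using V(1) \<theta>s by (auto simp: \<Sigma>_def)
  note rt = inv_sqrt_facts[OF \<Sigma>, folded \<Sigma>h_def \<Sigma>i_def]
  define S where "S = pd_sqrt \<Sigma>"
  have S: "S \<in> PDS" unfolding S_def by (rule pd_sqrt_PDS[OF \<Sigma>])
  have HS: "\<Sigma>h ** S = mat 1" and SH: "S ** \<Sigma>h = mat 1" using rt(1,2) by (simp_all add: S_def)
  have symH: "transpose \<Sigma>h = \<Sigma>h" by (rule PDS_sym[OF rt(3)])
  obtain c1 where c1: "0 < c1" "\<And>s. c1 \<le> s \<Longrightarrow> \<rho>1 s = \<rho>1 c1" using \<rho>1(2) by auto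
  interpret loss: redescending_loss \<rho>1 c1
    by unfold_locales (fact c1 \<rho>1(3,4))+
  interpret PP: prob_space P by (rule P(1))
  note meP = borel_measurable_transfer_sets[OF P(2)]
  define \<mu> where "\<mu> = density lborel (\<lambda>z :: real^'k. ennreal (elliptical_density m 0 (mat 1) z))"
  define \<nu> where "\<nu> = distr P borel (\<lambda>s. \<Sigma>h ** snd s)"
  note law = standardized_law[OF P \<Sigma> elliptical, folded \<Sigma>h_def, folded \<mu>_def \<nu>_def]
  have snd_meas: "(\<lambda>s :: ('k, 'q) obs. \<Sigma>h ** snd s) \<in> borel_measurable borel"
    by (intro borel_measurable_continuous_onI continuous_intros mm.continuous_on)
  obtain KH where KH: "0 \<le> KH" "\<And>X :: real^'q^'k. norm (\<Sigma>h ** X) \<le> KH * norm X"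
  proof -
    obtain K where K: "0 \<le> K" "\<And>(a :: real^'k^'k) (b :: real^'q^'k). norm (a ** b) \<le> norm a * norm b * K"
      using mm.nonneg_bounded by blast
    show thesis by (rule that[of "norm \<Sigma>h * K"]) (use K(1) K(2)[of \<Sigma>h] in \<open>simp_all add: mult_ac\<close>)
  qed
  have moment': "integrable P (\<lambda>s. (norm (snd s))\<^sup>2)" using moment by (simp add: case_prod_unfold)
  have momH: "integrable P (\<lambda>s. (norm (\<Sigma>h ** snd s))\<^sup>2)"
  proof (rule Bochner_Integration.integrable_bound[OF integrable_mult_right[OF moment', of "KH\<^sup>2"]])
    show "(\<lambda>s. (norm (\<Sigma>h ** snd s))\<^sup>2) \<in> borel_measurable P"
      by (intro meP borel_measurable_continuous_onI continuous_intros mm.continuous_on)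
    show "AE s in P. norm ((norm (\<Sigma>h ** snd s))\<^sup>2) \<le> norm (KH\<^sup>2 * (norm (snd s))\<^sup>2)"
    proof (rule AE_I2)
      fix s :: "('k, 'q) obs"
      have "(norm (\<Sigma>h ** snd s))\<^sup>2 \<le> (KH * norm (snd s))\<^sup>2" using KH(2) by (intro power_mono) auto
      then show "norm ((norm (\<Sigma>h ** snd s))\<^sup>2) \<le> norm (KH\<^sup>2 * (norm (snd s))\<^sup>2)" by (simp add: power_mult_distrib)
    qed
  qed
  interpret sm: standardized_model \<rho>1 c1 \<mu> \<nu>
  proof (intro standardized_model.intro standardized_model_axioms.intro)
    show "redescending_loss \<rho>1 c1" by unfold_locales
    show "spherical_law \<mu>" "prob_space \<nu>" by (rule law(1), rule law(2))
    show "sets \<nu> = sets borel" by (simp add: \<nu>_def)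
    show "integrable \<nu> (\<lambda>X. (norm X)\<^sup>2)"
      unfolding \<nu>_def by (subst integrable_distr_eq) (auto intro: meP snd_meas momH)
  qed
  \<comment> \<open>In standardized coordinates the estimates at \<open>Ph h\<close> are the error \<open>\<delta> h\<close> and the form \<open>T h\<close>; at \<open>P\<close> they
    are \<open>0\<close> and \<open>g\<close> times the identity.\<close>
  define \<delta> where "\<delta> h = \<beta>1 (Ph h) - \<beta>s" for h
  define A where "A h = matrix_inv (V (\<gamma> (Ph h)))" for h
  define T where "T h = (1 / (\<sigma> (Ph h))\<^sup>2) *\<^sub>R (S ** A h ** S)" for h
  define a where "a = det \<Sigma> powr (1 / ?k)"
  define g where "g = c\<sigma>\<^sup>2"
  have \<sigma>P: "0 < \<sigma> P" using scale(1) by (simp add: scale_solution_def)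
  have a: "0 < a" using PDS_det_pos[OF \<Sigma>] by (simp add: a_def)
  have c\<sigma>: "0 < c\<sigma>" using PDS_det_pos[OF \<Sigma>] \<sigma>P by (simp add: c\<sigma>_def)
  have g: "0 < g" using c\<sigma> by (simp add: g_def)
  have ga: "g = a / (\<sigma> P)\<^sup>2"
  proof -
    have "(det \<Sigma> powr (1 / (2 * ?k)))\<^sup>2 = a"
      by (simp add: a_def power2_eq_square flip: powr_add)
    then show ?thesis by (simp add: g_def c\<sigma>_def power_divide)
  qed
  have \<alpha>1g: "sm.\<alpha> g = \<alpha>\<^sub>1"
    using sm.alpha_eq[OF c\<sigma>] unfolding g_def \<alpha>\<^sub>1_def alpha1_def spherical_expectation_def \<mu>_def[symmetric] by (rule sym)
  have \<gamma>1g: "sm.\<gamma>c g = \<gamma>\<^sub>1"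
    using sm.gamma_eq[OF c\<sigma>] unfolding g_def \<gamma>\<^sub>1_def gamma1_def spherical_expectation_def \<mu>_def[symmetric] by (rule sym)

  \<comment> \<open>Since the law of the standardized data under \<open>P\<close> is a product, contaminated expectations reduce to it.\<close>
  have s0: "(y0, X0) \<in> space P" using sets_eq_imp_space_eq[OF P(2)] by simp
  have \<phi>P: "?\<phi> \<in> borel_measurable P" by (rule meP[OF measurable_standardize])
  have transfer: "(\<integral>s. F (?\<phi> s) \<partial>P) = (\<integral>s. F s \<partial>(\<mu> \<Otimes>\<^sub>M \<nu>))" if "F \<in> borel_measurable borel" for F :: "('k, 'q) obs \<Rightarrow> real"
    using integral_distr[OF \<phi>P that] by (simp add: law(3))
  have mix: "(\<integral>s. F (?\<phi> s) \<partial>Ph h) = (1 - h) * (\<integral>s. F s \<partial>(\<mu> \<Otimes>\<^sub>M \<nu>)) + h * F (?\<phi> (y0, X0))"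
    if F: "F \<in> borel_measurable borel" "integrable (\<mu> \<Otimes>\<^sub>M \<nu>) F" and h: "0 < h" "h < 1" for F :: "('k, 'q) obs \<Rightarrow> real" and h
  proof -
    have "integrable P (\<lambda>s. F (?\<phi> s))"
      using integrable_distr[OF \<phi>P] F(2) by (simp add: law(3))
    from integral_contaminated(2)[OF s0 _ _ this, of h] h show ?thesis
      unfolding Ph_def transfer[OF F(1)] by simp
  qed
  have sets_h: "sets (Ph h) = sets borel" if "0 < h" "h < 1" for h
    unfolding Ph_def using sets_contaminated[OF s0, of h] that P(2) by simp
  have fin_h: "finite_measure (Ph h)" if "0 < h" "h < 1" for h
    using prob_space_contaminated[OF P(1) s0, of h] that unfolding Ph_def by (simp add: prob_space.finite_measure)
  note me_h = borel_measurable_transfer_sets[OF sets_h]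
  have snd_phi: "snd (?\<phi> s) = \<Sigma>h ** snd s" for s by (simp add: standardize_def \<Sigma>h_def)
  have z0: "fst (?\<phi> (y0, X0)) = z0" by (simp add: standardize_def z0_def \<Sigma>h_def)
  have mom_h: "integrable (Ph h) (\<lambda>s. (norm (snd (?\<phi> s)))\<^sup>2)" if "0 < h" "h < 1" for h
    unfolding Ph_def snd_phi using that by (intro integrable_contaminated[OF s0] momH) auto

  have lim\<delta>: "(\<delta> \<longlongrightarrow> 0) (at_right 0)"
    using tendsto_fst[OF tendsto_fst[OF conv]] by (simp add: \<delta>_def[abs_def] at_P(1) LIM_zero_iff)
  have lim\<gamma>: "((\<lambda>h. \<gamma> (Ph h)) \<longlongrightarrow> \<gamma> P) (at_right 0)"
    using tendsto_snd[OF tendsto_fst[OF conv]] by simp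
  have lim\<sigma>: "((\<lambda>h. \<sigma> (Ph h)) \<longlongrightarrow> \<sigma> P) (at_right 0)"
    using tendsto_snd[OF conv] by simp
  have Vl: "V \<theta> = linear_structure L \<theta>" if "\<theta> \<in> \<Theta>" for \<theta>
    using linear[OF that] by (simp add: linear_structure_def)
  have dom: "\<theta> \<in> \<Theta>" "V \<theta> \<in> PDS" "det (V \<theta>) = 1" if "R_local_min \<rho>1 V \<Theta> Q s (\<beta>', \<theta>)" for Q s \<beta>' \<theta>
    using that by (auto simp: R_local_min_def local_min_on_def param_domain_def)
  note domP = dom[OF local_min(1)]
  have evdom: "\<forall>\<^sub>F h in at_right 0. \<gamma> (Ph h) \<in> \<Theta> \<and> V (\<gamma> (Ph h)) \<in> PDS"
    using local_min(2) by eventually_elim (use dom in blast)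
  have limV: "((\<lambda>h. V (\<gamma> (Ph h))) \<longlongrightarrow> V (\<gamma> P)) (at_right 0)"
  proof -
    have "((\<lambda>h. linear_structure L (\<gamma> (Ph h))) \<longlongrightarrow> linear_structure L (\<gamma> P)) (at_right 0)"
      by (rule bounded_linear.tendsto[OF bounded_linear_linear_structure lim\<gamma>])
    moreover have "\<forall>\<^sub>F h in at_right 0. linear_structure L (\<gamma> (Ph h)) = V (\<gamma> (Ph h))"
      using evdom by eventually_elim (simp add: Vl)
    ultimately show ?thesis unfolding Vl[OF domP(1)] by (rule Lim_transform_eventually)
  qed
  have V0: "V (\<gamma> P) = (1 / a) *\<^sub>R \<Sigma>" unfolding at_P(2) det_normalized_def a_def ..
  have A0: "matrix_inv (V (\<gamma> P)) = a *\<^sub>R \<Sigma>i"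
    unfolding V0 \<Sigma>i_def
    by (rule matrix_inv_eqI) (use a in \<open>simp add: mm.scaleR_left mm.scaleR_right matrix_inv_right[OF PDS_invertible[OF \<Sigma>]]\<close>)
  have "\<forall>\<^sub>F h in at_right 0. invertible (V (\<gamma> (Ph h)))"
    using evdom by eventually_elim (simp add: PDS_invertible)
  from tendsto_matrix_inv[OF limV domP(2) this]
  have limA: "(A \<longlongrightarrow> a *\<^sub>R \<Sigma>i) (at_right 0)" unfolding A0 A_def[abs_def] .
  have SiS: "S ** \<Sigma>i ** S = mat 1"
  proof -
    have "S ** \<Sigma>i ** S = (S ** \<Sigma>h) ** (\<Sigma>h ** S)" by (simp only: rt(4)[symmetric] matrix_mul_assoc)
    then show ?thesis by (simp add: SH HS)
  qed
  have limT: "(T \<longlongrightarrow> g *\<^sub>R mat 1) (at_right 0)"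
  proof -
    have "(T \<longlongrightarrow> (1 / (\<sigma> P)\<^sup>2) *\<^sub>R (S ** (a *\<^sub>R \<Sigma>i) ** S)) (at_right 0)"
      unfolding T_def[abs_def] using \<sigma>P by (intro tendsto_intros mm.tendsto lim\<sigma> limA) auto
    then show ?thesis by (simp add: mm.scaleR_left mm.scaleR_right SiS ga)
  qed
  have ev_low: "\<forall>\<^sub>F h in at_right 0. \<forall>x. g / 2 * (norm x)\<^sup>2 \<le> x \<bullet> (T h *v x)"
  proof (rule PDS_coercive_nearby[OF limT])
    show "g * (norm x)\<^sup>2 \<le> x \<bullet> ((g *\<^sub>R mat 1) *v x)" for x :: "real^'k"
      by (simp add: mv.scaleR_left power2_norm_eq_inner)
  qed (use g in simp)
  \<comment> \<open>What the hypotheses provide for all sufficiently small \<open>h\<close>; the constant \<open>g / 2\<close> leaves room below the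
    limit \<open>g\<close> so that one coercivity constant serves all of them.\<close>
  define good where "good h \<longleftrightarrow> h < 1 \<and> R_local_min \<rho>1 V \<Theta> (Ph h) (\<sigma> (Ph h)) (\<beta>1 (Ph h), \<gamma> (Ph h)) \<and>
    0 < \<sigma> (Ph h) \<and> (\<forall>x. g / 2 * (norm x)\<^sup>2 \<le> x \<bullet> (T h *v x))" for h
  have ev_good: "\<forall>\<^sub>F h in at_right 0. good h"
  proof -
    have "\<forall>\<^sub>F h in at_right 0. h < (1::real)" by (rule order_tendstoD(2)[OF tendsto_ident_at]) simp
    with local_min(2) scale(2) ev_low show ?thesis
      by eventually_elim (auto simp: good_def scale_solution_def)
  qed
  have T_PDS: "T h \<in> PDS" if "good h" for h
    using that dom(2) unfolding good_def T_def A_def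
    by (intro PDS_scaleR PDS_congruence PDS_inv S) auto
  note symT = PDS_sym[OF T_PDS]
  have crit: "R_crit \<rho>1 (Ph h) (\<sigma> (Ph h)) \<beta>' C
      = (\<integral>s. \<rho>1 (sqrt ((fst (?\<phi> s) - snd (?\<phi> s) *v (\<beta>' - \<beta>s)) \<bullet> (((1 / (\<sigma> (Ph h))\<^sup>2) *\<^sub>R (S ** matrix_inv C ** S)) *v
          (fst (?\<phi> s) - snd (?\<phi> s) *v (\<beta>' - \<beta>s))))) \<partial>Ph h)" if "good h" for h \<beta>' C
    using that unfolding R_crit_def good_def
    by (intro Bochner_Integration.integral_cong refl arg_cong[where f=\<rho>1])
      (simp only: mahalanobis_standardize[OF \<Sigma>] S_def)

  \<comment> \<open>The regression equation: the score integrates to zero under \<open>Ph h\<close>, a mixture of the law at \<open>P\<close> and a point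
    mass.\<close>
  define r where "r h s = sm.resid (\<delta> h) s" for h and s :: "('k, 'q) obs"
  define q where "q h s = r h s \<bullet> (T h *v r h s)" for h s
  have qw: "loss.w (q h s) = loss.w (sm.resid (\<delta> h) s \<bullet> (T h *v sm.resid (\<delta> h) s))" for h s by (simp add: q_def r_def)
  define score where "score h e s = loss.w (q h s) * ((snd s *v e) \<bullet> (T h *v r h s))" for h e s
  have score_meas: "score h e \<in> borel_measurable borel" for h e
    unfolding score_def[abs_def] q_def r_def by measurable
  have stat1: "(1 - h) * (\<integral>s. score h e s \<partial>(\<mu> \<Otimes>\<^sub>M \<nu>)) + h * score h e (?\<phi> (y0, X0)) = 0"
    if h: "0 < h" "good h" for h e
  proof -
    have h1: "h < 1" and lm: "R_local_min \<rho>1 V \<Theta> (Ph h) (\<sigma> (Ph h)) (\<beta>1 (Ph h), \<gamma> (Ph h))"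
      and low: "\<And>x. g / 2 * (norm x)\<^sup>2 \<le> x \<bullet> (T h *v x)" using h(2) by (auto simp: good_def)
    have "\<forall>\<^sub>F t in at 0. (case (\<beta>1 (Ph h), \<gamma> (Ph h)) of (\<beta>, \<gamma>) \<Rightarrow> R_crit \<rho>1 (Ph h) (\<sigma> (Ph h)) \<beta> (V \<gamma>))
      \<le> (case (\<beta>1 (Ph h) + t *\<^sub>R e, \<gamma> (Ph h)) of (\<beta>, \<gamma>) \<Rightarrow> R_crit \<rho>1 (Ph h) (\<sigma> (Ph h)) \<beta> (V \<gamma>))"
    proof (rule eventually_local_min_along_curve[OF lm[unfolded R_local_min_def]])
      have "((\<lambda>t. (\<beta>1 (Ph h) + t *\<^sub>R e, \<gamma> (Ph h))) \<longlongrightarrow> (\<beta>1 (Ph h) + 0 *\<^sub>R e, \<gamma> (Ph h))) (at (0::real))"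
        by (intro tendsto_intros)
      then show "((\<lambda>t. (\<beta>1 (Ph h) + t *\<^sub>R e, \<gamma> (Ph h))) \<longlongrightarrow> (\<beta>1 (Ph h), \<gamma> (Ph h))) (at (0::real))" by simp
      show "\<forall>\<^sub>F t in at 0. (\<beta>1 (Ph h) + t *\<^sub>R e, \<gamma> (Ph h)) \<in> param_domain V \<Theta>"
        using dom[OF lm] by (simp add: param_domain_def)
    qed
    then have min: "\<forall>\<^sub>F t in at 0. (\<integral>s. \<rho>1 (sqrt ((fst (?\<phi> s) - snd (?\<phi> s) *v \<delta> h) \<bullet> (T h *v (fst (?\<phi> s) - snd (?\<phi> s) *v \<delta> h)))) \<partial>Ph h)
      \<le> (\<integral>s. \<rho>1 (sqrt ((fst (?\<phi> s) - snd (?\<phi> s) *v (\<delta> h + t *\<^sub>R e)) \<bullet> (T h *v (fst (?\<phi> s) - snd (?\<phi> s) *v (\<delta> h + t *\<^sub>R e))))) \<partial>Ph h)"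
      by (simp add: crit[OF h(2)] T_def A_def \<delta>_def algebra_simps)
    have "(\<integral>s. score h e (?\<phi> s) \<partial>Ph h) = 0"
      unfolding score_def q_def r_def sm.resid_def
      by (rule loss.regression_stationary[OF fin_h[OF h(1) h1] _ _ mom_h[OF h(1) h1] T_PDS[OF h(2)] min])
        (intro me_h[OF h(1) h1] measurable_compose[OF measurable_standardize] borel_measurable_continuous_onI continuous_intros)+
    moreover have "integrable (\<mu> \<Otimes>\<^sub>M \<nu>) (score h e)"
      unfolding score_def[abs_def] q_def r_def
      by (rule sm.integrable_regression_score[OF _ low]) (use g in simp)
    ultimately show ?thesis using mix[OF score_meas _ h(1) h1, of h e] by simp
  qed

  have at_right: "filterlim x (at_right 0) sequentially" if "\<And>n. 0 < x n" "x \<longlonglongrightarrow> 0" for x :: "nat \<Rightarrow> real"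
    using that by (intro tendsto_imp_filterlim_at_right always_eventually) auto
  have score_lim: "(\<lambda>n. score (x n) e (?\<phi> (y0, X0))) \<longlonglongrightarrow> loss.w (g * (norm z0)\<^sup>2) * (((\<Sigma>h ** X0) *v e) \<bullet> (g *\<^sub>R z0))"
    and T_lim: "(\<lambda>n. T (x n)) \<longlonglongrightarrow> g *\<^sub>R mat 1" and r_lim: "(\<lambda>n. r (x n) (?\<phi> (y0, X0))) \<longlonglongrightarrow> z0"
    and w_lim: "(\<lambda>n. loss.w (q (x n) (?\<phi> (y0, X0)))) \<longlonglongrightarrow> loss.w (g * (norm z0)\<^sup>2)"
    if x: "\<And>n. 0 < x n" "x \<longlonglongrightarrow> 0" for x :: "nat \<Rightarrow> real" and e
  proof -
    note xr = at_right[OF x]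
    show T: "(\<lambda>n. T (x n)) \<longlonglongrightarrow> g *\<^sub>R mat 1" by (rule filterlim_compose[OF limT xr])
    have d: "(\<lambda>n. \<delta> (x n)) \<longlonglongrightarrow> 0" by (rule filterlim_compose[OF lim\<delta> xr])
    have "(\<lambda>n. z0 - snd (?\<phi> (y0, X0)) *v \<delta> (x n)) \<longlonglongrightarrow> z0 - snd (?\<phi> (y0, X0)) *v 0"
      by (intro tendsto_intros mv.tendsto d)
    then show r: "(\<lambda>n. r (x n) (?\<phi> (y0, X0))) \<longlonglongrightarrow> z0" by (simp add: r_def sm.resid_def z0)
    have Tr: "(\<lambda>n. T (x n) *v r (x n) (?\<phi> (y0, X0))) \<longlonglongrightarrow> g *\<^sub>R z0"
      using mv.tendsto[OF T r] by (simp add: mv.scaleR_left)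
    have "(\<lambda>n. q (x n) (?\<phi> (y0, X0))) \<longlonglongrightarrow> z0 \<bullet> (g *\<^sub>R z0)"
      unfolding q_def by (intro tendsto_intros r Tr)
    then have "(\<lambda>n. q (x n) (?\<phi> (y0, X0))) \<longlonglongrightarrow> g * (norm z0)\<^sup>2" by (simp add: power2_norm_eq_inner)
    then show w: "(\<lambda>n. loss.w (q (x n) (?\<phi> (y0, X0)))) \<longlonglongrightarrow> loss.w (g * (norm z0)\<^sup>2)"
      using loss.continuous_w by (intro isCont_tendsto_compose[where g=loss.w]) (simp_all add: continuous_on_eq_continuous_at)
    show "(\<lambda>n. score (x n) e (?\<phi> (y0, X0))) \<longlonglongrightarrow> loss.w (g * (norm z0)\<^sup>2) * (((\<Sigma>h ** X0) *v e) \<bullet> (g *\<^sub>R z0))"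
      unfolding score_def snd_phi snd_conv by (intro tendsto_intros w Tr)
  qed
  define U where "U = loss.w (g * (norm z0)\<^sup>2)"
  have U: "U = u_fun \<rho>1 (c\<sigma> * norm z0)"
    using c\<sigma> by (simp add: U_def loss.w_def g_def real_sqrt_mult)
  define G where "G = (\<integral>s. transpose (snd s) ** \<Sigma>i ** snd s \<partial>P)"
  have quad: "e \<bullet> ((transpose X ** \<Sigma>i ** X) *v b) = ((\<Sigma>h ** X) *v e) \<bullet> ((\<Sigma>h ** X) *v b)" for X :: "real^'q^'k" and e b
    by (simp add: rt(4)[symmetric] matrix_vector_mul_assoc[symmetric] matrix_mul_assoc[symmetric]
        inner_matrix_vector_left symH del: transpose_matrix_vector)
  have intG: "integrable P (\<lambda>s. transpose (snd s) ** \<Sigma>i ** snd s)"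
  proof -
    obtain K1 where K1: "0 \<le> K1" "\<And>(a :: real^'k^'q) (b :: real^'q^'k). norm (a ** b) \<le> norm a * norm b * K1"
      using mm.nonneg_bounded by blast
    obtain K2 where K2: "0 \<le> K2" "\<And>(a :: real^'k^'q) (b :: real^'k^'k). norm (a ** b) \<le> norm a * norm b * K2"
      using mm.nonneg_bounded by blast
    obtain K3 where K3: "0 \<le> K3" "\<And>X :: real^'q^'k. norm (transpose X) \<le> norm X * K3"
      using bounded_linear.nonneg_bounded[OF bounded_linear_transpose] by blast
    let ?C = "K3 * norm \<Sigma>i * K2 * K1"
    have bd: "norm (transpose X ** \<Sigma>i ** X) \<le> ?C * (norm X)\<^sup>2" for X :: "real^'q^'k"
    proof -
      have "norm (transpose X ** \<Sigma>i ** X) \<le> norm (transpose X ** \<Sigma>i) * norm X * K1" by (rule K1)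
      also have "\<dots> \<le> ((norm X * K3) * norm \<Sigma>i * K2) * norm X * K1"
        using K1(1) K2(1) by (intro mult_right_mono order_trans[OF K2(2)] K3(2)) auto
      finally show ?thesis by (simp add: power2_eq_square mult_ac)
    qed
    have "continuous_on UNIV (\<lambda>s :: ('k, 'q) obs. transpose (snd s) ** \<Sigma>i ** snd s)"
      by (intro mm.continuous_on bounded_linear.continuous_on[OF bounded_linear_transpose] continuous_intros)
    then have m: "(\<lambda>s :: ('k, 'q) obs. transpose (snd s) ** \<Sigma>i ** snd s) \<in> borel_measurable P"
      by (intro meP borel_measurable_continuous_onI)
    show ?thesis
    proof (rule Bochner_Integration.integrable_bound[OF integrable_mult_right[OF moment', of ?C] m])
      show "AE s in P. norm (transpose (snd s) ** \<Sigma>i ** snd s) \<le> norm (?C * (norm (snd s))\<^sup>2)"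
        using bd K1(1) K2(1) K3(1) by (intro AE_I2) (simp add: abs_mult)
    qed
  qed
  have Gform: "e \<bullet> (G *v b) = (\<integral>s. ((\<Sigma>h ** snd s) *v e) \<bullet> ((\<Sigma>h ** snd s) *v b) \<partial>P)" for e b
  proof -
    have "bounded_linear (\<lambda>M :: real^'q^'q. e \<bullet> (M *v b))"
      by (rule bounded_linear_compose[OF bounded_linear_inner_right mv.bounded_linear_left])
    from integral_bounded_linear[OF this intG] show ?thesis unfolding G_def quad by simp
  qed
  have Gnu: "(\<integral>X. (X *v e) \<bullet> (X *v b) \<partial>\<nu>) = e \<bullet> (G *v b)" for e b
    unfolding Gform \<nu>_def by (rule integral_distr) (auto intro: meP snd_meas)
  \<comment> \<open>A vector in the kernel of \<open>G\<close> is annihilated by almost every \<open>X\<close>, hence zero by full rank.\<close>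
  have invG: "invertible G"
  proof -
    have "b = 0" if "G *v b = 0" for b
    proof -
      have "(\<integral>s. (norm ((\<Sigma>h ** snd s) *v b))\<^sup>2 \<partial>P) = 0"
        using Gform[of b b] that by (simp add: power2_norm_eq_inner)
      moreover have "integrable P (\<lambda>s. (norm ((\<Sigma>h ** snd s) *v b))\<^sup>2)"
      proof -
        have "bounded_linear (\<lambda>M :: real^'q^'q. b \<bullet> (M *v b))"
          by (rule bounded_linear_compose[OF bounded_linear_inner_right mv.bounded_linear_left])
        from integrable_bounded_linear[OF this intG] show ?thesis unfolding quad by (simp add: power2_norm_eq_inner)
      qed
      ultimately have "AE s in P. (norm ((\<Sigma>h ** snd s) *v b))\<^sup>2 = 0"
        by (subst (asm) integral_nonneg_eq_0_iff_AE) auto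
      then have "AE s in P. b = 0"
        using full_rank
      proof eventually_elim
        case (elim s)
        have "snd s *v b = S *v ((\<Sigma>h ** snd s) *v b)"
          by (simp add: matrix_vector_mul_assoc matrix_mul_assoc SH)
        then have "snd s *v b = snd s *v 0" using elim(1) by simp
        moreover have "inj ((*v) (snd s))" using elim(2) by (simp add: full_rank_injective)
        ultimately show "b = 0" by (rule injD[rotated])
      qed
      then show ?thesis by simp
    qed
    then show ?thesis by (metis invertible_left_inverse matrix_left_invertible_ker)
  qed
  define IF\<beta> where "IF\<beta> = (U / \<alpha>\<^sub>1) *\<^sub>R (matrix_inv G *v (transpose X0 *v (\<Sigma>h *v z0)))"
  have infl_\<beta>: "((\<lambda>h. \<delta> h /\<^sub>R h) \<longlongrightarrow> IF\<beta>) (at_right 0)"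
  proof (rule rate_at_right[OF ev_good])
    fix x :: "nat \<Rightarrow> real" and b \<eta>
    assume x: "\<And>n. 0 < x n" "\<And>n. good (x n)" "x \<longlonglongrightarrow> 0"
      and b: "(\<lambda>n. \<delta> (x n) /\<^sub>R (x n + norm (\<delta> (x n)))) \<longlonglongrightarrow> b"
      and \<eta>: "(\<lambda>n. x n / (x n + norm (\<delta> (x n)))) \<longlonglongrightarrow> \<eta>"
    define e where "e n = x n + norm (\<delta> (x n))" for n
    have e: "0 < e n" for n using x(1)[of n] by (simp add: e_def add_pos_nonneg)
    have \<delta>0: "(\<lambda>n. \<delta> (x n)) \<longlonglongrightarrow> 0" by (rule filterlim_compose[OF lim\<delta> at_right[OF x(1,3)]])
    \<comment> \<open>The stationarity equation divided by \<open>e n\<close>: in the limit it is linear in \<open>b\<close> and \<open>\<eta>\<close>.\<close>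
    have key: "g * \<alpha>\<^sub>1 * (v \<bullet> (G *v b)) = \<eta> * (U * (((\<Sigma>h ** X0) *v v) \<bullet> (g *\<^sub>R z0)))" for v
    proof -
      have "(\<lambda>n. (\<integral>s. score (x n) v s \<partial>(\<mu> \<Otimes>\<^sub>M \<nu>)) / e n) \<longlonglongrightarrow> - (g * sm.\<alpha> g * (\<integral>X. (X *v v) \<bullet> (X *v b) \<partial>\<nu>))"
        unfolding score_def q_def r_def
      proof (rule sm.regression_score_limit[OF g _ e])
        show "0 < g / 2" using g by simp
        show "transpose (T (x n)) = T (x n)" for n by (rule symT[OF x(2)])
        show "g / 2 * (norm y)\<^sup>2 \<le> y \<bullet> (T (x n) *v y)" for n y using x(2)[of n] by (simp add: good_def)
        show "(\<lambda>n. T (x n)) \<longlonglongrightarrow> g *\<^sub>R mat 1" by (rule T_lim[OF x(1,3)])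
        show "norm (\<delta> (x n)) \<le> e n" for n using x(1)[of n] by (simp add: e_def)
        show "(\<lambda>n. \<delta> (x n) /\<^sub>R e n) \<longlonglongrightarrow> b" using b by (simp add: e_def)
      qed (rule \<delta>0)
      then have lim: "(\<lambda>n. (1 - x n) * ((\<integral>s. score (x n) v s \<partial>(\<mu> \<Otimes>\<^sub>M \<nu>)) / e n) + (x n / e n) * score (x n) v (?\<phi> (y0, X0)))
        \<longlonglongrightarrow> (1 - 0) * (- (g * \<alpha>\<^sub>1 * (v \<bullet> (G *v b)))) + \<eta> * (U * (((\<Sigma>h ** X0) *v v) \<bullet> (g *\<^sub>R z0)))"
        unfolding \<alpha>1g Gnu U_def
        by (intro tendsto_intros x(3) score_lim[OF x(1,3)] \<eta>[folded e_def])
      have "(1 - x n) * ((\<integral>s. score (x n) v s \<partial>(\<mu> \<Otimes>\<^sub>M \<nu>)) / e n) + (x n / e n) * score (x n) v (?\<phi> (y0, X0)) = 0" for n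
      proof -
        have "(1 - x n) * ((\<integral>s. score (x n) v s \<partial>(\<mu> \<Otimes>\<^sub>M \<nu>)) / e n) + (x n / e n) * score (x n) v (?\<phi> (y0, X0))
          = ((1 - x n) * (\<integral>s. score (x n) v s \<partial>(\<mu> \<Otimes>\<^sub>M \<nu>)) + x n * score (x n) v (?\<phi> (y0, X0))) / e n"
          by (simp add: add_divide_distrib)
        then show ?thesis by (simp add: stat1[OF x(1,2)])
      qed
      with lim have "(1 - 0) * (- (g * \<alpha>\<^sub>1 * (v \<bullet> (G *v b)))) + \<eta> * (U * (((\<Sigma>h ** X0) *v v) \<bullet> (g *\<^sub>R z0))) = 0"
        by (simp add: LIMSEQ_const_iff)
      then show ?thesis by (simp only: diff_zero mult_1_left neg_eq_iff_add_eq_0[symmetric] minus_minus)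
    qed
    have "v \<bullet> (\<alpha>\<^sub>1 *\<^sub>R (G *v b)) = v \<bullet> ((\<eta> * U) *\<^sub>R (transpose X0 *v (\<Sigma>h *v z0)))" for v
    proof -
      have "((\<Sigma>h ** X0) *v v) \<bullet> z0 = v \<bullet> (transpose X0 *v (\<Sigma>h *v z0))"
        by (simp add: inner_matrix_vector_left matrix_transpose_mul symH matrix_vector_mul_assoc del: transpose_matrix_vector)
      then have "g * (\<alpha>\<^sub>1 * (v \<bullet> (G *v b))) = g * (\<eta> * U * (v \<bullet> (transpose X0 *v (\<Sigma>h *v z0))))"
        using key[of v] by (simp add: mult_ac del: transpose_matrix_vector)
      then show ?thesis using g by (simp del: transpose_matrix_vector)
    qed
    then have "\<alpha>\<^sub>1 *\<^sub>R (G *v b) = (\<eta> * U) *\<^sub>R (transpose X0 *v (\<Sigma>h *v z0))"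
      by (rule vector_eq_ldot[THEN iffD1, OF allI])
    then have "matrix_inv G *v (\<alpha>\<^sub>1 *\<^sub>R (G *v b)) = (\<eta> * U) *\<^sub>R (matrix_inv G *v (transpose X0 *v (\<Sigma>h *v z0)))"
      by (simp only: mv.scaleR_right)
    then have "\<alpha>\<^sub>1 *\<^sub>R b = (\<eta> * U) *\<^sub>R (matrix_inv G *v (transpose X0 *v (\<Sigma>h *v z0)))"
      by (simp add: mv.scaleR_right matrix_vector_mul_assoc matrix_inv_left[OF invG] del: transpose_matrix_vector)
    then have "(1 / \<alpha>\<^sub>1) *\<^sub>R (\<alpha>\<^sub>1 *\<^sub>R b) = (1 / \<alpha>\<^sub>1) *\<^sub>R ((\<eta> * U) *\<^sub>R (matrix_inv G *v (transpose X0 *v (\<Sigma>h *v z0))))"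
      by (rule arg_cong)
    then show "b = \<eta> *\<^sub>R IF\<beta>"
      using \<alpha>1 by (simp add: IF\<beta>_def del: transpose_matrix_vector)
  qed

  \<comment> \<open>Under the determinant constraint the shape can only be varied in the directions \<open>B h j\<close>, one for each
    coordinate \<open>j\<close> of the parameter.\<close>
  define Lt where "Lt j = \<Sigma>h ** L j ** \<Sigma>h" for j
  define B where "B h j = ?k *\<^sub>R (T h ** Lt j ** T h) - trace (T h ** Lt j) *\<^sub>R T h" for h j
  define sscore where "sscore h j s = loss.w (q h s) * (r h s \<bullet> (B h j *v r h s))" for h j s
  have sscore_meas: "sscore h j \<in> borel_measurable borel" for h j
    unfolding sscore_def[abs_def] q_def r_def by measurable
  have sscore_int: "integrable (\<mu> \<Otimes>\<^sub>M \<nu>) (sscore h j)" if "good h" for h j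
  proof -
    have low: "\<And>x. g / 2 * (norm x)\<^sup>2 \<le> x \<bullet> (T h *v x)" and g2: "0 < g / 2" using that g by (auto simp: good_def)
    have "sscore h j s = (\<Sum>i\<in>UNIV. \<Sum>l\<in>UNIV. B h j $ i $ l * (loss.w (q h s) * (r h s $ i * r h s $ l)))" for s
    proof -
      have "y \<bullet> (B h j *v y) = (\<Sum>i\<in>UNIV. \<Sum>l\<in>UNIV. B h j $ i $ l * (y $ i * y $ l))" for y :: "real^'k"
        by (simp add: inner_vec_def matrix_vector_mult_def sum_distrib_left mult_ac)
      then show ?thesis unfolding sscore_def by (simp only: sum_distrib_left mult.left_commute[of "loss.w _"])
    qed
    then have "sscore h j = (\<lambda>s. \<Sum>i\<in>UNIV. \<Sum>l\<in>UNIV. B h j $ i $ l * (loss.w (q h s) * (r h s $ i * r h s $ l)))"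
      by (rule ext)
    then show ?thesis
      unfolding q_def r_def
      by (simp only:) (intro Bochner_Integration.integrable_sum integrable_mult_right sm.integrable_weighted_scatter[OF g2 low])
  qed
  have stat2: "(1 - h) * (\<integral>s. sscore h j s \<partial>(\<mu> \<Otimes>\<^sub>M \<nu>)) + h * sscore h j (?\<phi> (y0, X0)) = 0"
    if h: "0 < h" "good h" and inner: "\<gamma> (Ph h) \<in> interior \<Theta>" for h j
  proof -
    have h1: "h < 1" and lm: "R_local_min \<rho>1 V \<Theta> (Ph h) (\<sigma> (Ph h)) (\<beta>1 (Ph h), \<gamma> (Ph h))" and \<sigma>h: "0 < \<sigma> (Ph h)"
      using h(2) by (auto simp: good_def)
    note d = dom[OF lm]
    define c where "c t = (det (linear_structure L (\<gamma> (Ph h) + t *\<^sub>R axis j 1)) powr (- 1 / ?k)) *\<^sub>R (\<gamma> (Ph h) + t *\<^sub>R axis j 1)" for t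
    note line = normalized_line[OF d(2,3)[unfolded Vl[OF d(1)]], of j, folded c_def]
    have evT: "\<forall>\<^sub>F t in nhds 0. c t \<in> \<Theta>"
    proof -
      have "\<forall>\<^sub>F t in at 0. c t \<in> interior \<Theta>"
        by (rule topological_tendstoD[OF line(2)]) (use inner in auto)
      then have "\<forall>\<^sub>F t in at 0. c t \<in> \<Theta>" by (rule eventually_mono) (use interior_subset in blast)
      then show ?thesis using line(1) d(1) by (auto simp: eventually_at_filter elim: eventually_mono)
    qed
    have evP: "\<forall>\<^sub>F t in nhds 0. V (c t) \<in> PDS" using evT by eventually_elim (use V(1) in blast)
    define T' where "T' t = (1 / (\<sigma> (Ph h))\<^sup>2) *\<^sub>R (S ** matrix_inv (linear_structure L (c t)) ** S)" for t
    have T'0: "T' 0 = T h" by (simp add: T'_def T_def A_def line(1) Vl[OF d(1)])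
    have PD: "\<forall>\<^sub>F t in nhds 0. T' t \<in> PDS"
      using evT evP
    proof eventually_elim
      case (elim t)
      then show ?case unfolding T'_def
        using \<sigma>h by (intro PDS_scaleR PDS_congruence PDS_inv S) (auto simp: Vl)
    qed
    have V0c: "linear_structure L (c 0) = V (\<gamma> (Ph h))" by (simp add: line(1) Vl[OF d(1)])
    have dT: "(T' has_vector_derivative (- ((\<sigma> (Ph h))\<^sup>2 / ?k)) *\<^sub>R B h j) (at 0)"
    proof -
      have inv: "((\<lambda>t. matrix_inv (linear_structure L (c t))) has_vector_derivative
          - (A h ** (L j - (trace (A h ** L j) / ?k) *\<^sub>R V (\<gamma> (Ph h))) ** A h)) (at 0)"
        using matrix_inv_has_vector_derivative[OF line(4)] d(2)
        by (simp add: V0c A_def Vl[OF d(1), symmetric])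
      have lin: "bounded_linear (\<lambda>M :: real^'k^'k. (1 / (\<sigma> (Ph h))\<^sup>2) *\<^sub>R (S ** M ** S))"
        by (intro bounded_linear_compose[OF bounded_linear_scaleR_right]
            bounded_linear_compose[OF mm.bounded_linear_left mm.bounded_linear_right])
      have AV: "A h ** V (\<gamma> (Ph h)) = mat 1" unfolding A_def by (rule matrix_inv_left[OF PDS_invertible[OF d(2)]])
      show ?thesis
        using bounded_linear.has_vector_derivative[OF lin inv]
        unfolding standardized_direction[OF AV HS SH less_imp_neq[OF \<sigma>h, symmetric], of "L j"]
        unfolding T'_def[abs_def, symmetric] B_def T_def Lt_def .
    qed
    have "\<forall>\<^sub>F t in at 0. (case (\<beta>1 (Ph h), \<gamma> (Ph h)) of (\<beta>, \<gamma>) \<Rightarrow> R_crit \<rho>1 (Ph h) (\<sigma> (Ph h)) \<beta> (V \<gamma>))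
      \<le> (case (\<beta>1 (Ph h), c t) of (\<beta>, \<gamma>) \<Rightarrow> R_crit \<rho>1 (Ph h) (\<sigma> (Ph h)) \<beta> (V \<gamma>))"
    proof (rule eventually_local_min_along_curve[OF lm[unfolded R_local_min_def]])
      show "((\<lambda>t. (\<beta>1 (Ph h), c t)) \<longlongrightarrow> (\<beta>1 (Ph h), \<gamma> (Ph h))) (at (0::real))"
        by (intro tendsto_intros line(2))
      have "\<forall>\<^sub>F t in nhds 0. (\<beta>1 (Ph h), c t) \<in> param_domain V \<Theta>"
        using evT evP line(3) by eventually_elim (auto simp: param_domain_def Vl)
      then show "\<forall>\<^sub>F t in at 0. (\<beta>1 (Ph h), c t) \<in> param_domain V \<Theta>"
        by (auto simp: eventually_at_filter elim: eventually_mono)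
    qed
    moreover have "\<forall>\<^sub>F t in at 0. c t \<in> \<Theta>" using evT by (auto simp: eventually_at_filter elim: eventually_mono)
    ultimately have min: "\<forall>\<^sub>F t in at 0. (\<integral>s. \<rho>1 (sqrt (r h (?\<phi> s) \<bullet> (T' 0 *v r h (?\<phi> s)))) \<partial>Ph h)
      \<le> (\<integral>s. \<rho>1 (sqrt (r h (?\<phi> s) \<bullet> (T' t *v r h (?\<phi> s)))) \<partial>Ph h)"
    proof eventually_elim
      case (elim t)
      then show ?case
        by (simp add: crit[OF h(2)] T'0 T_def A_def T'_def[of t] Vl[OF elim(2)] r_def sm.resid_def \<delta>_def)
    qed
    have rm: "(\<lambda>s. r h (?\<phi> s)) \<in> borel_measurable (Ph h)"
      unfolding r_def by (intro me_h[OF h(1) h1] measurable_compose[OF measurable_standardize] sm.measurable_resid)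
    from loss.shape_stationary[OF fin_h[OF h(1) h1] rm PD dT min]
    have "(\<integral>s. (- ((\<sigma> (Ph h))\<^sup>2 / ?k)) * sscore h j (?\<phi> s) \<partial>Ph h) = 0"
      unfolding T'0 sscore_def q_def by (simp add: mv.minus_left mv.scaleR_left mult_ac)
    then have "(\<integral>s. sscore h j (?\<phi> s) \<partial>Ph h) = 0"
      unfolding integral_mult_right_zero using \<sigma>h by simp
    then show ?thesis using mix[OF sscore_meas sscore_int[OF h(2)] h(1) h1, of j] by simp
  qed
  define M where "M = transpose Lm ** kronecker \<Sigma>i \<Sigma>i ** Lm"
  have symSi: "transpose \<Sigma>i = \<Sigma>i" unfolding \<Sigma>i_def by (rule PDS_sym[OF PDS_inv[OF \<Sigma>]])
  have Mv: "(M *v v) $ j = L j \<bullet> (\<Sigma>i ** linear_structure L v ** \<Sigma>i)" for v j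
  proof -
    have "M *v v = transpose Lm *v vectorize (\<Sigma>i ** linear_structure L v ** \<Sigma>i)"
      by (simp only: M_def matrix_vector_mul_assoc[symmetric] Lm_def vectorized_columns_mult linear_structure_def[symmetric]
          kronecker_vectorize symSi)
    then show ?thesis by (simp only: Lm_def transpose_vectorized_columns_mult)
  qed
  have conj: "L j \<bullet> (\<Sigma>i ** W ** \<Sigma>i) = Lt j \<bullet> (\<Sigma>h ** W ** \<Sigma>h)" for j W
  proof -
    have "Lt j \<bullet> (\<Sigma>h ** W ** \<Sigma>h) = (\<Sigma>h ** L j) \<bullet> (\<Sigma>h ** W ** \<Sigma>h ** \<Sigma>h)"
      unfolding Lt_def by (subst inner_mult_right) (simp only: symH)
    also have "\<dots> = L j \<bullet> (\<Sigma>h ** (\<Sigma>h ** W ** \<Sigma>h ** \<Sigma>h))"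
      by (subst inner_mult_left) (simp only: symH)
    finally show ?thesis by (simp only: rt(4)[symmetric] matrix_mul_assoc)
  qed
  \<comment> \<open>The linear structure takes the value \<open>\<Sigma>\<close> at \<open>\<theta>s\<close>, and \<open>\<Sigma>\<close> standardizes to the identity.\<close>
  have "M *v \<theta>s = (\<chi> j. trace (Lt j))"
  proof -
    have "(M *v \<theta>s) $ j = trace (Lt j)" for j
    proof -
      have "linear_structure L \<theta>s = \<Sigma>" using Vl[OF \<theta>s] by (simp add: \<Sigma>_def)
      moreover have "\<Sigma>h ** \<Sigma> ** \<Sigma>h = (\<Sigma>h ** S) ** (S ** \<Sigma>h)"
        by (simp only: pd_sqrt_square[OF \<Sigma>, folded S_def, symmetric] matrix_mul_assoc)
      ultimately have "(M *v \<theta>s) $ j = Lt j \<bullet> mat 1" unfolding Mv conj by (simp add: HS SH)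
      then show ?thesis by (simp only: inner_mat_1)
    qed
    then show ?thesis by (simp add: vec_eq_iff)
  qed
  note M\<theta> = this
  define p where "p = transpose Lm *v (kronecker \<Sigma>h \<Sigma>h *v vectorize (outer z0))"
  have pj: "p $ j = z0 \<bullet> (Lt j *v z0)" for j
  proof -
    have "p $ j = L j \<bullet> (\<Sigma>h ** outer z0 ** \<Sigma>h)"
      unfolding p_def by (simp only: kronecker_vectorize symH Lm_def transpose_vectorized_columns_mult)
    also have "\<dots> = (\<Sigma>h ** L j) \<bullet> (outer z0 ** \<Sigma>h)"
      by (subst inner_mult_left) (simp only: symH matrix_mul_assoc)
    also have "\<dots> = Lt j \<bullet> outer z0"
      unfolding Lt_def by (subst inner_mult_right) (simp only: symH)
    finally show ?thesis by (simp only: inner_outer)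
  qed
  define IF\<gamma> where "IF\<gamma> = (?k * U / ((\<sigma> P)\<^sup>2 * \<gamma>\<^sub>1)) *\<^sub>R (matrix_inv M *v p) - (U * (norm z0)\<^sup>2 / ((\<sigma> P)\<^sup>2 * \<gamma>\<^sub>1)) *\<^sub>R \<theta>s"
  have infl_\<gamma>: "((\<lambda>h. (\<gamma> (Ph h) - \<gamma> P) /\<^sub>R h) \<longlongrightarrow> IF\<gamma>) (at_right 0)"
    if \<gamma>1: "0 < \<gamma>\<^sub>1" and rank: "rank Lm = CARD('l)" and int: "\<gamma> P \<in> interior \<Theta>"
  proof -
    have lin_inner: "linear_structure L v \<bullet> Y = (\<Sum>j\<in>UNIV. v $ j * (L j \<bullet> Y))" for v Y
      by (simp add: linear_structure_def inner_sum_left)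
    have invM: "invertible M"
    proof -
      have "v = 0" if "M *v v = 0" for v
      proof -
        let ?W = "linear_structure L v"
        have "(\<Sum>j\<in>UNIV. v $ j * (M *v v) $ j) = ?W \<bullet> (\<Sigma>i ** ?W ** \<Sigma>i)"
          unfolding Mv using lin_inner[of v "\<Sigma>i ** ?W ** \<Sigma>i"] by (rule sym)
        also have "\<dots> = (\<Sigma>h ** ?W ** \<Sigma>h) \<bullet> (\<Sigma>h ** ?W ** \<Sigma>h)"
        proof -
          have "(\<Sigma>h ** ?W ** \<Sigma>h) \<bullet> (\<Sigma>h ** ?W ** \<Sigma>h) = (\<Sigma>h ** ?W) \<bullet> (\<Sigma>h ** ?W ** \<Sigma>h ** \<Sigma>h)"
            by (subst inner_mult_right) (simp only: symH)
          also have "\<dots> = ?W \<bullet> (\<Sigma>h ** (\<Sigma>h ** ?W ** \<Sigma>h ** \<Sigma>h))"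
            by (subst inner_mult_left) (simp only: symH)
          finally show ?thesis by (simp only: rt(4)[symmetric] matrix_mul_assoc)
        qed
        finally have "\<Sigma>h ** ?W ** \<Sigma>h = 0" using that by simp
        then have "S ** (\<Sigma>h ** ?W ** \<Sigma>h) ** S = 0" by simp
        moreover have "S ** (\<Sigma>h ** ?W ** \<Sigma>h) ** S = (S ** \<Sigma>h) ** ?W ** (\<Sigma>h ** S)" by (simp only: matrix_mul_assoc)
        ultimately have "?W = 0" by (simp add: SH HS)
        then have "Lm *v v = Lm *v 0"
          by (simp add: Lm_def vectorized_columns_mult linear_structure_def vectorize_def vec_eq_iff)
        moreover have "inj ((*v) Lm)" using rank by (simp add: full_rank_injective)
        ultimately show "v = 0" by (rule injD[rotated])
      qed
      then show ?thesis by (metis invertible_left_inverse matrix_left_invertible_ker)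
    qed
    \<comment> \<open>The rate already found for the regression parameter makes \<open>\<delta> h\<close> of order \<open>h\<close>; at first order it then
      drops out of the shape equation by symmetry.\<close>
    define K where "K = norm IF\<beta> + 1"
    define nice where "nice h \<longleftrightarrow> good h \<and> \<gamma> (Ph h) \<in> interior \<Theta> \<and> norm (\<delta> h) \<le> K * h \<and> g / 2 \<le> a / (\<sigma> (Ph h))\<^sup>2" for h
    have lim_g: "((\<lambda>h. a / (\<sigma> (Ph h))\<^sup>2) \<longlongrightarrow> g) (at_right 0)"
      unfolding ga using \<sigma>P by (intro tendsto_intros lim\<sigma>) auto
    have ev_nice: "\<forall>\<^sub>F h in at_right 0. nice h"
    proof -
      have 1: "\<forall>\<^sub>F h in at_right 0. \<gamma> (Ph h) \<in> interior \<Theta>"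
        by (rule topological_tendstoD[OF lim\<gamma> _ int]) simp
      have 2: "\<forall>\<^sub>F h in at_right 0. norm (\<delta> h /\<^sub>R h) < K"
        by (rule order_tendstoD(2)[OF tendsto_norm[OF infl_\<beta>]]) (simp add: K_def)
      have 3: "\<forall>\<^sub>F h in at_right 0. g / 2 < a / (\<sigma> (Ph h))\<^sup>2"
        by (rule order_tendstoD(1)[OF lim_g]) (use g in simp)
      have 4: "\<forall>\<^sub>F h in at_right 0. 0 < (h::real)" by (simp add: eventually_at_right_less)
      from ev_good 1 2 3 4 show ?thesis
        by eventually_elim (auto simp: nice_def divide_inverse[symmetric] pos_divide_less_eq less_imp_le field_simps)
    qed
    show ?thesis
    proof (rule rate_at_right[OF ev_nice])
      fix x :: "nat \<Rightarrow> real" and b \<eta>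
      let ?f = "\<lambda>h. \<gamma> (Ph h) - \<gamma> P"
      assume x: "\<And>n. 0 < x n" "\<And>n. nice (x n)" "x \<longlonglongrightarrow> 0"
        and b: "(\<lambda>n. ?f (x n) /\<^sub>R (x n + norm (?f (x n)))) \<longlonglongrightarrow> b"
        and \<eta>: "(\<lambda>n. x n / (x n + norm (?f (x n)))) \<longlonglongrightarrow> \<eta>"
      define e where "e n = x n + norm (?f (x n))" for n
      have e: "0 < e n" for n using x(1)[of n] by (simp add: e_def add_pos_nonneg)
      have good: "good (x n)" for n using x(2)[of n] by (simp add: nice_def)
      note xr = at_right[OF x(1,3)]
      have f0: "(\<lambda>n. ?f (x n)) \<longlonglongrightarrow> 0"
        using filterlim_compose[OF lim\<gamma> xr] by (simp add: LIM_zero_iff)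
      have e0: "e \<longlonglongrightarrow> 0"
        unfolding e_def[abs_def] using tendsto_add[OF x(3) tendsto_norm[OF f0]] by simp
      define W where "W n = \<Sigma>h ** linear_structure L (?f (x n)) ** \<Sigma>h" for n
      define W' where "W' = \<Sigma>h ** linear_structure L b ** \<Sigma>h"
      have \<gamma>dom: "\<gamma> (Ph (x n)) \<in> \<Theta>" "V (\<gamma> (Ph (x n))) \<in> PDS" "det (V (\<gamma> (Ph (x n)))) = 1" for n
        using good[of n] dom by (auto simp: good_def)
      have diffV: "linear_structure L (?f (x n)) = V (\<gamma> (Ph (x n))) - V (\<gamma> P)" for n
        unfolding linear_diff[OF bounded_linear.linear[OF bounded_linear_linear_structure]] Vl[OF \<gamma>dom(1)] Vl[OF domP(1)] ..
      have Wlim: "(\<lambda>n. W n /\<^sub>R e n) \<longlonglongrightarrow> W'"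
      proof -
        have "(\<lambda>n. \<Sigma>h ** linear_structure L (?f (x n) /\<^sub>R e n) ** \<Sigma>h) \<longlonglongrightarrow> W'"
          unfolding W'_def
          by (intro mm.tendsto tendsto_const bounded_linear.tendsto[OF bounded_linear_linear_structure] b[folded e_def])
        then show ?thesis
          by (simp add: W_def linear_cmul[OF bounded_linear.linear[OF bounded_linear_linear_structure]] mm.scaleR_left mm.scaleR_right)
      qed
      have symLS: "transpose (linear_structure L v) = linear_structure L v" for v
        by (simp add: linear_structure_def transpose_sum transpose_scaleR L)
      have symW': "transpose W' = W'"
        unfolding W'_def by (simp add: matrix_transpose_mul symH symLS matrix_mul_assoc)
      \<comment> \<open>The determinant constraint: the limiting direction is tangent to the level set.\<close>
      have trW': "trace W' = 0"
      proof -
        interpret lin: bounded_linear "linear_structure L" by (rule bounded_linear_linear_structure)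
        have "((\<lambda>d. V (\<gamma> P) + linear_structure L d) has_derivative linear_structure L) (at 0)"
          by (auto intro!: derivative_eq_intros bounded_linear_imp_has_derivative[OF bounded_linear_linear_structure])
        then have der: "((\<lambda>d. det (V (\<gamma> P) + linear_structure L d)) has_derivative
            (\<lambda>d. det (V (\<gamma> P)) * trace (matrix_inv (V (\<gamma> P)) ** linear_structure L d))) (at 0)"
          by (rule has_derivative_compose) (use det_has_derivative[OF PDS_invertible[OF domP(2)]] in \<open>simp add: lin.zero\<close>)
        have lev: "det (V (\<gamma> P) + linear_structure L (?f (x n))) = det (V (\<gamma> P) + linear_structure L 0)" for n
          unfolding diffV by (simp add: lin.zero \<gamma>dom(3) domP(3))
        have "det (V (\<gamma> P)) * trace (matrix_inv (V (\<gamma> P)) ** linear_structure L b) = 0"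
          by (rule derivative_vanishes_along_level_set[OF der lev f0 e _ b[folded e_def]]) (use x(1) in \<open>simp add: e_def less_imp_le\<close>)
        then have "trace (\<Sigma>i ** linear_structure L b) = 0"
          using a by (simp add: domP(3) A0 mm.scaleR_left trace_scaleR)
        moreover have "trace W' = trace (\<Sigma>i ** linear_structure L b)"
          unfolding W'_def trace_mul_sym[of "\<Sigma>h ** linear_structure L b" \<Sigma>h]
          by (simp only: rt(4)[symmetric] matrix_mul_assoc)
        ultimately show ?thesis by simp
      qed
      \<comment> \<open>The resolvent identity writes the perturbation of \<open>T\<close> as a multiple of the identity, which carries the
        effect of the scale, and a term linear in the perturbation of \<open>\<gamma>\<close>.\<close>
      have TW: "T (x n) = (a / (\<sigma> (Ph (x n)))\<^sup>2) *\<^sub>R mat 1 - a *\<^sub>R (T (x n) ** W n)" for n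
      proof -
        let ?s = "1 / (\<sigma> (Ph (x n)))\<^sup>2" and ?F = "linear_structure L (?f (x n))"
        have "A (x n) - a *\<^sub>R \<Sigma>i = - (A (x n) ** ?F ** (a *\<^sub>R \<Sigma>i))"
          using matrix_inv_diff[OF PDS_invertible[OF domP(2)] PDS_invertible[OF \<gamma>dom(2)], of n]
          unfolding A0 A_def diffV .
        then have "A (x n) = a *\<^sub>R \<Sigma>i - a *\<^sub>R (A (x n) ** ?F ** \<Sigma>i)"
          by (simp add: mm.scaleR_right algebra_simps)
        then have "T (x n) = ?s *\<^sub>R (S ** (a *\<^sub>R \<Sigma>i - a *\<^sub>R (A (x n) ** ?F ** \<Sigma>i)) ** S)"
          unfolding T_def by simp
        also have "\<dots> = (a * ?s) *\<^sub>R (S ** \<Sigma>i ** S) - (a * ?s) *\<^sub>R (S ** A (x n) ** ?F ** \<Sigma>i ** S)"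
          by (simp add: mm.diff_left mm.diff_right mm.scaleR_left mm.scaleR_right scaleR_diff_right matrix_mul_assoc mult.commute)
        also have "S ** A (x n) ** ?F ** \<Sigma>i ** S = (S ** A (x n) ** S) ** W n"
        proof -
          have "(S ** A (x n) ** S) ** W n = S ** A (x n) ** (S ** \<Sigma>h) ** ?F ** \<Sigma>h"
            by (simp only: W_def matrix_mul_assoc)
          moreover have "S ** A (x n) ** ?F ** \<Sigma>i ** S = S ** A (x n) ** ?F ** \<Sigma>h ** (\<Sigma>h ** S)"
            by (simp only: rt(4)[symmetric] matrix_mul_assoc)
          ultimately show ?thesis by (simp add: SH HS)
        qed
        finally show ?thesis unfolding SiS T_def mm.scaleR_left scaleR_scaleR times_divide_eq_right mult_1_right .
      qed
      \<comment> \<open>The shape equation divided by \<open>e n\<close>, in the limit.  The scale has no effect at first order because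
        \<open>B h j\<close> is orthogonal to the identity at \<open>T h = g I\<close>.\<close>
      have sens: "a * g * \<gamma>\<^sub>1 * (Lt j \<bullet> W') = \<eta> * (U * (g\<^sup>2 * (?k * (z0 \<bullet> (Lt j *v z0)) - trace (Lt j) * (norm z0)\<^sup>2)))" for j
      proof -
        have symLt: "transpose (Lt j) = Lt j"
          unfolding Lt_def by (simp add: matrix_transpose_mul symH L matrix_mul_assoc)
        have \<delta>lim: "(\<lambda>n. \<delta> (x n) /\<^sub>R e n) \<longlonglongrightarrow> \<eta> *\<^sub>R IF\<beta>"
        proof -
          have "(\<lambda>n. (x n / e n) *\<^sub>R (\<delta> (x n) /\<^sub>R x n)) \<longlonglongrightarrow> \<eta> *\<^sub>R IF\<beta>"
            by (intro tendsto_intros \<eta>[folded e_def] filterlim_compose[OF infl_\<beta> xr])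
          moreover have "(x n / e n) *\<^sub>R (\<delta> (x n) /\<^sub>R x n) = \<delta> (x n) /\<^sub>R e n" for n
            using x(1)[of n] by (simp add: divide_inverse)
          ultimately show ?thesis by (simp only:)
        qed
        have K0: "0 \<le> K" by (simp add: K_def)
        have \<delta>le: "norm (\<delta> (x n)) \<le> K * e n" for n
        proof -
          have "norm (\<delta> (x n)) \<le> K * x n" using x(2)[of n] by (simp add: nice_def)
          also have "\<dots> \<le> K * e n" using K0 by (intro mult_left_mono) (simp_all add: e_def)
          finally show ?thesis .
        qed
        have glim: "(\<lambda>n. a / (\<sigma> (Ph (x n)))\<^sup>2) \<longlonglongrightarrow> g" by (rule filterlim_compose[OF lim_g xr])
        have "(\<lambda>n. (\<integral>s. sscore (x n) j s \<partial>(\<mu> \<Otimes>\<^sub>M \<nu>)) / e n) \<longlonglongrightarrow> - (a * g * sm.\<gamma>c g * (Lt j \<bullet> W'))"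
          unfolding sscore_def q_def r_def B_def
        proof (rule sm.shape_score_limit[OF g glim _ _ e _ T_lim[OF x(1,3)] _ TW \<delta>le e0 \<delta>lim Wlim symW' trW' symLt])
          show "0 < g / 2" using g by simp
          show "g / 2 \<le> a / (\<sigma> (Ph (x n)))\<^sup>2" for n using x(2)[of n] by (simp add: nice_def)
          show "transpose (T (x n)) = T (x n)" for n by (rule symT[OF good])
          show "g / 2 * (norm y)\<^sup>2 \<le> y \<bullet> (T (x n) *v y)" for n y using good[of n] by (simp add: good_def)
        qed
        moreover have "(\<lambda>n. sscore (x n) j (?\<phi> (y0, X0))) \<longlonglongrightarrow>
            U * (z0 \<bullet> ((?k *\<^sub>R ((g *\<^sub>R mat 1) ** Lt j ** (g *\<^sub>R mat 1)) - trace ((g *\<^sub>R mat 1) ** Lt j) *\<^sub>R (g *\<^sub>R mat 1)) *v z0))"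
          unfolding sscore_def B_def U_def
          by (intro tendsto_intros w_lim[OF x(1,3)] r_lim[OF x(1,3)] mv.tendsto mm.tendsto T_lim[OF x(1,3)]
              bounded_linear.tendsto[OF bounded_linear_trace])
        moreover have "z0 \<bullet> ((?k *\<^sub>R ((g *\<^sub>R mat 1) ** Lt j ** (g *\<^sub>R mat 1)) - trace ((g *\<^sub>R mat 1) ** Lt j) *\<^sub>R (g *\<^sub>R mat 1)) *v z0)
            = g\<^sup>2 * (?k * (z0 \<bullet> (Lt j *v z0)) - trace (Lt j) * (norm z0)\<^sup>2)"
          unfolding power2_norm_eq_inner
          by (simp add: mm.scaleR_left mm.scaleR_right trace_scaleR mv.diff_left mv.scaleR_left inner_diff_right
              power2_eq_square algebra_simps)
        ultimately have "(\<lambda>n. (1 - x n) * ((\<integral>s. sscore (x n) j s \<partial>(\<mu> \<Otimes>\<^sub>M \<nu>)) / e n) + (x n / e n) * sscore (x n) j (?\<phi> (y0, X0)))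
          \<longlonglongrightarrow> (1 - 0) * (- (a * g * \<gamma>\<^sub>1 * (Lt j \<bullet> W'))) + \<eta> * (U * (g\<^sup>2 * (?k * (z0 \<bullet> (Lt j *v z0)) - trace (Lt j) * (norm z0)\<^sup>2)))"
          unfolding \<gamma>1g by (intro tendsto_intros x(3) \<eta>[folded e_def]) simp_all
        moreover have "(1 - x n) * ((\<integral>s. sscore (x n) j s \<partial>(\<mu> \<Otimes>\<^sub>M \<nu>)) / e n) + (x n / e n) * sscore (x n) j (?\<phi> (y0, X0)) = 0" for n
        proof -
          have "(1 - x n) * ((\<integral>s. sscore (x n) j s \<partial>(\<mu> \<Otimes>\<^sub>M \<nu>)) / e n) + (x n / e n) * sscore (x n) j (?\<phi> (y0, X0))
            = ((1 - x n) * (\<integral>s. sscore (x n) j s \<partial>(\<mu> \<Otimes>\<^sub>M \<nu>)) + x n * sscore (x n) j (?\<phi> (y0, X0))) / e n"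
            by (simp add: add_divide_distrib)
          also have "\<dots> = 0" using stat2[OF x(1) good, of n j] x(2)[of n] by (simp add: nice_def)
          finally show ?thesis .
        qed
        ultimately have "(1 - 0) * (- (a * g * \<gamma>\<^sub>1 * (Lt j \<bullet> W'))) + \<eta> * (U * (g\<^sup>2 * (?k * (z0 \<bullet> (Lt j *v z0)) - trace (Lt j) * (norm z0)\<^sup>2))) = 0"
          by (simp add: LIMSEQ_const_iff)
        then show ?thesis by simp
      qed
      let ?d = "(\<sigma> P)\<^sup>2 * \<gamma>\<^sub>1"
      have d0: "?d \<noteq> 0" using \<sigma>P \<gamma>1 by simp
      have "?d *\<^sub>R (M *v b) = (\<eta> * U) *\<^sub>R (?k *\<^sub>R p - (norm z0)\<^sup>2 *\<^sub>R (M *v \<theta>s))"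
      proof -
        have "?d * (M *v b) $ j = \<eta> * U * (?k * p $ j - (norm z0)\<^sup>2 * (M *v \<theta>s) $ j)" for j
        proof -
          have ag: "a = g * (\<sigma> P)\<^sup>2" using ga \<sigma>P by simp
          have "(M *v b) $ j = Lt j \<bullet> W'" unfolding Mv conj W'_def ..
          then have "g\<^sup>2 * (?d * (M *v b) $ j) = g\<^sup>2 * (\<eta> * U * (?k * p $ j - (norm z0)\<^sup>2 * (M *v \<theta>s) $ j))"
            using sens[of j] unfolding ag pj M\<theta> by (simp add: power2_eq_square algebra_simps)
          then show ?thesis using g by simp
        qed
        then show ?thesis by (simp add: vec_eq_iff)
      qed
      then have "matrix_inv M *v (?d *\<^sub>R (M *v b)) = matrix_inv M *v ((\<eta> * U) *\<^sub>R (?k *\<^sub>R p - (norm z0)\<^sup>2 *\<^sub>R (M *v \<theta>s)))"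
        by (rule arg_cong)
      then have "?d *\<^sub>R b = (\<eta> * U) *\<^sub>R (?k *\<^sub>R (matrix_inv M *v p) - (norm z0)\<^sup>2 *\<^sub>R \<theta>s)"
        by (simp only: mv.scaleR_right mv.diff_right matrix_vector_mul_assoc matrix_inv_left[OF invM] matrix_vector_mul_lid)
      then have "(1 / ?d) *\<^sub>R (?d *\<^sub>R b) = (1 / ?d) *\<^sub>R ((\<eta> * U) *\<^sub>R (?k *\<^sub>R (matrix_inv M *v p) - (norm z0)\<^sup>2 *\<^sub>R \<theta>s))"
        by (rule arg_cong)
      moreover have "(1 / ?d) *\<^sub>R (?d *\<^sub>R b) = b" using d0 by simp
      ultimately have "b = (1 / ?d) *\<^sub>R ((\<eta> * U) *\<^sub>R (?k *\<^sub>R (matrix_inv M *v p) - (norm z0)\<^sup>2 *\<^sub>R \<theta>s))" by simp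
      then show "b = \<eta> *\<^sub>R IF\<gamma>"
        unfolding IF\<gamma>_def scaleR_diff_right scaleR_scaleR by (simp add: mult_ac)
    qed
  qed
  \<comment> \<open>The coefficient of \<open>\<theta>s\<close>: \<open>v (c\<sigma> |z0|) = U c\<sigma>\<^sup>2 |z0|\<^sup>2\<close> and \<open>c\<sigma>\<^sup>2 = a / (\<sigma> P)\<^sup>2\<close>.\<close>
  have final_v: "v_fun \<rho>1 (c\<sigma> * norm z0) / (det \<Sigma> powr (1 / CARD('k)) * \<gamma>\<^sub>1) = U * (norm z0)\<^sup>2 / ((\<sigma> P)\<^sup>2 * \<gamma>\<^sub>1)"
  proof -
    have "v_fun \<rho>1 (c\<sigma> * norm z0) = U * (g * (norm z0)\<^sup>2)"
      unfolding v_fun_def loss.deriv_rho_eq U g_def by (simp add: power2_eq_square mult_ac)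
    then show ?thesis unfolding ga a_def[symmetric] using a by simp
  qed
  show ?thesis
    unfolding has_influence_def Ph_def[symmetric] at_P(1)
  proof (intro conjI impI)
    show "((\<lambda>h. (\<beta>1 (Ph h) - \<beta>s) /\<^sub>R h) \<longlongrightarrow> (u_fun \<rho>1 (c\<sigma> * norm z0) / \<alpha>\<^sub>1) *\<^sub>R
        (matrix_inv (\<integral>s. transpose (snd s) ** \<Sigma>i ** snd s \<partial>P) *v (transpose X0 *v (\<Sigma>h *v z0)))) (at_right 0)"
      using infl_\<beta> unfolding IF\<beta>_def \<delta>_def U G_def .
    assume "0 < \<gamma>\<^sub>1" "rank Lm = CARD('l)" "\<gamma> P \<in> interior \<Theta>"
    from infl_\<gamma>[OF this] show "((\<lambda>h. (\<gamma> (Ph h) - \<gamma> P) /\<^sub>R h) \<longlongrightarrow>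
        (CARD('k) * u_fun \<rho>1 (c\<sigma> * norm z0) / ((\<sigma> P)\<^sup>2 * \<gamma>\<^sub>1)) *\<^sub>R
          (matrix_inv (transpose Lm ** kronecker \<Sigma>i \<Sigma>i ** Lm)
            *v (transpose Lm *v (kronecker \<Sigma>h \<Sigma>h *v vectorize (outer z0))))
        - (v_fun \<rho>1 (c\<sigma> * norm z0) / (det \<Sigma> powr (1 / CARD('k)) * \<gamma>\<^sub>1)) *\<^sub>R \<theta>s) (at_right 0)"
      unfolding final_v IF\<gamma>_def M_def p_def U .
  qed
qed

end
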